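(* Let $d\ge1$ and let $\mathbf H_{\boldsymbol\Lambda}$ be the random two-particle operator described in the context, satisfying (D), (E0), (E1), (E2), (E3), (E4) with range constant $R$. Then for every interval $I=[a,b]\subset\mathbb R$ there exists a constant $C_2(I)>0$ such that for every pair of sufficiently distant boxes $\boldsymbol\Lambda=\Lambda_{L_1}(u_1)\times\Lambda_{L_2}(u_2)$, $\boldsymbol\Lambda'=\Lambda_{L_1'}(u_1')\times\Lambda_{L_2'}(u_2')$ (with $L_1,L_2,L_1',L_2'>1$) and every $\epsilon\in(0,1)$, $$\mathbb P\Big(\operatorname{dist}\big[\Sigma(\mathbf H_{\boldsymbol\Lambda})\cap I,\ \Sigma(\mathbf H_{\boldsymbol\Lambda'})\cap I\big]\le\epsilon\Big)\le C_2(I)\,|\boldsymbol\Lambda|\,|\boldsymbol\Lambda'|\,\max_{j=1,2}\max\big[|\Pi_j\boldsymbol\Lambda|,|\Pi_j\boldsymbol\Lambda'|\big]\,\nu(2\epsilon),$$ where $\Sigma(\cdot)$ denotes the (discrete) spectrum, $\operatorname{dist}$ is the distance between subsets of $\mathbb R$, $|\boldsymbol\Lambda|$ is Lebesgue volume in $\mathbb R^{2d}$, and $|\Pi_j\boldsymbol\Lambda|$ is the Lebesgue volume in $\mathbb R^d$ of the projection $\Pi_j\boldsymbol\Lambda$ of $\boldsymbol\Lambda$ onto the $j$-th factor of $\mathbb R^d\times\mathbb R^d$.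
   Context: For $L>0$ and $v=(v^{(1)},\dots,v^{(d)})\in\mathbb R^d$, $\Lambda_L(v)=\prod_{i=1}^d[v^{(i)}-L,v^{(i)}+L]$. A (two-particle) box is $\boldsymbol\Lambda_{L_1,L_2}(\mathbf u)=\Lambda_{L_1}(u_1)\times\Lambda_{L_2}(u_2)\subset\mathbb R^{2d}$, $\mathbf u=(u_1,u_2)$. Points of $\mathbb R^{2d}$ are written $\mathbf x=(x_1,x_2)$, $x_j\in\mathbb R^d$. Random potential: $(\mathrm V_s)_{s\in\mathbb Z^d}$ is a family of real random variables on a probability space $(\Omega,\mathfrak B,\mathbb P)$ (not necessarily independent), and $(\varphi_s)_{s\in\mathbb Z^d}$ are deterministic functions on $\mathbb R^d$. Set $V(x;\omega)=\sum_{s\in\mathbb Z^d}\mathrm V_s(\omega)\varphi_s(x-s)$ and $\mathbf V(\mathbf x;\omega)=V(x_1;\omega)+V(x_2;\omega)$. The Hamiltonian $\mathbf H_{\boldsymbol\Lambda}(\omega)=-\tfrac12\boldsymbol\Delta+\mathbf U(\mathbf x)+\mathbf V(\mathbf x;\omega)$ acts in $L^2(\boldsymbol\Lambda)$ with Dirichlet boundary conditions on $\partial\boldsymbol\Lambda$. Assumptions: (D) $\mathbf U\in L^\infty(\mathbb R^{2d})$ (real-valued). (E0) $\sup_s\|\mathrm V_s\|_{L^\infty(\mathbb P)}<\infty$. (E1) each $\varphi_s$ is bounded and nonnegative, and $\sup_{x}\sum_s\varphi_s(x-s)<\infty$. (E2) $\sum_{s\in\Lambda_L(u)\cap\mathbb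 Z^d}\varphi_s(x-s)\ge1$ for all $L\ge1$, $u\in\mathbb R^d$, $x\in\Lambda_L(u)$. (E3) for each $s$, the conditional distribution of $\mathrm V_s$ given the $\sigma$-algebra $\mathfrak B_{\{s\}^c}$ generated by $\{\mathrm V_t:t\neq s\}$ has a density $p_s(\mathrm y;\mathfrak B_{\{s\}^c})$ with $\sup_s\sup_{\mathrm y}\operatorname{ess\,sup}p_s<\infty$. (E4) there is $R\in(0,\infty)$ with $\varphi_s(y)=0$ whenever $\|y\|_{\max}>R$, for all $s$. $\nu(\epsilon)=\sup_{s}\sup_{\mathrm y\in\mathbb R}\operatorname{ess\,sup}\big[F(\mathrm y+\epsilon\mid\mathfrak B_{\{s\}^c})-F(\mathrm y\mid\mathfrak B_{\{s\}^c})\big]$, where $F(\mathrm y\mid\mathfrak B_{\{s\}^c})=\mathbb P(\mathrm V_s<\mathrm y\mid\mathfrak B_{\{s\}^c})$. Boxes $\boldsymbol\Lambda_{L_1,L_2}(\mathbf u)$ and $\boldsymbol\Lambda_{L_1',L_2'}(\mathbf u')$ with $L_1,L_2,L_1',L_2'>1$ are called sufficiently distant if $\min\{\|\mathbf u-\mathbf u'\|_{\max},\|\mathcal S(\mathbf u)-\mathbf u'\|_{\max}\}>8\max\{L_1+R,L_2+R,L_1'+R,L_2'+R\}$, where $\mathcal S(u_1,u_2)=(u_2,u_1)$ and $\|\cdot\|_{\max}$ is the sup-norm on $\mathbb R^{2d}$. *)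

theory Defs
  imports "HOL-Probability.Probability"
begin

definition maxnorm :: "real^'d \<Rightarrow> real" where
  "maxnorm x = Max (range (\<lambda>i. \<bar>x$i\<bar>))"

definition maxnorm2 :: "(real^'d) \<times> (real^'d) \<Rightarrow> real" where
  "maxnorm2 x = max (maxnorm (fst x)) (maxnorm (snd x))"

definition cube :: "real \<Rightarrow> real^'d \<Rightarrow> (real^'d) set" where
  "cube L u = {x. \<forall>i. u$i - L \<le> x$i \<and> x$i \<le> u$i + L}"

definition box2 :: "real \<Rightarrow> real \<Rightarrow> (real^'d) \<times> (real^'d) \<Rightarrow> ((real^'d) \<times> (real^'d)) set" where
  "box2 L1 L2 u = cube L1 (fst u) \<times> cube L2 (snd u)"

definition swap2 :: "'a \<times> 'a \<Rightarrow> 'a \<times> 'a" where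
  "swap2 u = (snd u, fst u)"

definition suff_distant ::
  "real \<Rightarrow> real \<Rightarrow> real \<Rightarrow> (real^'d) \<times> (real^'d) \<Rightarrow> real \<Rightarrow> real \<Rightarrow> (real^'d) \<times> (real^'d) \<Rightarrow> bool" where
  "suff_distant R L1 L2 u L1' L2' u' \<longleftrightarrow>
     min (maxnorm2 (u - u')) (maxnorm2 (swap2 u - u'))
       > 8 * Max {L1 + R, L2 + R, L1' + R, L2' + R}"

definition lattice_pt :: "int^'d \<Rightarrow> real^'d" where
  "lattice_pt s = (\<chi> i. real_of_int (s$i))"

definition single_pot ::
  "(int^'d \<Rightarrow> 'w \<Rightarrow> real) \<Rightarrow> (int^'d \<Rightarrow> real^'d \<Rightarrow> real) \<Rightarrow> real^'d \<Rightarrow> 'w \<Rightarrow> real" where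
  "single_pot V \<phi> x \<omega> = (\<Sum>\<^sub>\<infinity>s. V s \<omega> * \<phi> s (x - lattice_pt s))"

definition two_pot ::
  "(int^'d \<Rightarrow> 'w \<Rightarrow> real) \<Rightarrow> (int^'d \<Rightarrow> real^'d \<Rightarrow> real) \<Rightarrow> (real^'d) \<times> (real^'d) \<Rightarrow> 'w \<Rightarrow> real" where
  "two_pot V \<phi> x \<omega> = single_pot V \<phi> (fst x) \<omega> + single_pot V \<phi> (snd x) \<omega>"

definition compl_sigma :: "'w measure \<Rightarrow> (int^'d \<Rightarrow> 'w \<Rightarrow> real) \<Rightarrow> int^'d \<Rightarrow> 'w measure" where
  "compl_sigma M V s = sigma (space M) {V t -` A \<inter> space M | t A. t \<noteq> s \<and> A \<in> sets borel}"

definition cond_cdf :: "'w measure \<Rightarrow> (int^'d \<Rightarrow> 'w \<Rightarrow> real) \<Rightarrow> int^'d \<Rightarrow> real \<Rightarrow> 'w \<Rightarrow> real" where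
  "cond_cdf M V s y = real_cond_exp M (compl_sigma M V s) (indicator {\<omega> \<in> space M. V s \<omega> < y})"

definition nu :: "'w measure \<Rightarrow> (int^'d \<Rightarrow> 'w \<Rightarrow> real) \<Rightarrow> real \<Rightarrow> ereal" where
  "nu M V \<epsilon> = (SUP s. SUP y. esssup M (\<lambda>\<omega>. ereal (cond_cdf M V s (y + \<epsilon>) \<omega> - cond_cdf M V s y \<omega>)))"

definition test_fun :: "('a::euclidean_space) set \<Rightarrow> ('a \<Rightarrow> real) \<Rightarrow> ('a \<Rightarrow> 'a) \<Rightarrow> bool" where
  "test_fun \<Lambda> \<psi> D\<psi> \<longleftrightarrow>
     (\<forall>x. (\<psi> has_derivative (\<lambda>h. D\<psi> x \<bullet> h)) (at x)) \<and> continuous_on UNIV D\<psi> \<and>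
     compact (closure {x. \<psi> x \<noteq> 0}) \<and> closure {x. \<psi> x \<noteq> 0} \<subseteq> interior \<Lambda>"

definition sq_int :: "('a::euclidean_space) set \<Rightarrow> ('a \<Rightarrow> 'b::euclidean_space) \<Rightarrow> bool" where
  "sq_int \<Lambda> f \<longleftrightarrow> f \<in> borel_measurable (lebesgue_on \<Lambda>) \<and>
     integrable (lebesgue_on \<Lambda>) (\<lambda>x. (norm (f x))\<^sup>2)"

text \<open>f in H^1_0(Lambda) with (weak) gradient g: the H^1-closure of the test functions.\<close>
definition H10 :: "('a::euclidean_space) set \<Rightarrow> ('a \<Rightarrow> real) \<Rightarrow> ('a \<Rightarrow> 'a) \<Rightarrow> bool" where
  "H10 \<Lambda> f g \<longleftrightarrow> sq_int \<Lambda> f \<and> sq_int \<Lambda> g \<and>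
     (\<exists>\<psi> D\<psi>. (\<forall>n. test_fun \<Lambda> (\<psi> n) (D\<psi> n)) \<and>
        (\<lambda>n. \<integral>x. (\<psi> n x - f x)\<^sup>2 \<partial>lebesgue_on \<Lambda>) \<longlonglongrightarrow> 0 \<and>
        (\<lambda>n. \<integral>x. (norm (D\<psi> n x - g x))\<^sup>2 \<partial>lebesgue_on \<Lambda>) \<longlonglongrightarrow> 0)"

text \<open>E is an eigenvalue of -1/2 Laplacian + W on Lambda with Dirichlet b.c.\<close>
definition dirichlet_eigenvalue :: "('a::euclidean_space) set \<Rightarrow> ('a \<Rightarrow> real) \<Rightarrow> real \<Rightarrow> bool" where
  "dirichlet_eigenvalue \<Lambda> W E \<longleftrightarrow>
     (\<exists>f g. H10 \<Lambda> f g \<and> \<not> (AE x in lebesgue_on \<Lambda>. f x = 0) \<and>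
        (\<forall>\<psi> D\<psi>. test_fun \<Lambda> \<psi> D\<psi> \<longrightarrow>
           (1/2) * (\<integral>x. g x \<bullet> D\<psi> x \<partial>lebesgue_on \<Lambda>) + (\<integral>x. W x * f x * \<psi> x \<partial>lebesgue_on \<Lambda>)
           = E * (\<integral>x. f x * \<psi> x \<partial>lebesgue_on \<Lambda>)))"

definition spec :: "('a::euclidean_space) set \<Rightarrow> ('a \<Rightarrow> real) \<Rightarrow> real set" where
  "spec \<Lambda> W = {E. dirichlet_eigenvalue \<Lambda> W E}"

text \<open>distance between subsets of R (infinite if one of them is empty)\<close>
definition spdist :: "real set \<Rightarrow> real set \<Rightarrow> ereal" where
  "spdist A B = (INF p\<in>A \<times> B. ereal \<bar>fst p - snd p\<bar>)"

text \<open>outer probability (coincides with the probability on events)\<close>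
definition outer_prob :: "'w measure \<Rightarrow> 'w set \<Rightarrow> ennreal" where
  "outer_prob M A = (INF B\<in>{B \<in> sets M. A \<subseteq> B}. emeasure M B)"

end

theory Submission
  imports Defs
begin

text \<open>Eigenvalues are compared through min-max values. An eigenvalue of a box is a min-max value of its energy
  form, and this needs no spectral theorem: adjoining an eigenfunction of energy \<open>E\<close> to a subspace of energy below
  \<open>E\<close> gives a subspace of energy at most \<open>E\<close>. The Poincare inequality on small cells bounds the number of min-max
  values below a level by a constant times the volume. If two boxes are distant, then one of their four projections
  is so far from both projections of the other box that the potentials at its lattice points do not act there,
  while they shift the min-max values of their own box at unit rate. Stollmann's argument, applied to the difference of
  a min-max value of one box and one of the other, costs one factor \<open>\<nu>(2\<epsilon>)\<close> per lattice point; summing over the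
  pairs of min-max values gives the volume factors.\<close>

section \<open>Square-integrable functions\<close>

text \<open>Min-max values are preferred to enumerated eigenvalues because they exist for every
  deterministic assignment of site potentials and depend on it in a Lipschitz way; this is where
  measurability comes from. Eigenvalues are only shown to occur among them, so the spectral event is
  enclosed in a finite union of measurable events, up to a null set, which suits the outer
  probability in the statement. The site potentials may depend on each other. Randomness is
  therefore used one site at a time, conditionally on all others, and the interval that has to catch
  the site has a random endpoint measurable with respect to the others. The function
  \<open>nu\<close> controls half-open intervals with fixed endpoints; E3 enters through continuity
  of the conditional distribution functions, which allows random endpoints and a closed interval.
  The constant is \<open>C1 * C1 * 2 ^ CARD('d)\<close>: \<open>C1\<close> bounds the number of
  min-max values per unit volume of a box, and \<open>2 ^ CARD('d)\<close> the number of lattice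
  points per unit volume of a projection.\<close>

lemma sq_int_inner:
  assumes "sq_int \<Lambda> f" "sq_int \<Lambda> g"
  shows "integrable (lebesgue_on \<Lambda>) (\<lambda>x. f x \<bullet> g x)"
proof (rule Bochner_Integration.integrable_bound)
  show "integrable (lebesgue_on \<Lambda>) (\<lambda>x. (norm (f x))\<^sup>2 + (norm (g x))\<^sup>2)"
    using assms by (auto simp: sq_int_def)
  show "(\<lambda>x. f x \<bullet> g x) \<in> borel_measurable (lebesgue_on \<Lambda>)"
    using assms by (auto simp: sq_int_def)
  have "\<bar>f x \<bullet> g x\<bar> \<le> (norm (f x))\<^sup>2 + (norm (g x))\<^sup>2" for x
  proof -
    have "\<bar>f x \<bullet> g x\<bar> \<le> norm (f x) * norm (g x)" by (rule Cauchy_Schwarz_ineq2)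
    also have "\<dots> \<le> (norm (f x))\<^sup>2 + (norm (g x))\<^sup>2"
      using sum_squares_bound[of "norm (f x)" "norm (g x)"]
      mult_nonneg_nonneg[OF norm_ge_zero norm_ge_zero, of "f x" "g x"] by linarith
    finally show ?thesis .
  qed
  then show "AE x in lebesgue_on \<Lambda>. norm (f x \<bullet> g x) \<le> norm ((norm (f x))\<^sup>2 + (norm (g x))\<^sup>2)"
    by auto
qed

lemma sq_int_add:
  assumes "sq_int \<Lambda> f" "sq_int \<Lambda> g"
  shows "sq_int \<Lambda> (\<lambda>x. f x + g x)"
proof -
  have "(norm (f x + g x))\<^sup>2 = (norm (f x))\<^sup>2 + (norm (g x))\<^sup>2 + 2 * (f x \<bullet> g x)" for x
    by (simp add: power2_norm_eq_inner inner_commute algebra_simps)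
  then show ?thesis
    using assms sq_int_inner[OF assms] unfolding sq_int_def by auto
qed

lemma sq_int_scaleR:
  assumes "sq_int \<Lambda> f"
  shows "sq_int \<Lambda> (\<lambda>x. c *\<^sub>R f x)"
  using assms unfolding sq_int_def by (auto simp: power_mult_distrib)

lemma sq_int_diff:
  assumes "sq_int \<Lambda> f" "sq_int \<Lambda> g"
  shows "sq_int \<Lambda> (\<lambda>x. f x - g x)"
  using sq_int_add[OF assms(1) sq_int_scaleR[OF assms(2), of "-1"]] by simp

lemma sq_int_mult_bounded:
  assumes f: "sq_int \<Lambda> f" and w: "w \<in> borel_measurable (lebesgue_on \<Lambda>)"
    and B: "AE x in lebesgue_on \<Lambda>. \<bar>w x\<bar> \<le> B"
  shows "sq_int \<Lambda> (\<lambda>x. w x *\<^sub>R f x)"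
proof -
  have m: "(\<lambda>x. w x *\<^sub>R f x) \<in> borel_measurable (lebesgue_on \<Lambda>)"
    using f w by (auto simp: sq_int_def)
  moreover have "integrable (lebesgue_on \<Lambda>) (\<lambda>x. (norm (w x *\<^sub>R f x))\<^sup>2)"
  proof (rule Bochner_Integration.integrable_bound)
    show "integrable (lebesgue_on \<Lambda>) (\<lambda>x. B\<^sup>2 * (norm (f x))\<^sup>2)"
      using f by (auto simp: sq_int_def)
    show "(\<lambda>x. (norm (w x *\<^sub>R f x))\<^sup>2) \<in> borel_measurable (lebesgue_on \<Lambda>)"
      using m by measurable
    show "AE x in lebesgue_on \<Lambda>. norm ((norm (w x *\<^sub>R f x))\<^sup>2) \<le> norm (B\<^sup>2 * (norm (f x))\<^sup>2)"
      using B
    proof eventually_elim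
      case (elim x)
      then have "(w x)\<^sup>2 \<le> B\<^sup>2" by (meson abs_ge_self abs_le_square_iff order_trans)
      then show ?case by (simp add: power_mult_distrib mult_right_mono)
    qed
  qed
  ultimately show ?thesis by (simp add: sq_int_def)
qed

text \<open>The discriminant of a nonnegative quadratic in \<open>s\<close>. For
  \<open>C > 0\<close> its minimum is at \<open>s = B / C\<close>; for \<open>C = 0\<close> the
  bound is linear in \<open>s\<close> and forces \<open>B = 0\<close>.\<close>

lemma quadratic_nonneg_imp_le:
  fixes A B C :: real
  assumes q: "\<And>s. 2 * s * B \<le> A + s\<^sup>2 * C" and A: "0 \<le> A" and C: "0 \<le> C"
  shows "B\<^sup>2 \<le> A * C"
proof (cases "C = 0")
  case True
  have "B = 0"
  proof (rule ccontr)
    assume B: "B \<noteq> 0"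
    have "2 * ((A + 1) / B) * B \<le> A"
      using q[of "(A + 1) / B"] True by simp
    then show False using A B by simp
  qed
  then show ?thesis using True by simp
next
  case False
  then have "0 < C" using C by simp
  then show ?thesis using q[of "B / C"] by (simp add: power2_eq_square field_simps)
qed

lemma sq_int_Cauchy_Schwarz:
  assumes f: "sq_int \<Lambda> f" and g: "sq_int \<Lambda> g"
  shows "(\<integral>x. f x \<bullet> g x \<partial>lebesgue_on \<Lambda>)\<^sup>2
    \<le> (\<integral>x. (norm (f x))\<^sup>2 \<partial>lebesgue_on \<Lambda>) * (\<integral>x. (norm (g x))\<^sup>2 \<partial>lebesgue_on \<Lambda>)"
    (is "?B\<^sup>2 \<le> ?A * ?C")
proof -
  have q: "2 * s * ?B \<le> ?A + s\<^sup>2 * ?C" for s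
  proof -
    have "0 \<le> (\<integral>x. (norm (f x - s *\<^sub>R g x))\<^sup>2 \<partial>lebesgue_on \<Lambda>)" by simp
    also have "\<dots> = (\<integral>x. (norm (f x))\<^sup>2 - 2 * s * (f x \<bullet> g x) + s\<^sup>2 * (norm (g x))\<^sup>2 \<partial>lebesgue_on \<Lambda>)"
    proof (rule Bochner_Integration.integral_cong)
      fix x
      show "(norm (f x - s *\<^sub>R g x))\<^sup>2 = (norm (f x))\<^sup>2 - 2 * s * (f x \<bullet> g x) + s\<^sup>2 * (norm (g x))\<^sup>2"
        unfolding power2_norm_eq_inner by (simp add: inner_commute algebra_simps power2_eq_square)
    qed simp
    also have "\<dots> = (\<integral>x. (norm (f x))\<^sup>2 - 2 * s * (f x \<bullet> g x) \<partial>lebesgue_on \<Lambda>) + s\<^sup>2 * ?C"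
      using f g sq_int_inner[OF f g] by (subst Bochner_Integration.integral_add) (auto simp: sq_int_def)
    also have "\<dots> = ?A - 2 * s * ?B + s\<^sup>2 * ?C"
      using f g sq_int_inner[OF f g] by (subst Bochner_Integration.integral_diff) (auto simp: sq_int_def)
    finally show ?thesis by simp
  qed
  show ?thesis by (rule quadratic_nonneg_imp_le[OF q]) auto
qed

text \<open>The weak equation and the Poincare inequality hold for test functions first and pass to
  their closure by this limit. Expanding around \<open>f\<close> and \<open>g\<close> leaves three
  error terms, each with a factor tending to 0, so Cauchy-Schwarz settles them without a separate
  bound on the norms of \<open>a n\<close> and \<open>b n\<close>.\<close>

lemma L2_limit_inner:
  fixes f g :: "'a::euclidean_space \<Rightarrow> 'b::euclidean_space"
  assumes a: "\<And>n. sq_int \<Lambda> (a n)" "sq_int \<Lambda> f"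
    and b: "\<And>n. sq_int \<Lambda> (b n)" "sq_int \<Lambda> g"
    and la: "(\<lambda>n. \<integral>x. (norm (a n x - f x))\<^sup>2 \<partial>lebesgue_on \<Lambda>) \<longlonglongrightarrow> 0"
    and lb: "(\<lambda>n. \<integral>x. (norm (b n x - g x))\<^sup>2 \<partial>lebesgue_on \<Lambda>) \<longlonglongrightarrow> 0"
  shows "(\<lambda>n. \<integral>x. a n x \<bullet> b n x \<partial>lebesgue_on \<Lambda>) \<longlonglongrightarrow> (\<integral>x. f x \<bullet> g x \<partial>lebesgue_on \<Lambda>)"
proof -
  let ?I = "\<lambda>u v. \<integral>x. u x \<bullet> v x \<partial>lebesgue_on \<Lambda>"
  let ?N = "\<lambda>u. \<integral>x. (norm (u x))\<^sup>2 \<partial>lebesgue_on \<Lambda>"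
  let ?da = "\<lambda>n x. a n x - f x" and ?db = "\<lambda>n x. b n x - g x"
  have da: "sq_int \<Lambda> (?da n)" and db: "sq_int \<Lambda> (?db n)" for n
    using a b by (auto intro: sq_int_diff)
  have small: "(\<lambda>n. ?I (u n) (v n)) \<longlonglongrightarrow> 0"
    if "\<And>n. sq_int \<Lambda> (u n)" "\<And>n. sq_int \<Lambda> (v n)" "(\<lambda>n. ?N (u n) * ?N (v n)) \<longlonglongrightarrow> 0" for u v :: "nat \<Rightarrow> 'a \<Rightarrow> 'b"
  proof -
    have "(\<lambda>n. (?I (u n) (v n))\<^sup>2) \<longlonglongrightarrow> 0"
    proof (rule tendsto_sandwich[OF _ _ tendsto_const that(3)])
      show "\<forall>\<^sub>F n in sequentially. (?I (u n) (v n))\<^sup>2 \<le> ?N (u n) * ?N (v n)"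
        by (intro always_eventually allI sq_int_Cauchy_Schwarz that)
    qed simp
    then show ?thesis by simp
  qed
  have 1: "(\<lambda>n. ?I (?da n) (?db n)) \<longlonglongrightarrow> 0"
    by (rule small) (use da db tendsto_mult[OF la lb] in auto)
  have 2: "(\<lambda>n. ?I f (?db n)) \<longlonglongrightarrow> 0"
    by (rule small) (use a db tendsto_mult_left[OF lb] in auto)
  have 3: "(\<lambda>n. ?I (?da n) g) \<longlonglongrightarrow> 0"
    by (rule small) (use b da tendsto_mult_right[OF la] in auto)
  have "?I (a n) (b n) = ?I f g + ?I (?da n) (?db n) + ?I f (?db n) + ?I (?da n) g" for n
  proof -
    have "?I (a n) (b n) = (\<integral>x. f x \<bullet> g x + ?da n x \<bullet> ?db n x + f x \<bullet> ?db n x + ?da n x \<bullet> g x \<partial>lebesgue_on \<Lambda>)"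
      by (intro Bochner_Integration.integral_cong) (auto simp: algebra_simps)
    also have "\<dots> = ?I f g + ?I (?da n) (?db n) + ?I f (?db n) + ?I (?da n) g"
      by (intro Bochner_Integration.integral_add[THEN trans] arg_cong2[where f="(+)"]
            Bochner_Integration.integrable_add refl sq_int_inner a b da db)
    finally show ?thesis .
  qed
  then show ?thesis
    using tendsto_add[OF tendsto_add[OF tendsto_add[OF tendsto_const[of "?I f g"] 1] 2] 3] by simp
qed

section \<open>The Poincare inequality on convex sets\<close>

text \<open>Only the half of the segment next to \<open>x\<close> is used, so that
  \<open>t \<ge> 1/2\<close> in the later contraction towards \<open>y\<close>. The constant is
  \<open>\<delta>\<^sup>2\<close> from the length of the segment times 1/2 from Cauchy-Schwarz on an
  interval of length 1/2.\<close>

lemma segment_increment_bound: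
  fixes \<psi> :: "'a::euclidean_space \<Rightarrow> real"
  assumes der: "\<And>x. (\<psi> has_derivative (\<lambda>h. D x \<bullet> h)) (at x)"
    and cont: "continuous_on UNIV D" and \<delta>: "norm (x - y) \<le> \<delta>"
  shows "ennreal ((\<psi> x - \<psi> ((1/2) *\<^sub>R (x + y)))\<^sup>2)
    \<le> (\<integral>\<^sup>+t. ennreal (\<delta>\<^sup>2 / 2 * (norm (D (y + t *\<^sub>R (x - y))))\<^sup>2) * indicator {1/2..1} t \<partial>lborel)"
proof -
  define k where "k t = D (y + t *\<^sub>R (x - y)) \<bullet> (x - y)" for t :: real
  define I where "I = \<psi> x - \<psi> ((1/2) *\<^sub>R (x + y))"
  have contD: "continuous_on A (\<lambda>t. D (y + t *\<^sub>R (x - y)))" for A :: "real set"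
    by (rule continuous_on_compose2[OF cont]) (auto intro!: continuous_intros)
  have contk: "continuous_on A k" for A
    unfolding k_def by (intro continuous_intros contD)
  have mid: "y + (1/2) *\<^sub>R (x - y) = (1/2) *\<^sub>R (x + y)"
    by (simp add: algebra_simps flip: scaleR_add_left)
  have "(k has_integral (\<psi> (y + 1 *\<^sub>R (x - y)) - \<psi> (y + (1/2) *\<^sub>R (x - y)))) {1/2..1}"
  proof (rule fundamental_theorem_of_calculus)
    fix t :: real
    have "((\<lambda>t. y + t *\<^sub>R (x - y)) has_derivative (\<lambda>h. h *\<^sub>R (x - y))) (at t within {1/2..1})"
      by (auto intro!: derivative_eq_intros)
    from has_derivative_compose[OF this der]
    show "((\<lambda>t. \<psi> (y + t *\<^sub>R (x - y))) has_vector_derivative k t) (at t within {1/2..1})"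
      by (simp add: has_vector_derivative_def k_def)
  qed simp
  then have kI: "(k has_integral I) {1/2..1}" by (simp add: I_def mid)
  have k2: "(\<lambda>t. (k t)\<^sup>2) integrable_on {1/2..1}"
    by (intro integrable_continuous_interval continuous_intros contk)
  \<comment> \<open>The integrand is \<open>(k t - 2 * I)\<^sup>2\<close>, and \<open>2 * I\<close>
    is the mean of \<open>k\<close> over the interval: Cauchy-Schwarz in the form of a nonnegative
    variance.\<close>
  have "((\<lambda>t. (k t)\<^sup>2 - 4 * I * k t + 4 * I\<^sup>2) has_integral
      (integral {1/2..1} (\<lambda>t. (k t)\<^sup>2) - 4 * I * I + (1 - 1/2) *\<^sub>R (4 * I\<^sup>2))) {1/2..1}"
    using has_integral_const_real[of "4 * I\<^sup>2" "1/2" 1]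
    by (intro has_integral_add has_integral_diff has_integral_mult_right kI integrable_integral k2) auto
  moreover have "0 \<le> (k t)\<^sup>2 - 4 * I * k t + 4 * I\<^sup>2" for t
    using zero_le_power2[of "k t - 2 * I"] by (simp add: power2_eq_square algebra_simps)
  ultimately have "0 \<le> integral {1/2..1} (\<lambda>t. (k t)\<^sup>2) - 4 * I * I + (1 - 1/2) *\<^sub>R (4 * I\<^sup>2)"
    by (rule has_integral_nonneg)
  then have "2 * I\<^sup>2 \<le> integral {1/2..1} (\<lambda>t. (k t)\<^sup>2)" by (simp add: power2_eq_square)
  also have "\<dots> \<le> integral {1/2..1} (\<lambda>t. \<delta>\<^sup>2 * (norm (D (y + t *\<^sub>R (x - y))))\<^sup>2)"
  proof (rule integral_le[OF k2])
    show "(\<lambda>t. \<delta>\<^sup>2 * (norm (D (y + t *\<^sub>R (x - y))))\<^sup>2) integrable_on {1/2..1}"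
      by (intro integrable_continuous_interval continuous_intros contD)
    fix t
    have "\<bar>k t\<bar> \<le> norm (D (y + t *\<^sub>R (x - y))) * norm (x - y)"
      unfolding k_def by (rule Cauchy_Schwarz_ineq2)
    also have "\<dots> \<le> norm (D (y + t *\<^sub>R (x - y))) * \<delta>"
      using \<delta> by (intro mult_left_mono) auto
    finally have "\<bar>k t\<bar>\<^sup>2 \<le> (norm (D (y + t *\<^sub>R (x - y))) * \<delta>)\<^sup>2"
      by (intro power_mono) auto
    then show "(k t)\<^sup>2 \<le> \<delta>\<^sup>2 * (norm (D (y + t *\<^sub>R (x - y))))\<^sup>2"
      by (simp add: power_mult_distrib mult.commute)
  qed
  finally have le: "I\<^sup>2 \<le> integral {1/2..1} (\<lambda>t. \<delta>\<^sup>2 * (norm (D (y + t *\<^sub>R (x - y))))\<^sup>2) / 2" by simp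
  have hi: "((\<lambda>t. \<delta>\<^sup>2 / 2 * (norm (D (y + t *\<^sub>R (x - y))))\<^sup>2) has_integral
     integral {1/2..1} (\<lambda>t. \<delta>\<^sup>2 * (norm (D (y + t *\<^sub>R (x - y))))\<^sup>2) / 2) {1/2..1}"
  proof -
    have "(\<lambda>t. \<delta>\<^sup>2 * (norm (D (y + t *\<^sub>R (x - y))))\<^sup>2) integrable_on {1/2..1}"
      by (intro integrable_continuous_interval continuous_intros contD)
    from has_integral_divide[OF integrable_integral[OF this], of 2] show ?thesis by simp
  qed
  have "(\<integral>\<^sup>+t. ennreal (\<delta>\<^sup>2 / 2 * (norm (D (y + t *\<^sub>R (x - y))))\<^sup>2) * indicator {1/2..1} t \<partial>lborel)
     = ennreal (integral {1/2..1} (\<lambda>t. \<delta>\<^sup>2 * (norm (D (y + t *\<^sub>R (x - y))))\<^sup>2) / 2)"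
    by (rule nn_integral_has_integral_lebesgue'[OF _ hi]) auto
  then show ?thesis using le by (simp add: I_def ennreal_leI)
qed

text \<open>By convexity the contraction towards \<open>y\<close> maps \<open>Q\<close> into itself.
  Its Jacobian \<open>t ^ DIM('a)\<close> costs at most a factor 2 per dimension because
  \<open>t\<close> stays away from 0.\<close>

lemma nn_integral_convex_contraction:
  fixes g :: "'a::euclidean_space \<Rightarrow> real"
  assumes g [measurable]: "g \<in> borel_measurable borel" and g0: "\<And>x. 0 \<le> g x"
    and Q [measurable]: "Q \<in> sets borel" "convex Q" and y: "y \<in> Q" and t: "1/2 \<le> t" "t \<le> 1"
  shows "(\<integral>\<^sup>+x. ennreal (indicator Q x * g (y + t *\<^sub>R (x - y))) \<partial>lborel)
     \<le> 2 ^ DIM('a) * (\<integral>\<^sup>+x. ennreal (indicator Q x * g x) \<partial>lborel)"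
proof -
  let ?h = "\<lambda>z. ennreal (indicator Q z * g z)"
  have eq: "y + t *\<^sub>R (x - y) = (1 - t) *\<^sub>R y + t *\<^sub>R x" for x
    by (simp add: algebra_simps)
  have inQ: "(1 - t) *\<^sub>R y + t *\<^sub>R x \<in> Q" if "x \<in> Q" for x
    using \<open>convex Q\<close> y that t by (intro convexD) auto
  have "(\<integral>\<^sup>+x. ennreal (indicator Q x * g (y + t *\<^sub>R (x - y))) \<partial>lborel)
      \<le> (\<integral>\<^sup>+x. ?h ((1 - t) *\<^sub>R y + t *\<^sub>R x) \<partial>lborel)"
    unfolding eq by (intro nn_integral_mono ennreal_leI) (use inQ g0 in \<open>auto simp: indicator_def\<close>)
  also have "\<dots> = 1 * \<dots>" by simp
  \<comment> \<open>The factor \<open>(2 * t) ^ DIM('a)\<close>, which is at least 1, is inserted to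
    supply the Jacobian of the substitution.\<close>
  also have "\<dots> \<le> (2 ^ DIM('a) * ennreal (t ^ DIM('a))) * (\<integral>\<^sup>+x. ?h ((1 - t) *\<^sub>R y + t *\<^sub>R x) \<partial>lborel)"
  proof (rule mult_right_mono)
    have "1 \<le> (2 * t) ^ DIM('a)" using t by (intro one_le_power) auto
    then have "ennreal 1 \<le> ennreal (2 ^ DIM('a) * t ^ DIM('a))"
      by (intro ennreal_leI) (simp add: power_mult_distrib)
    also have "\<dots> = 2 ^ DIM('a) * ennreal (t ^ DIM('a))"
      using t by (simp add: ennreal_mult ennreal_power[symmetric])
    finally show "1 \<le> 2 ^ DIM('a) * ennreal (t ^ DIM('a))" by simp
  qed simp
  also have "\<dots> = 2 ^ DIM('a) * (\<integral>\<^sup>+x. ennreal (t ^ DIM('a)) * ?h ((1 - t) *\<^sub>R y + t *\<^sub>R x) \<partial>lborel)"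
    by (simp add: nn_integral_cmult mult.assoc)
  also have "(\<integral>\<^sup>+x. ennreal (t ^ DIM('a)) * ?h ((1 - t) *\<^sub>R y + t *\<^sub>R x) \<partial>lborel) = (\<integral>\<^sup>+x. ?h x \<partial>lborel)"
    using t by (subst (2) lborel_affine[of t "(1 - t) *\<^sub>R y"])
      (auto simp: nn_integral_density nn_integral_distr)
  finally show ?thesis .
qed

lemma integrable_indicator_continuous:
  fixes f :: "'a::euclidean_space \<Rightarrow> real"
  assumes f: "continuous_on UNIV f" and Q: "Q \<in> sets borel" "bounded Q"
  shows "integrable lborel (\<lambda>x. indicator Q x * f x)"
proof -
  have "compact (closure Q)" using Q by simp
  then have "bounded (f ` closure Q)"
    by (intro compact_imp_bounded compact_continuous_image) (use f continuous_on_subset in blast)+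
  then obtain B where B: "\<And>x. x \<in> closure Q \<Longrightarrow> norm (f x) \<le> B"
    by (auto simp: bounded_iff)
  have "integrable lborel (\<lambda>x. indicator Q x *\<^sub>R B)"
    using Q emeasure_bounded_finite[of Q] by auto
  then show ?thesis
  proof (rule Bochner_Integration.integrable_bound)
    show "(\<lambda>x. indicator Q x * f x) \<in> borel_measurable lborel"
      using Q borel_measurable_continuous_onI[OF f] by simp
    show "AE x in lborel. norm (indicator Q x * f x) \<le> norm (indicator Q x *\<^sub>R B)"
      using B closure_subset[of Q] by (intro always_eventually allI) (force simp: indicator_def)
  qed
qed

text \<open>The left side is half of the double integral over \<open>Q \<times> Q\<close> of the
  squared increments of \<open>\<psi>\<close>. Each increment is split at the midpoint, and each
  half is integrated along the part of the segment next to its own endpoint. The measure of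
  \<open>Q\<close> is kept as a factor, so that \<open>Q\<close> may be a null set.\<close>

lemma Poincare_convex_C1:
  fixes \<psi> :: "'a::euclidean_space \<Rightarrow> real"
  assumes der: "\<And>x. (\<psi> has_derivative (\<lambda>h. D x \<bullet> h)) (at x)"
    and cont: "continuous_on UNIV D"
    and Q: "Q \<in> sets borel" "convex Q" "\<And>x y. x \<in> Q \<Longrightarrow> y \<in> Q \<Longrightarrow> norm (x - y) \<le> \<delta>"
  shows "measure lborel Q * (\<integral>x. indicator Q x * (\<psi> x)\<^sup>2 \<partial>lborel) - (\<integral>x. indicator Q x * \<psi> x \<partial>lborel)\<^sup>2
    \<le> 2 ^ DIM('a) * \<delta>\<^sup>2 / 2 * measure lborel Q * (\<integral>x. indicator Q x * (norm (D x))\<^sup>2 \<partial>lborel)"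
proof -
  note [measurable] = Q(1)
  have bdd: "bounded Q"
  proof (cases "Q = {}")
    case False
    then obtain z where "z \<in> Q" by auto
    then show ?thesis using Q(3) by (intro boundedI[of _ "norm z + \<delta>"])
       (metis add.commute add_le_cancel_left norm_triangle_sub order_trans)
  qed simp
  have fin: "emeasure lborel Q < \<infinity>" by (rule emeasure_bounded_finite[OF bdd])
  have contp: "continuous_on UNIV \<psi>"
    using der has_derivative_continuous continuous_at_imp_continuous_on by blast
  have [measurable]: "\<psi> \<in> borel_measurable borel" "D \<in> borel_measurable borel"
    using contp cont by (auto intro: borel_measurable_continuous_onI)
  let ?m = "measure lborel Q"
  define S where "S = (\<integral>x. indicator Q x * (\<psi> x)\<^sup>2 \<partial>lborel)"
  define P where "P = (\<integral>x. indicator Q x * \<psi> x \<partial>lborel)"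
  define G where "G = (\<integral>x. indicator Q x * (norm (D x))\<^sup>2 \<partial>lborel)"
  have iS: "integrable lborel (\<lambda>x. indicator Q x * (\<psi> x)\<^sup>2)"
    and iP: "integrable lborel (\<lambda>x. indicator Q x * \<psi> x)"
    and iG: "integrable lborel (\<lambda>x. indicator Q x * (norm (D x))\<^sup>2)"
    by (intro integrable_indicator_continuous continuous_intros contp cont Q(1) bdd)+
  have i1: "integrable lborel (\<lambda>x. indicator Q x * c)" for c :: real
    by (intro integrable_indicator_continuous continuous_intros Q(1) bdd)
  have nnG: "(\<integral>\<^sup>+x. ennreal (indicator Q x * (norm (D x))\<^sup>2) \<partial>lborel) = ennreal G"
    unfolding G_def by (intro nn_integral_eq_integral iG) auto
  define F where "F x y = indicator Q x * indicator Q y * (\<psi> x - \<psi> y)\<^sup>2" for x y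
  define H where "H x y = indicator Q x * indicator Q y * (\<psi> x - \<psi> ((1/2) *\<^sub>R (x + y)))\<^sup>2" for x y
  have inner: "has_bochner_integral lborel (F x) (indicator Q x * (?m * (\<psi> x)\<^sup>2 - 2 * \<psi> x * P + S))" for x
  proof -
    have "has_bochner_integral lborel (\<lambda>y. indicator Q x * (indicator Q y * (\<psi> x)\<^sup>2
        - 2 * \<psi> x * (indicator Q y * \<psi> y) + indicator Q y * (\<psi> y)\<^sup>2))
        (indicator Q x * (?m * (\<psi> x)\<^sup>2 - 2 * \<psi> x * P + S))"
      unfolding S_def P_def
      by (intro has_bochner_integral_mult_right has_bochner_integral_add has_bochner_integral_diff
          has_bochner_integral_mult_left has_bochner_integral_integrable iS iP has_bochner_integral_real_indicator fin) auto
    also have "(\<lambda>y. indicator Q x * (indicator Q y * (\<psi> x)\<^sup>2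
        - 2 * \<psi> x * (indicator Q y * \<psi> y) + indicator Q y * (\<psi> y)\<^sup>2)) = F x"
      by (auto simp: F_def fun_eq_iff power2_eq_square algebra_simps)
    finally show ?thesis .
  qed
  have outer: "has_bochner_integral lborel (\<lambda>x. indicator Q x * (?m * (\<psi> x)\<^sup>2 - 2 * \<psi> x * P + S)) (2 * ?m * S - 2 * P\<^sup>2)"
  proof -
    have "has_bochner_integral lborel (\<lambda>x. ?m * (indicator Q x * (\<psi> x)\<^sup>2)
        - (2 * P) * (indicator Q x * \<psi> x) + indicator Q x * S) (?m * S - (2 * P) * P + ?m * S)"
      unfolding S_def P_def
      by (intro has_bochner_integral_mult_right has_bochner_integral_add has_bochner_integral_diff
          has_bochner_integral_mult_left has_bochner_integral_integrable iS iP has_bochner_integral_real_indicator fin) auto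
    then show ?thesis by (simp add: algebra_simps power2_eq_square)
  qed
  have F0: "0 \<le> F x y" for x y by (simp add: F_def)
  have F1: "(\<integral>\<^sup>+y. ennreal (F x y) \<partial>lborel) = ennreal (indicator Q x * (?m * (\<psi> x)\<^sup>2 - 2 * \<psi> x * P + S))" for x
    using inner[of x] F0 by (simp add: has_bochner_integral_iff nn_integral_eq_integral)
  have F1pos: "0 \<le> indicator Q x * (?m * (\<psi> x)\<^sup>2 - 2 * \<psi> x * P + S)" for x
    using inner[of x] F0 integral_nonneg_AE[of "F x" lborel] by (simp add: has_bochner_integral_iff)
  have F2: "(\<integral>\<^sup>+x. \<integral>\<^sup>+y. ennreal (F x y) \<partial>lborel \<partial>lborel) = ennreal (2 * ?m * S - 2 * P\<^sup>2)"
    unfolding F1 using outer F1pos by (simp add: has_bochner_integral_iff nn_integral_eq_integral)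
  have [measurable]: "(\<lambda>z. ennreal (H (fst z) (snd z))) \<in> borel_measurable (lborel \<Otimes>\<^sub>M lborel)"
    "(\<lambda>z. ennreal (H (snd z) (fst z))) \<in> borel_measurable (lborel \<Otimes>\<^sub>M lborel)"
    unfolding H_def by measurable
  have swap: "(\<integral>\<^sup>+x. \<integral>\<^sup>+y. ennreal (H x y) \<partial>lborel \<partial>lborel) = (\<integral>\<^sup>+y. \<integral>\<^sup>+x. ennreal (H x y) \<partial>lborel \<partial>lborel)"
    by (rule lborel_pair.Fubini'[symmetric]) (simp add: case_prod_beta')
  have G0: "0 \<le> G" unfolding G_def by simp
  \<comment> \<open>The factors of \<open>c\<close> are \<open>\<delta>\<^sup>2 / 2\<close> from the
    segment, \<open>2 ^ DIM('a)\<close> from the contraction, and 1/2 from the length of the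
    interval of \<open>t\<close>.\<close>
  define c where "c = 2 ^ DIM('a) * \<delta>\<^sup>2 / 4 * G"
  have c0: "0 \<le> c" using G0 by (simp add: c_def)
  have Hy: "(\<integral>\<^sup>+x. ennreal (H x y) \<partial>lborel) \<le> ennreal (c * indicator Q y)" for y
  proof (cases "y \<in> Q")
    case True
    have "(\<integral>\<^sup>+x. ennreal (H x y) \<partial>lborel)
       \<le> (\<integral>\<^sup>+x. \<integral>\<^sup>+t. ennreal (\<delta>\<^sup>2 / 2 * (indicator Q x * (norm (D (y + t *\<^sub>R (x - y))))\<^sup>2)) * indicator {1/2..1} t \<partial>lborel \<partial>lborel)"
    proof (rule nn_integral_mono)
      fix x
      show "ennreal (H x y) \<le> (\<integral>\<^sup>+t. ennreal (\<delta>\<^sup>2 / 2 * (indicator Q x * (norm (D (y + t *\<^sub>R (x - y))))\<^sup>2)) * indicator {1/2..1} t \<partial>lborel)"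
        using segment_increment_bound[OF der cont Q(3)[of x y]] True
        by (cases "x \<in> Q") (auto simp: H_def)
    qed
    \<comment> \<open>Tonelli puts \<open>t\<close> outside, so that for each fixed \<open>t\<close>
      the inner integral is a single contraction towards \<open>y\<close>.\<close>
    also have "\<dots> = (\<integral>\<^sup>+t. \<integral>\<^sup>+x. ennreal (\<delta>\<^sup>2 / 2 * (indicator Q x * (norm (D (y + t *\<^sub>R (x - y))))\<^sup>2)) * indicator {1/2..1} t \<partial>lborel \<partial>lborel)"
      by (rule lborel_pair.Fubini'[symmetric]) (simp add: case_prod_beta')
    also have "\<dots> \<le> (\<integral>\<^sup>+t. ennreal (2 * c) * indicator {1/2..1::real} t \<partial>lborel)"
    proof (rule nn_integral_mono)
      fix t :: real
      show "(\<integral>\<^sup>+x. ennreal (\<delta>\<^sup>2 / 2 * (indicator Q x * (norm (D (y + t *\<^sub>R (x - y))))\<^sup>2)) * indicator {1/2..1} t \<partial>lborel)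
        \<le> ennreal (2 * c) * indicator {1/2..1} t"
      proof (cases "t \<in> {1/2..1}")
        case t: True
        have "(\<integral>\<^sup>+x. ennreal (\<delta>\<^sup>2 / 2 * (indicator Q x * (norm (D (y + t *\<^sub>R (x - y))))\<^sup>2)) * indicator {1/2..1} t \<partial>lborel)
           = ennreal (\<delta>\<^sup>2 / 2) * (\<integral>\<^sup>+x. ennreal (indicator Q x * (norm (D (y + t *\<^sub>R (x - y))))\<^sup>2) \<partial>lborel)"
          using t by (subst nn_integral_cmult[symmetric]) (auto simp: ennreal_mult'[symmetric])
        also have "\<dots> \<le> ennreal (\<delta>\<^sup>2 / 2) * (2 ^ DIM('a) * ennreal G)"
          unfolding nnG[symmetric] using t True Q
          by (intro mult_left_mono nn_integral_convex_contraction) auto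
        also have "\<dots> = ennreal (2 * c)"
        proof -
          have e1: "(2::ennreal) ^ n = ennreal (2 ^ n)" for n :: nat
            by (induction n) (auto simp: ennreal_mult' ennreal_power[symmetric])
          have e2: "2 * c = (\<delta>\<^sup>2 / 2) * (2 ^ DIM('a) * G)"
            by (simp add: c_def)
          show ?thesis unfolding e1 e2 by (simp add: ennreal_mult'[symmetric])
        qed
        finally show ?thesis using t by simp
      qed simp
    qed
    also have "\<dots> = ennreal (2 * c) * ennreal (1/2)"
      by (simp add: nn_integral_cmult_indicator)
    also have "\<dots> = ennreal c" using c0 by (subst ennreal_mult'[symmetric]) simp_all
    finally show ?thesis using True by simp
  qed (simp add: H_def)
  have HH: "(\<integral>\<^sup>+x. \<integral>\<^sup>+y. ennreal (H x y) \<partial>lborel \<partial>lborel) \<le> ennreal (c * ?m)"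
  proof -
    have "(\<integral>\<^sup>+y. \<integral>\<^sup>+x. ennreal (H x y) \<partial>lborel \<partial>lborel) \<le> (\<integral>\<^sup>+y. ennreal c * indicator Q y \<partial>lborel)"
      by (rule nn_integral_mono) (use Hy c0 in \<open>simp add: ennreal_mult' ennreal_indicator\<close>)
    also have "\<dots> = ennreal c * ennreal ?m"
      using fin by (simp add: nn_integral_cmult_indicator emeasure_eq_ennreal_measure)
    finally show ?thesis using c0 by (simp add: swap ennreal_mult')
  qed
  have HH': "(\<integral>\<^sup>+x. \<integral>\<^sup>+y. ennreal (H y x) \<partial>lborel \<partial>lborel) \<le> ennreal (c * ?m)"
    using HH unfolding swap .
  have FH: "ennreal (F x y) \<le> 2 * ennreal (H x y) + 2 * ennreal (H y x)" for x y
  proof -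
    let ?z = "\<psi> ((1/2) *\<^sub>R (x + y))"
    have "(\<psi> x - \<psi> y)\<^sup>2 \<le> 2 * (\<psi> x - ?z)\<^sup>2 + 2 * (\<psi> y - ?z)\<^sup>2"
      using zero_le_power2[of "(\<psi> x - ?z) + (\<psi> y - ?z)"] by (simp add: power2_eq_square algebra_simps)
    then have "F x y \<le> 2 * H x y + 2 * H y x"
      by (cases "x \<in> Q"; cases "y \<in> Q") (simp_all add: F_def H_def add.commute[of y x])
    then have "ennreal (F x y) \<le> ennreal (2 * H x y + 2 * H y x)" by (rule ennreal_leI)
    also have "\<dots> = 2 * ennreal (H x y) + 2 * ennreal (H y x)"
      by (simp add: ennreal_plus ennreal_mult' H_def)
    finally show ?thesis .
  qed
  have [measurable]: "(\<lambda>y. ennreal (H x y)) \<in> borel_measurable lborel" "(\<lambda>y. ennreal (H y x)) \<in> borel_measurable lborel" for x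
    unfolding H_def by measurable
  have "(\<integral>\<^sup>+x. \<integral>\<^sup>+y. ennreal (F x y) \<partial>lborel \<partial>lborel)
     \<le> (\<integral>\<^sup>+x. \<integral>\<^sup>+y. 2 * ennreal (H x y) + 2 * ennreal (H y x) \<partial>lborel \<partial>lborel)"
    by (intro nn_integral_mono FH)
  also have "\<dots> = (\<integral>\<^sup>+x. 2 * (\<integral>\<^sup>+y. ennreal (H x y) \<partial>lborel) + 2 * (\<integral>\<^sup>+y. ennreal (H y x) \<partial>lborel) \<partial>lborel)"
    by (intro nn_integral_cong) (simp add: nn_integral_add nn_integral_cmult)
  also have "\<dots> = 2 * (\<integral>\<^sup>+x. \<integral>\<^sup>+y. ennreal (H x y) \<partial>lborel \<partial>lborel) + 2 * (\<integral>\<^sup>+x. \<integral>\<^sup>+y. ennreal (H y x) \<partial>lborel \<partial>lborel)"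
    by (subst nn_integral_add; (subst nn_integral_cmult)?; (subst nn_integral_cmult)?)
      (simp_all add: lborel.borel_measurable_nn_integral case_prod_beta')
  also have "\<dots> \<le> 2 * ennreal (c * ?m) + 2 * ennreal (c * ?m)"
    by (intro add_mono mult_left_mono HH HH') auto
  also have "\<dots> = ennreal (4 * (c * ?m))"
    using c0 by (simp add: ennreal_mult'[symmetric] ennreal_plus[symmetric] ennreal_numeral[symmetric] del: ennreal_numeral ennreal_plus)
  finally have "2 * ?m * S - 2 * P\<^sup>2 \<le> 4 * (c * ?m)"
    unfolding F2 using c0 by (subst (asm) ennreal_le_iff) auto
  then show ?thesis
    unfolding c_def S_def[symmetric] P_def[symmetric] G_def[symmetric] by (simp add: field_simps)
qed

section \<open>Dirichlet forms\<close>

lemma continuous_sq_int: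
  fixes f :: "'a::euclidean_space \<Rightarrow> 'b::euclidean_space"
  assumes f: "continuous_on UNIV f" and \<Lambda>: "compact \<Lambda>"
  shows "sq_int \<Lambda> f"
proof -
  have m: "f \<in> borel_measurable borel" by (rule borel_measurable_continuous_onI[OF f])
  have s: "\<Lambda> \<in> sets borel" using \<Lambda> by (simp add: compact_imp_closed)
  have "integrable lborel (\<lambda>x. indicator \<Lambda> x * (norm (f x))\<^sup>2)"
    by (intro integrable_indicator_continuous continuous_intros f s compact_imp_bounded \<Lambda>)
  then have "integrable lebesgue (\<lambda>x. indicator \<Lambda> x * (norm (f x))\<^sup>2)"
    by (subst integrable_completion) (use m s in measurable)
  then have "integrable (lebesgue_on \<Lambda>) (\<lambda>x. (norm (f x))\<^sup>2)"
    by (subst integrable_restrict_space) (use s in \<open>simp_all add: sets.Int_space_eq2\<close>)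
  moreover have "f \<in> borel_measurable (lebesgue_on \<Lambda>)"
    by (rule continuous_imp_measurable_on_sets_lebesgue[OF continuous_on_subset[OF f]]) (use s in auto)
  ultimately show ?thesis by (simp add: sq_int_def)
qed

lemma integral_lebesgue_on_borel:
  fixes f :: "'a::euclidean_space \<Rightarrow> real"
  assumes "\<Lambda> \<in> sets borel" "f \<in> borel_measurable borel"
  shows "(\<integral>x. f x \<partial>lebesgue_on \<Lambda>) = (\<integral>x. indicator \<Lambda> x * f x \<partial>lborel)"
proof -
  have "(\<integral>x. f x \<partial>lebesgue_on \<Lambda>) = (\<integral>x. indicator \<Lambda> x * f x \<partial>lebesgue)"
    using assms(1) by (subst integral_restrict_space) auto
  also have "\<dots> = (\<integral>x. indicator \<Lambda> x * f x \<partial>lborel)"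
    using assms by (intro integral_completion) auto
  finally show ?thesis .
qed

section \<open>Test functions and their closure in the energy norm\<close>

lemma test_fun_continuous:
  assumes "test_fun \<Lambda> \<psi> D"
  shows "continuous_on UNIV \<psi>" "continuous_on UNIV D"
proof -
  have "isCont \<psi> x" for x
    using assms by (intro has_derivative_continuous[of \<psi> "\<lambda>h. D x \<bullet> h" x UNIV]) (simp add: test_fun_def)
  then show "continuous_on UNIV \<psi>" by (simp add: continuous_on_eq_continuous_at)
  show "continuous_on UNIV D" using assms by (simp add: test_fun_def)
qed

lemma test_fun_sq_int:
  assumes "test_fun \<Lambda> \<psi> D" "compact \<Lambda>"
  shows "sq_int \<Lambda> \<psi>" "sq_int \<Lambda> D"
  using test_fun_continuous[OF assms(1)] assms(2) by (auto intro: continuous_sq_int)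

lemma test_fun_zero: "test_fun \<Lambda> (\<lambda>_. 0) (\<lambda>_. 0)"
  by (simp add: test_fun_def)

lemma test_fun_lincomb:
  assumes "test_fun \<Lambda> \<psi> D" "test_fun \<Lambda> \<psi>' D'"
  shows "test_fun \<Lambda> (\<lambda>x. a * \<psi> x + b * \<psi>' x) (\<lambda>x. a *\<^sub>R D x + b *\<^sub>R D' x)"
proof -
  let ?S = "closure {x. \<psi> x \<noteq> 0} \<union> closure {x. \<psi>' x \<noteq> 0}"
  have sub: "closure {x. a * \<psi> x + b * \<psi>' x \<noteq> 0} \<subseteq> ?S"
    unfolding closure_Un[symmetric] by (rule closure_mono) auto
  have cpt: "compact ?S" using assms by (auto simp: test_fun_def)
  have "compact (closure {x. a * \<psi> x + b * \<psi>' x \<noteq> 0})"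
    using compact_Int_closed[OF cpt closed_closure[of "{x. a * \<psi> x + b * \<psi>' x \<noteq> 0}"]] sub
    by (simp add: inf.absorb2)
  moreover have "((\<lambda>x. a * \<psi> x + b * \<psi>' x) has_derivative (\<lambda>h. (a *\<^sub>R D x + b *\<^sub>R D' x) \<bullet> h)) (at x)" for x
  proof -
    have "(\<psi> has_derivative (\<lambda>h. D x \<bullet> h)) (at x)" "(\<psi>' has_derivative (\<lambda>h. D' x \<bullet> h)) (at x)"
      using assms by (auto simp: test_fun_def)
    then show ?thesis
      by (auto intro!: derivative_eq_intros simp: inner_add_left)
  qed
  ultimately show ?thesis
    using assms sub unfolding test_fun_def by (auto intro!: continuous_intros)
qed

lemma L2_limit_lincomb:
  fixes f :: "'a::euclidean_space \<Rightarrow> 'b::euclidean_space"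
  assumes u: "\<And>n. sq_int \<Lambda> (u n)" "\<And>n. sq_int \<Lambda> (v n)" and f: "sq_int \<Lambda> f" "sq_int \<Lambda> g"
    and lim: "(\<lambda>n. \<integral>x. (norm (u n x - f x))\<^sup>2 \<partial>lebesgue_on \<Lambda>) \<longlonglongrightarrow> 0"
      "(\<lambda>n. \<integral>x. (norm (v n x - g x))\<^sup>2 \<partial>lebesgue_on \<Lambda>) \<longlonglongrightarrow> 0"
  shows "(\<lambda>n. \<integral>x. (norm (a *\<^sub>R u n x + b *\<^sub>R v n x - (a *\<^sub>R f x + b *\<^sub>R g x)))\<^sup>2 \<partial>lebesgue_on \<Lambda>) \<longlonglongrightarrow> 0"
proof (rule tendsto_sandwich[OF _ _ tendsto_const])
  let ?du = "\<lambda>n. \<integral>x. (norm (u n x - f x))\<^sup>2 \<partial>lebesgue_on \<Lambda>"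
  let ?dv = "\<lambda>n. \<integral>x. (norm (v n x - g x))\<^sup>2 \<partial>lebesgue_on \<Lambda>"
  show "(\<lambda>n. 2 * a\<^sup>2 * ?du n + 2 * b\<^sup>2 * ?dv n) \<longlonglongrightarrow> 0"
    using tendsto_add[OF tendsto_mult_left[OF lim(1), of "2 * a\<^sup>2"] tendsto_mult_left[OF lim(2), of "2 * b\<^sup>2"]] by simp
  have "(\<integral>x. (norm (a *\<^sub>R u n x + b *\<^sub>R v n x - (a *\<^sub>R f x + b *\<^sub>R g x)))\<^sup>2 \<partial>lebesgue_on \<Lambda>)
     \<le> 2 * a\<^sup>2 * ?du n + 2 * b\<^sup>2 * ?dv n" for n
  proof -
    have d: "sq_int \<Lambda> (\<lambda>x. u n x - f x)" "sq_int \<Lambda> (\<lambda>x. v n x - g x)"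
      using u f by (auto intro: sq_int_diff)
    have "(\<integral>x. (norm (a *\<^sub>R u n x + b *\<^sub>R v n x - (a *\<^sub>R f x + b *\<^sub>R g x)))\<^sup>2 \<partial>lebesgue_on \<Lambda>)
       \<le> (\<integral>x. 2 * a\<^sup>2 * (norm (u n x - f x))\<^sup>2 + 2 * b\<^sup>2 * (norm (v n x - g x))\<^sup>2 \<partial>lebesgue_on \<Lambda>)"
    proof (rule integral_mono_AE')
      show "integrable (lebesgue_on \<Lambda>) (\<lambda>x. 2 * a\<^sup>2 * (norm (u n x - f x))\<^sup>2 + 2 * b\<^sup>2 * (norm (v n x - g x))\<^sup>2)"
        using d by (auto simp: sq_int_def)
      have "(norm (p + q))\<^sup>2 \<le> 2 * (norm p)\<^sup>2 + 2 * (norm q)\<^sup>2" for p q :: 'b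
      proof -
        have "0 \<le> (norm (p - q))\<^sup>2" by simp
        then show ?thesis unfolding power2_norm_eq_inner by (simp add: inner_commute algebra_simps)
      qed
      note sq = this
      have "(norm (a *\<^sub>R u n x + b *\<^sub>R v n x - (a *\<^sub>R f x + b *\<^sub>R g x)))\<^sup>2
        \<le> 2 * a\<^sup>2 * (norm (u n x - f x))\<^sup>2 + 2 * b\<^sup>2 * (norm (v n x - g x))\<^sup>2" for x
      proof -
        have "a *\<^sub>R u n x + b *\<^sub>R v n x - (a *\<^sub>R f x + b *\<^sub>R g x) = a *\<^sub>R (u n x - f x) + b *\<^sub>R (v n x - g x)"
          by (simp add: algebra_simps)
        then show ?thesis
          using sq[of "a *\<^sub>R (u n x - f x)" "b *\<^sub>R (v n x - g x)"] by (simp add: power_mult_distrib mult.assoc)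
      qed
      then show "AE x in lebesgue_on \<Lambda>. (norm (a *\<^sub>R u n x + b *\<^sub>R v n x - (a *\<^sub>R f x + b *\<^sub>R g x)))\<^sup>2
        \<le> 2 * a\<^sup>2 * (norm (u n x - f x))\<^sup>2 + 2 * b\<^sup>2 * (norm (v n x - g x))\<^sup>2"
        by simp
    qed auto
    also have "\<dots> = 2 * a\<^sup>2 * ?du n + 2 * b\<^sup>2 * ?dv n"
      using d by (subst Bochner_Integration.integral_add) (auto simp: sq_int_def)
    finally show ?thesis .
  qed
  then show "\<forall>\<^sub>F n in sequentially. (\<integral>x. (norm (a *\<^sub>R u n x + b *\<^sub>R v n x - (a *\<^sub>R f x + b *\<^sub>R g x)))\<^sup>2 \<partial>lebesgue_on \<Lambda>)
     \<le> 2 * a\<^sup>2 * ?du n + 2 * b\<^sup>2 * ?dv n" by simp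
qed auto

lemma H10_sq_int: "H10 \<Lambda> f g \<Longrightarrow> sq_int \<Lambda> f" "H10 \<Lambda> f g \<Longrightarrow> sq_int \<Lambda> g"
  by (auto simp: H10_def)

lemma H10_zero: "H10 \<Lambda> (\<lambda>_. 0) (\<lambda>_. 0)"
  unfolding H10_def
proof (intro conjI exI[of _ "\<lambda>_ _. 0"] allI)
qed (auto simp: sq_int_def test_fun_zero)

lemma H10_lincomb:
  assumes \<Lambda>: "compact \<Lambda>" and 1: "H10 \<Lambda> f g" and 2: "H10 \<Lambda> f' g'"
  shows "H10 \<Lambda> (\<lambda>x. a * f x + b * f' x) (\<lambda>x. a *\<^sub>R g x + b *\<^sub>R g' x)"
proof -
  obtain \<psi> D where p: "\<And>n. test_fun \<Lambda> (\<psi> n) (D n)"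
    "(\<lambda>n. \<integral>x. (\<psi> n x - f x)\<^sup>2 \<partial>lebesgue_on \<Lambda>) \<longlonglongrightarrow> 0"
    "(\<lambda>n. \<integral>x. (norm (D n x - g x))\<^sup>2 \<partial>lebesgue_on \<Lambda>) \<longlonglongrightarrow> 0"
    using 1 by (auto simp: H10_def)
  obtain \<psi>' D' where p': "\<And>n. test_fun \<Lambda> (\<psi>' n) (D' n)"
    "(\<lambda>n. \<integral>x. (\<psi>' n x - f' x)\<^sup>2 \<partial>lebesgue_on \<Lambda>) \<longlonglongrightarrow> 0"
    "(\<lambda>n. \<integral>x. (norm (D' n x - g' x))\<^sup>2 \<partial>lebesgue_on \<Lambda>) \<longlonglongrightarrow> 0"
    using 2 by (auto simp: H10_def)
  note t = test_fun_sq_int[OF p(1) \<Lambda>] test_fun_sq_int[OF p'(1) \<Lambda>]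
  note s = H10_sq_int[OF 1] H10_sq_int[OF 2]
  have "(\<lambda>n. \<integral>x. ((a * \<psi> n x + b * \<psi>' n x) - (a * f x + b * f' x))\<^sup>2 \<partial>lebesgue_on \<Lambda>) \<longlonglongrightarrow> 0"
    using L2_limit_lincomb[of \<Lambda> \<psi> \<psi>' f f' a b] t s p(2) p'(2) by simp
  moreover have "(\<lambda>n. \<integral>x. (norm ((a *\<^sub>R D n x + b *\<^sub>R D' n x) - (a *\<^sub>R g x + b *\<^sub>R g' x)))\<^sup>2 \<partial>lebesgue_on \<Lambda>) \<longlonglongrightarrow> 0"
    using L2_limit_lincomb[of \<Lambda> D D' g g' a b] t s p(3) p'(3) by simp
  moreover have "sq_int \<Lambda> (\<lambda>x. a * f x + b * f' x)" "sq_int \<Lambda> (\<lambda>x. a *\<^sub>R g x + b *\<^sub>R g' x)"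
    using sq_int_add[OF sq_int_scaleR[OF s(1), of a] sq_int_scaleR[OF s(3), of b]]
      sq_int_add[OF sq_int_scaleR[OF s(2), of a] sq_int_scaleR[OF s(4), of b]] by auto
  ultimately show ?thesis
    unfolding H10_def using test_fun_lincomb[OF p(1) p'(1), where a = a and b = b]
    by (intro conjI exI[of _ "\<lambda>n x. a * \<psi> n x + b * \<psi>' n x"] exI[of _ "\<lambda>n x. a *\<^sub>R D n x + b *\<^sub>R D' n x"]) auto
qed

lemma H10_sum:
  fixes n :: nat
  assumes \<Lambda>: "compact \<Lambda>" and "\<And>i. i < n \<Longrightarrow> H10 \<Lambda> (f i) (g i)"
  shows "H10 \<Lambda> (\<lambda>x. \<Sum>i<n. c i * f i x) (\<lambda>x. \<Sum>i<n. c i *\<^sub>R g i x)"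
  using assms(2)
proof (induction n)
  case (Suc n)
  then show ?case
    using H10_lincomb[OF \<Lambda>, of "\<lambda>x. \<Sum>i<n. c i * f i x" "\<lambda>x. \<Sum>i<n. c i *\<^sub>R g i x" "f n" "g n" 1 "c n"] by simp
qed (simp add: H10_zero)

text \<open>Density: every term is continuous in the test pair under the convergence that defines
  \<open>H10\<close>. The eigenfunction itself and the trial combinations, which are only limits of
  test functions, can then be inserted in the equation.\<close>

lemma H10_weak_form:
  assumes \<Lambda>: "compact \<Lambda>" and W: "W \<in> borel_measurable (lebesgue_on \<Lambda>)" "AE x in lebesgue_on \<Lambda>. \<bar>W x\<bar> \<le> B"
    and fg: "H10 \<Lambda> f g" and hk: "H10 \<Lambda> h k"
    and weak: "\<And>\<psi> D. test_fun \<Lambda> \<psi> D \<Longrightarrow>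
       (1/2) * (\<integral>x. g x \<bullet> D x \<partial>lebesgue_on \<Lambda>) + (\<integral>x. W x * f x * \<psi> x \<partial>lebesgue_on \<Lambda>)
           = E * (\<integral>x. f x * \<psi> x \<partial>lebesgue_on \<Lambda>)"
  shows "(1/2) * (\<integral>x. g x \<bullet> k x \<partial>lebesgue_on \<Lambda>) + (\<integral>x. W x * f x * h x \<partial>lebesgue_on \<Lambda>)
           = E * (\<integral>x. f x * h x \<partial>lebesgue_on \<Lambda>)"
proof -
  obtain \<psi> D where p: "\<And>n. test_fun \<Lambda> (\<psi> n) (D n)"
    "(\<lambda>n. \<integral>x. (\<psi> n x - h x)\<^sup>2 \<partial>lebesgue_on \<Lambda>) \<longlonglongrightarrow> 0"
    "(\<lambda>n. \<integral>x. (norm (D n x - k x))\<^sup>2 \<partial>lebesgue_on \<Lambda>) \<longlonglongrightarrow> 0"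
    using hk by (auto simp: H10_def)
  note t = test_fun_sq_int[OF p(1) \<Lambda>]
  note s = H10_sq_int[OF fg] H10_sq_int[OF hk]
  have Wf: "sq_int \<Lambda> (\<lambda>x. W x * f x)"
    using sq_int_mult_bounded[OF s(1) W] by simp
  have l1: "(\<lambda>n. \<integral>x. g x \<bullet> D n x \<partial>lebesgue_on \<Lambda>) \<longlonglongrightarrow> (\<integral>x. g x \<bullet> k x \<partial>lebesgue_on \<Lambda>)"
    by (rule L2_limit_inner) (use s t p(3) in auto)
  have l2: "(\<lambda>n. \<integral>x. W x * f x * \<psi> n x \<partial>lebesgue_on \<Lambda>) \<longlonglongrightarrow> (\<integral>x. W x * f x * h x \<partial>lebesgue_on \<Lambda>)"
    using L2_limit_inner[of \<Lambda> "\<lambda>_ x. W x * f x" "\<lambda>x. W x * f x" \<psi> h] Wf s t p(2) by simp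
  have l3: "(\<lambda>n. \<integral>x. f x * \<psi> n x \<partial>lebesgue_on \<Lambda>) \<longlonglongrightarrow> (\<integral>x. f x * h x \<partial>lebesgue_on \<Lambda>)"
    using L2_limit_inner[of \<Lambda> "\<lambda>_. f" f \<psi> h] s t p(2) by simp
  have "(\<lambda>n. (1/2) * (\<integral>x. g x \<bullet> D n x \<partial>lebesgue_on \<Lambda>) + (\<integral>x. W x * f x * \<psi> n x \<partial>lebesgue_on \<Lambda>))
     \<longlonglongrightarrow> (1/2) * (\<integral>x. g x \<bullet> k x \<partial>lebesgue_on \<Lambda>) + (\<integral>x. W x * f x * h x \<partial>lebesgue_on \<Lambda>)"
    by (intro tendsto_intros l1 l2)
  moreover have "(\<lambda>n. (1/2) * (\<integral>x. g x \<bullet> D n x \<partial>lebesgue_on \<Lambda>) + (\<integral>x. W x * f x * \<psi> n x \<partial>lebesgue_on \<Lambda>))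
     \<longlonglongrightarrow> E * (\<integral>x. f x * h x \<partial>lebesgue_on \<Lambda>)"
    unfolding weak[OF p(1)] by (intro tendsto_intros l3)
  ultimately show ?thesis by (rule LIMSEQ_unique)
qed

text \<open>The mean of \<open>f\<close> over \<open>Q\<close> vanishes, but the means of the
  approximating test functions do not have to. The inequality for smooth functions therefore carries
  its mean term, which disappears only in the limit.\<close>

lemma Poincare_convex_H10:
  fixes \<Lambda> :: "'a::euclidean_space set"
  assumes \<Lambda>: "compact \<Lambda>" and fg: "H10 \<Lambda> f g"
    and Q: "Q \<in> sets borel" "convex Q" "\<And>x y. x \<in> Q \<Longrightarrow> y \<in> Q \<Longrightarrow> norm (x - y) \<le> \<delta>" "Q \<subseteq> \<Lambda>"
    and mean: "(\<integral>x. indicator Q x * f x \<partial>lebesgue_on \<Lambda>) = 0"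
  shows "(\<integral>x. indicator Q x * (f x)\<^sup>2 \<partial>lebesgue_on \<Lambda>)
    \<le> 2 ^ DIM('a) * \<delta>\<^sup>2 / 2 * (\<integral>x. indicator Q x * (norm (g x))\<^sup>2 \<partial>lebesgue_on \<Lambda>)"
proof -
  obtain \<psi> D where p: "\<And>n. test_fun \<Lambda> (\<psi> n) (D n)"
    "(\<lambda>n. \<integral>x. (\<psi> n x - f x)\<^sup>2 \<partial>lebesgue_on \<Lambda>) \<longlonglongrightarrow> 0"
    "(\<lambda>n. \<integral>x. (norm (D n x - g x))\<^sup>2 \<partial>lebesgue_on \<Lambda>) \<longlonglongrightarrow> 0"
    using fg by (auto simp: H10_def)
  note t = test_fun_sq_int[OF p(1) \<Lambda>]
  note s = H10_sq_int[OF fg]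
  let ?m = "measure lborel Q" and ?c = "2 ^ DIM('a) * \<delta>\<^sup>2 / 2 :: real"
  have L: "\<Lambda> \<in> sets borel" using \<Lambda> by (simp add: compact_imp_closed)
  have mQ: "(indicator Q :: 'a \<Rightarrow> real) \<in> borel_measurable (lebesgue_on \<Lambda>)"
    using Q(1) by (intro measurable_restrict_space1 borel_measurable_indicator) auto
  have cut: "sq_int \<Lambda> (\<lambda>x. indicat_real Q x *\<^sub>R u x)" if "sq_int \<Lambda> u" for u :: "'a \<Rightarrow> 'c::euclidean_space"
    by (rule sq_int_mult_bounded[OF that mQ, where B = 1]) (auto simp: indicator_def)
  have one: "sq_int \<Lambda> (indicat_real Q)"
    using cut[OF continuous_sq_int[OF continuous_on_const[of UNIV "1::real"] \<Lambda>]] by simp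
  \<comment> \<open>Multiplying by the indicator of \<open>Q\<close> does not increase the L2
    distance, so the approximation survives the restriction to the cell; the same holds for the
    gradients.\<close>
  have l1: "(\<lambda>n. \<integral>x. indicator Q x * (\<psi> n x)\<^sup>2 \<partial>lebesgue_on \<Lambda>) \<longlonglongrightarrow> (\<integral>x. indicator Q x * (f x)\<^sup>2 \<partial>lebesgue_on \<Lambda>)"
  proof -
    have "(\<lambda>n. \<integral>x. (norm (indicat_real Q x *\<^sub>R \<psi> n x - indicat_real Q x *\<^sub>R f x))\<^sup>2 \<partial>lebesgue_on \<Lambda>) \<longlonglongrightarrow> 0"
    proof (rule tendsto_sandwich[OF _ _ tendsto_const p(2)])
      show "\<forall>\<^sub>F n in sequentially. (\<integral>x. (norm (indicat_real Q x *\<^sub>R \<psi> n x - indicat_real Q x *\<^sub>R f x))\<^sup>2 \<partial>lebesgue_on \<Lambda>)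
         \<le> (\<integral>x. (\<psi> n x - f x)\<^sup>2 \<partial>lebesgue_on \<Lambda>)"
      proof (intro always_eventually allI integral_mono_AE')
        fix n show "integrable (lebesgue_on \<Lambda>) (\<lambda>x. (\<psi> n x - f x)\<^sup>2)"
          using sq_int_diff[OF t(1)[of n] s(1)] by (simp add: sq_int_def)
      qed (auto simp: indicator_def)
    qed auto
    from L2_limit_inner[OF cut[OF t(1)] cut[OF s(1)] t(1) s(1) this] p(2)
    show ?thesis by (simp add: power2_eq_square mult.assoc)
  qed
  have l2: "(\<lambda>n. \<integral>x. indicator Q x * (norm (D n x))\<^sup>2 \<partial>lebesgue_on \<Lambda>) \<longlonglongrightarrow> (\<integral>x. indicator Q x * (norm (g x))\<^sup>2 \<partial>lebesgue_on \<Lambda>)"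
  proof -
    have "(\<lambda>n. \<integral>x. (norm (indicat_real Q x *\<^sub>R D n x - indicat_real Q x *\<^sub>R g x))\<^sup>2 \<partial>lebesgue_on \<Lambda>) \<longlonglongrightarrow> 0"
    proof (rule tendsto_sandwich[OF _ _ tendsto_const p(3)])
      show "\<forall>\<^sub>F n in sequentially. (\<integral>x. (norm (indicat_real Q x *\<^sub>R D n x - indicat_real Q x *\<^sub>R g x))\<^sup>2 \<partial>lebesgue_on \<Lambda>)
         \<le> (\<integral>x. (norm (D n x - g x))\<^sup>2 \<partial>lebesgue_on \<Lambda>)"
      proof (intro always_eventually allI integral_mono_AE')
        fix n show "integrable (lebesgue_on \<Lambda>) (\<lambda>x. (norm (D n x - g x))\<^sup>2)"
          using sq_int_diff[OF t(2)[of n] s(2)] by (simp add: sq_int_def)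
      qed (auto simp: indicator_def)
    qed auto
    from L2_limit_inner[OF cut[OF t(2)] cut[OF s(2)] t(2) s(2) this p(3)]
    show ?thesis by (simp add: power2_norm_eq_inner)
  qed
  have l3: "(\<lambda>n. \<integral>x. indicator Q x * \<psi> n x \<partial>lebesgue_on \<Lambda>) \<longlonglongrightarrow> 0"
    using L2_limit_inner[of \<Lambda> "\<lambda>_. indicat_real Q" "indicat_real Q" \<psi> f] one s t p(2) mean by simp
  have red: "(\<integral>x. indicator Q x * u x \<partial>lebesgue_on \<Lambda>) = (\<integral>x. indicator Q x * u x \<partial>lborel)"
    if "continuous_on UNIV u" for u :: "'a \<Rightarrow> real"
  proof -
    have "(\<integral>x. indicator Q x * u x \<partial>lebesgue_on \<Lambda>) = (\<integral>x. indicator \<Lambda> x * (indicator Q x * u x) \<partial>lborel)"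
      using L Q(1) borel_measurable_continuous_onI[OF that]
      by (intro integral_lebesgue_on_borel) auto
    also have "\<dots> = (\<integral>x. indicator Q x * u x \<partial>lborel)"
      using Q(4) by (intro Bochner_Integration.integral_cong) (auto simp: indicator_def)
    finally show ?thesis .
  qed
  have ineq: "?m * (\<integral>x. indicator Q x * (\<psi> n x)\<^sup>2 \<partial>lebesgue_on \<Lambda>) - (\<integral>x. indicator Q x * \<psi> n x \<partial>lebesgue_on \<Lambda>)\<^sup>2
    \<le> ?c * ?m * (\<integral>x. indicator Q x * (norm (D n x))\<^sup>2 \<partial>lebesgue_on \<Lambda>)" for n
  proof -
    have "((\<psi> n) has_derivative (\<lambda>h. D n x \<bullet> h)) (at x)" for x
      using p(1)[of n] by (auto simp: test_fun_def)
    from Poincare_convex_C1[OF this test_fun_continuous(2)[OF p(1)] Q(1-3)]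
    show ?thesis
      using red[of "\<lambda>x. (\<psi> n x)\<^sup>2"] red[of "\<psi> n"] red[of "\<lambda>x. (norm (D n x))\<^sup>2"]
        test_fun_continuous[OF p(1)[of n]] by (simp add: continuous_on_power continuous_on_norm)
  qed
  have "?m * (\<integral>x. indicator Q x * (f x)\<^sup>2 \<partial>lebesgue_on \<Lambda>) - 0\<^sup>2
    \<le> ?c * ?m * (\<integral>x. indicator Q x * (norm (g x))\<^sup>2 \<partial>lebesgue_on \<Lambda>)"
    by (rule LIMSEQ_le[OF tendsto_diff[OF tendsto_mult_left[OF l1] tendsto_power[OF l3]] tendsto_mult_left[OF l2]])
      (use ineq in auto)
  then have le: "?m * (\<integral>x. indicator Q x * (f x)\<^sup>2 \<partial>lebesgue_on \<Lambda>)
    \<le> ?m * (?c * (\<integral>x. indicator Q x * (norm (g x))\<^sup>2 \<partial>lebesgue_on \<Lambda>))" by (simp add: ac_simps)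
  \<comment> \<open>The inequality in the limit carries the factor \<open>?m\<close>. It can be
    cancelled unless \<open>Q\<close> is null, and then the left integral vanishes by
    itself.\<close>
  show ?thesis
  proof (cases "?m = 0")
    case True
    have "bounded Q" using \<Lambda> Q(4) bounded_subset compact_imp_bounded by blast
    then have "Q \<in> null_sets lborel"
      using True Q(1) emeasure_bounded_finite[of Q] by (auto simp: null_sets_def emeasure_eq_ennreal_measure)
    then have "Q \<in> null_sets (lebesgue_on \<Lambda>)"
      using L Q(4) by (subst null_sets_restrict_space) (auto intro: null_sets_completionI)
    then have "AE x in lebesgue_on \<Lambda>. indicator Q x * (f x)\<^sup>2 = 0"
      by (auto dest!: AE_not_in simp: indicator_def)
    then have "(\<integral>x. indicator Q x * (f x)\<^sup>2 \<partial>lebesgue_on \<Lambda>) = 0"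
      by (rule integral_eq_zero_AE)
    then show ?thesis by simp
  next
    case False
    then have "0 < ?m" by (simp add: less_le)
    then show ?thesis using le by (simp only: mult_le_cancel_left_pos)
  qed
qed

section \<open>Min-max values\<close>

definition energy :: "('a::euclidean_space) set \<Rightarrow> ('a \<Rightarrow> real) \<Rightarrow> ('a \<Rightarrow> real) \<Rightarrow> ('a \<Rightarrow> 'a) \<Rightarrow> real" where
  "energy \<Lambda> W f g = (1/2) * (\<integral>x. (norm (g x))\<^sup>2 \<partial>lebesgue_on \<Lambda>) + (\<integral>x. W x * (f x)\<^sup>2 \<partial>lebesgue_on \<Lambda>)"

text \<open>A spanning family with its weak gradients stands for an \<open>n\<close>-dimensional
  space of trial functions. Positivity of the norm for every nonzero coefficient vector expresses
  linear independence modulo null sets, so no quotient space is formed.\<close>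

definition minmax_adm :: "('a::euclidean_space) set \<Rightarrow> ('a \<Rightarrow> real) \<Rightarrow> nat \<Rightarrow> real \<Rightarrow> bool" where
  "minmax_adm \<Lambda> W n \<mu> \<longleftrightarrow> (\<exists>f g. (\<forall>i<n. H10 \<Lambda> (f i) (g i)) \<and>
     (\<forall>c::nat \<Rightarrow> real. (\<exists>i<n. c i \<noteq> 0) \<longrightarrow>
        0 < (\<integral>x. (\<Sum>i<n. c i * f i x)\<^sup>2 \<partial>lebesgue_on \<Lambda>) \<and>
        energy \<Lambda> W (\<lambda>x. \<Sum>i<n. c i * f i x) (\<lambda>x. \<Sum>i<n. c i *\<^sub>R g i x)
          \<le> \<mu> * (\<integral>x. (\<Sum>i<n. c i * f i x)\<^sup>2 \<partial>lebesgue_on \<Lambda>)))"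

text \<open>For \<open>n = 0\<close> every real level is admissible, and if no level is admissible
  the infimum is arbitrary. This is why \<open>1 \<le> n\<close> and an admissible level accompany
  this value below.\<close>

definition minmax_val :: "('a::euclidean_space) set \<Rightarrow> ('a \<Rightarrow> real) \<Rightarrow> nat \<Rightarrow> real" where
  "minmax_val \<Lambda> W n = Inf {\<mu>. minmax_adm \<Lambda> W n \<mu>}"

definition bdd_potential :: "('a::euclidean_space) set \<Rightarrow> ('a \<Rightarrow> real) \<Rightarrow> bool" where
  "bdd_potential \<Lambda> W \<longleftrightarrow> W \<in> borel_measurable (lebesgue_on \<Lambda>) \<and> (\<exists>B. AE x in lebesgue_on \<Lambda>. \<bar>W x\<bar> \<le> B)"

lemma bdd_potential_integrable:
  assumes "bdd_potential \<Lambda> W" "sq_int \<Lambda> f" "sq_int \<Lambda> h"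
  shows "integrable (lebesgue_on \<Lambda>) (\<lambda>x. W x * f x * h x)"
proof -
  obtain B where "W \<in> borel_measurable (lebesgue_on \<Lambda>)" "AE x in lebesgue_on \<Lambda>. \<bar>W x\<bar> \<le> B"
    using assms(1) by (auto simp: bdd_potential_def)
  from sq_int_inner[OF sq_int_mult_bounded[OF assms(2) this] assms(3)] show ?thesis by simp
qed

lemma bdd_potential_integrable_square:
  assumes "bdd_potential \<Lambda> W" "sq_int \<Lambda> f"
  shows "integrable (lebesgue_on \<Lambda>) (\<lambda>x. W x * (f x)\<^sup>2)"
  using bdd_potential_integrable[OF assms(1,2,2)] by (simp add: power2_eq_square mult.assoc)

lemma integral_norm_square_add:
  fixes u v :: "'a::euclidean_space \<Rightarrow> 'b::euclidean_space"
  assumes "sq_int \<Lambda> u" "sq_int \<Lambda> v"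
  shows "(\<integral>x. (norm (u x + b *\<^sub>R v x))\<^sup>2 \<partial>lebesgue_on \<Lambda>) =
    (\<integral>x. (norm (u x))\<^sup>2 \<partial>lebesgue_on \<Lambda>) + 2 * b * (\<integral>x. v x \<bullet> u x \<partial>lebesgue_on \<Lambda>)
      + b\<^sup>2 * (\<integral>x. (norm (v x))\<^sup>2 \<partial>lebesgue_on \<Lambda>)"
proof -
  have i: "integrable (lebesgue_on \<Lambda>) (\<lambda>x. (norm (u x))\<^sup>2)" "integrable (lebesgue_on \<Lambda>) (\<lambda>x. (norm (v x))\<^sup>2)"
    "integrable (lebesgue_on \<Lambda>) (\<lambda>x. v x \<bullet> u x)"
    using assms sq_int_inner[OF assms(2,1)] by (auto simp: sq_int_def)
  have "(norm (u x + b *\<^sub>R v x))\<^sup>2 = (norm (u x))\<^sup>2 + 2 * b * (v x \<bullet> u x) + b\<^sup>2 * (norm (v x))\<^sup>2" for x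
    unfolding power2_norm_eq_inner by (simp add: inner_commute algebra_simps power2_eq_square)
  then show ?thesis using i by simp
qed

lemma integral_potential_square_add:
  assumes W: "bdd_potential \<Lambda> W" and "sq_int \<Lambda> u" "sq_int \<Lambda> v"
  shows "(\<integral>x. W x * (u x + b * v x)\<^sup>2 \<partial>lebesgue_on \<Lambda>) =
    (\<integral>x. W x * (u x)\<^sup>2 \<partial>lebesgue_on \<Lambda>) + 2 * b * (\<integral>x. W x * v x * u x \<partial>lebesgue_on \<Lambda>)
      + b\<^sup>2 * (\<integral>x. W x * (v x)\<^sup>2 \<partial>lebesgue_on \<Lambda>)"
proof -
  have i: "integrable (lebesgue_on \<Lambda>) (\<lambda>x. W x * (u x)\<^sup>2)" "integrable (lebesgue_on \<Lambda>) (\<lambda>x. W x * (v x)\<^sup>2)"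
    "integrable (lebesgue_on \<Lambda>) (\<lambda>x. W x * v x * u x)"
    using assms by (auto intro: bdd_potential_integrable bdd_potential_integrable_square)
  have "W x * (u x + b * v x)\<^sup>2 = W x * (u x)\<^sup>2 + 2 * b * (W x * v x * u x) + b\<^sup>2 * (W x * (v x)\<^sup>2)" for x
    by (simp add: algebra_simps power2_eq_square)
  then show ?thesis using i by simp
qed

lemma minmax_adm_0: "minmax_adm \<Lambda> W 0 \<mu>"
  by (simp add: minmax_adm_def)

text \<open>Adjoining an eigenfunction for \<^term>\<open>E\<close> to a subspace on which the energy stays below \<^term>\<open>E\<close>
  replaces the spectral theorem: by the weak equation the energy of \<open>F + b e\<close> is
  \<open>E \<parallel>F + b e\<parallel>\<^sup>2 + (energy F - E \<parallel>F\<parallel>\<^sup>2)\<close>.\<close>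

lemma minmax_adm_Suc:
  assumes \<Lambda>: "compact \<Lambda>" and W: "bdd_potential \<Lambda> W"
    and ev: "dirichlet_eigenvalue \<Lambda> W E" and adm: "minmax_adm \<Lambda> W n \<mu>" and \<mu>: "\<mu> < E"
  shows "minmax_adm \<Lambda> W (Suc n) E"
proof -
  let ?M = "lebesgue_on \<Lambda>"
  obtain e k where e: "H10 \<Lambda> e k" "\<not> (AE x in ?M. e x = 0)"
    and weak: "\<And>\<psi> D. test_fun \<Lambda> \<psi> D \<Longrightarrow>
       (1/2) * (\<integral>x. k x \<bullet> D x \<partial>?M) + (\<integral>x. W x * e x * \<psi> x \<partial>?M) = E * (\<integral>x. e x * \<psi> x \<partial>?M)"
    using ev by (auto simp: dirichlet_eigenvalue_def)
  obtain f g where fg: "\<And>i. i < n \<Longrightarrow> H10 \<Lambda> (f i) (g i)"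
    and pos: "\<And>c::nat \<Rightarrow> real. \<exists>i<n. c i \<noteq> 0 \<Longrightarrow> 0 < (\<integral>x. (\<Sum>i<n. c i * f i x)\<^sup>2 \<partial>?M)"
    and le: "\<And>c::nat \<Rightarrow> real. \<exists>i<n. c i \<noteq> 0 \<Longrightarrow>
        energy \<Lambda> W (\<lambda>x. \<Sum>i<n. c i * f i x) (\<lambda>x. \<Sum>i<n. c i *\<^sub>R g i x)
          \<le> \<mu> * (\<integral>x. (\<Sum>i<n. c i * f i x)\<^sup>2 \<partial>?M)"
    using adm unfolding minmax_adm_def by blast
  obtain B where B: "W \<in> borel_measurable ?M" "AE x in ?M. \<bar>W x\<bar> \<le> B"
    using W by (auto simp: bdd_potential_def)
  note wf = H10_weak_form[OF \<Lambda> B e(1) _ weak]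
  define f' where "f' i = (if i < n then f i else e)" for i
  define g' where "g' i = (if i < n then g i else k)" for i
  have sum': "(\<Sum>i<Suc n. c i * f' i x) = (\<Sum>i<n. c i * f i x) + c n * e x"
    "(\<Sum>i<Suc n. c i *\<^sub>R g' i x) = (\<Sum>i<n. c i *\<^sub>R g i x) + c n *\<^sub>R k x" for c x
    by (simp_all add: f'_def g'_def)
  have se: "sq_int \<Lambda> e" "sq_int \<Lambda> k" using H10_sq_int[OF e(1)] .
  have epos: "0 < (\<integral>x. (e x)\<^sup>2 \<partial>?M)"
  proof -
    have "(\<integral>x. (e x)\<^sup>2 \<partial>?M) \<noteq> 0"
      using e(2) se(1) integral_nonneg_eq_0_iff_AE[of ?M "\<lambda>x. (e x)\<^sup>2"] by (simp add: sq_int_def)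
    then show ?thesis by (simp add: less_le)
  qed
  have main: "0 < (\<integral>x. ((\<Sum>i<n. c i * f i x) + c n * e x)\<^sup>2 \<partial>?M) \<and>
     energy \<Lambda> W (\<lambda>x. (\<Sum>i<n. c i * f i x) + c n * e x) (\<lambda>x. (\<Sum>i<n. c i *\<^sub>R g i x) + c n *\<^sub>R k x)
       \<le> E * (\<integral>x. ((\<Sum>i<n. c i * f i x) + c n * e x)\<^sup>2 \<partial>?M)"
    if nz: "\<exists>i<Suc n. c i \<noteq> 0" for c :: "nat \<Rightarrow> real"
  proof -
    define F where "F x = (\<Sum>i<n. c i * f i x)" for x
    define G where "G x = (\<Sum>i<n. c i *\<^sub>R g i x)" for x
    define H where "H x = F x + c n * e x" for x
    have H_eq: "H = (\<lambda>x. F x + c n * e x)" by (simp add: H_def fun_eq_iff)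
    have FG: "H10 \<Lambda> F G" unfolding F_def G_def by (rule H10_sum[OF \<Lambda> fg])
    note sF = H10_sq_int[OF FG]
    have sH: "sq_int \<Lambda> H"
      using sq_int_add[OF sF(1) sq_int_scaleR[OF se(1), of "c n"]] unfolding H_eq by simp
    let ?a = "\<integral>x. (F x)\<^sup>2 \<partial>?M" and ?h = "\<integral>x. (H x)\<^sup>2 \<partial>?M"
    let ?k = "\<integral>x. (norm (G x + c n *\<^sub>R k x))\<^sup>2 \<partial>?M"
    have h: "?h = ?a + 2 * c n * (\<integral>x. e x * F x \<partial>?M) + (c n)\<^sup>2 * (\<integral>x. (e x)\<^sup>2 \<partial>?M)"
      using integral_norm_square_add[OF sF(1) se(1), of "c n"] by (simp add: H_def)
    have en: "energy \<Lambda> W H (\<lambda>x. G x + c n *\<^sub>R k x) = energy \<Lambda> W F G - E * ?a + E * ?h"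
    proof -
      have w1: "(1/2) * (\<integral>x. k x \<bullet> G x \<partial>?M) + (\<integral>x. W x * e x * F x \<partial>?M) = E * (\<integral>x. e x * F x \<partial>?M)"
        by (rule wf[OF FG])
      have w2: "(1/2) * (\<integral>x. (norm (k x))\<^sup>2 \<partial>?M) + (\<integral>x. W x * (e x)\<^sup>2 \<partial>?M) = E * (\<integral>x. (e x)\<^sup>2 \<partial>?M)"
        using wf[OF e(1)] unfolding power2_norm_eq_inner by (simp add: power2_eq_square mult.assoc)
      have "energy \<Lambda> W H (\<lambda>x. G x + c n *\<^sub>R k x) = energy \<Lambda> W F G
        + 2 * c n * ((1/2) * (\<integral>x. k x \<bullet> G x \<partial>?M) + (\<integral>x. W x * e x * F x \<partial>?M))
        + (c n)\<^sup>2 * ((1/2) * (\<integral>x. (norm (k x))\<^sup>2 \<partial>?M) + (\<integral>x. W x * (e x)\<^sup>2 \<partial>?M))"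
        unfolding energy_def H_def integral_norm_square_add[OF sF(2) se(2)]
          integral_potential_square_add[OF W sF(1) se(1)] by (simp add: algebra_simps)
      also have "\<dots> = energy \<Lambda> W F G - E * ?a + E * ?h"
        unfolding w1 w2 h by (simp add: algebra_simps)
      finally show ?thesis .
    qed
    have "0 < ?h \<and> energy \<Lambda> W H (\<lambda>x. G x + c n *\<^sub>R k x) \<le> E * ?h"
    proof (cases "\<exists>i<n. c i \<noteq> 0")
      case True
      have a: "0 < ?a" using pos[OF True] by (simp add: F_def)
      have "energy \<Lambda> W F G \<le> \<mu> * ?a" unfolding F_def G_def by (rule le[OF True])
      also have "\<dots> < E * ?a" using \<mu> a by simp
      finally have neg: "energy \<Lambda> W F G - E * ?a < 0" by simp
      \<comment> \<open>Strict negativity in \<open>neg\<close> also yields linear independence: if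
        \<open>H\<close> vanished almost everywhere, only the gradient term would remain and the
        energy would be nonnegative, while \<open>en\<close> makes it negative.\<close>
      have "?h \<noteq> 0"
      proof
        assume h0: "?h = 0"
        have "AE x in ?M. (H x)\<^sup>2 = 0"
          using h0 sH integral_nonneg_eq_0_iff_AE[of ?M "\<lambda>x. (H x)\<^sup>2"] by (simp add: sq_int_def)
        then have "AE x in ?M. W x * (H x)\<^sup>2 = 0" by eventually_elim simp
        then have "(\<integral>x. W x * (H x)\<^sup>2 \<partial>?M) = 0" by (rule integral_eq_zero_AE)
        then have "0 \<le> energy \<Lambda> W H (\<lambda>x. G x + c n *\<^sub>R k x)" by (simp add: energy_def)
        then show False using en neg h0 by simp
      qed
      then have "0 < ?h" by (simp add: less_le)
      then show ?thesis using en neg by simp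
    next
      case False
      then have 0: "F x = 0" "G x = 0" for x by (auto simp: F_def G_def)
      have "c n \<noteq> 0" using nz False by (auto simp: less_Suc_eq)
      then have "0 < ?h" unfolding h using 0 epos by simp
      moreover have "energy \<Lambda> W F G = 0" by (simp add: energy_def 0)
      ultimately show ?thesis using en 0 by simp
    qed
    then show ?thesis unfolding H_def F_def G_def .
  qed
  show ?thesis
    unfolding minmax_adm_def
  proof (intro exI[of _ f'] exI[of _ g'] conjI allI impI)
    fix i assume "i < Suc n"
    then show "H10 \<Lambda> (f' i) (g' i)" using fg e(1) by (auto simp: f'_def g'_def)
  next
    fix c :: "nat \<Rightarrow> real" assume c: "\<exists>i<Suc n. c i \<noteq> 0"
    show "0 < (\<integral>x. (\<Sum>i<Suc n. c i * f' i x)\<^sup>2 \<partial>?M)"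
      unfolding sum' using main[OF c] by blast
    show "energy \<Lambda> W (\<lambda>x. \<Sum>i<Suc n. c i * f' i x) (\<lambda>x. \<Sum>i<Suc n. c i *\<^sub>R g' i x)
          \<le> E * (\<integral>x. (\<Sum>i<Suc n. c i * f' i x)\<^sup>2 \<partial>?M)"
      unfolding sum' using main[OF c] by blast
  qed
qed

text \<open>The index is one more than the largest index admissible at some level strictly below
  \<open>E\<close>. Adjoining the eigenfunction makes it admissible at \<open>E\<close>, and
  maximality excludes every lower level, so the infimum is attained at \<open>E\<close>. The bound
  \<open>N\<close> ensures that the largest index exists.\<close>

lemma eigenvalue_eq_minmax_val:
  assumes \<Lambda>: "compact \<Lambda>" and W: "bdd_potential \<Lambda> W" and ev: "dirichlet_eigenvalue \<Lambda> W E"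
    and N: "\<And>n \<mu>. minmax_adm \<Lambda> W n \<mu> \<Longrightarrow> \<mu> \<le> E \<Longrightarrow> n \<le> N"
  obtains n where "1 \<le> n" "n \<le> N" "minmax_adm \<Lambda> W n E" "E = minmax_val \<Lambda> W n"
proof -
  define A where "A = {n. \<exists>\<mu><E. minmax_adm \<Lambda> W n \<mu>}"
  have A_I: "m \<in> A" if "\<mu> < E" "minmax_adm \<Lambda> W m \<mu>" for m \<mu>
    using that by (auto simp: A_def)
  have A_E: "\<exists>\<mu><E. minmax_adm \<Lambda> W m \<mu>" if "m \<in> A" for m
    using that by (auto simp: A_def)
  have "A \<subseteq> {..N}" unfolding A_def using N less_imp_le by blast
  then have fin: "finite A" using finite_subset by blast
  have "0 \<in> A" unfolding A_def using minmax_adm_0[of \<Lambda> W "E - 1"] by (intro CollectI exI[of _ "E - 1"]) simp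
  then have mA: "Max A \<in> A" using fin by (intro Max_in) auto
  then obtain \<mu> where \<mu>: "\<mu> < E" "minmax_adm \<Lambda> W (Max A) \<mu>"
    using A_E by blast
  have adm: "minmax_adm \<Lambda> W (Suc (Max A)) E" by (rule minmax_adm_Suc[OF \<Lambda> W ev \<mu>(2,1)])
  have notin: "Suc (Max A) \<notin> A" using Max_ge[OF fin, of "Suc (Max A)"] by auto
  have "E \<le> \<mu>" if "minmax_adm \<Lambda> W (Suc (Max A)) \<mu>" for \<mu>
  proof (rule ccontr)
    assume "\<not> E \<le> \<mu>"
    then have "Suc (Max A) \<in> A" using that by (intro A_I[of \<mu>]) simp_all
    then show False using notin by simp
  qed
  then have "E = minmax_val \<Lambda> W (Suc (Max A))"
    unfolding minmax_val_def using adm by (intro cInf_eq_minimum[symmetric]) auto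
  then show thesis using that[of "Suc (Max A)"] adm N[OF adm] by simp
qed

text \<open>The trial family is kept: raising the potential by at most \<open>t\<close> raises the
  energy by at most \<open>t\<close> times the squared norm.\<close>

lemma minmax_adm_shift:
  assumes \<Lambda>: "compact \<Lambda>" and W: "bdd_potential \<Lambda> W" "bdd_potential \<Lambda> W'"
    and le: "AE x in lebesgue_on \<Lambda>. W x \<le> W' x + t" and adm: "minmax_adm \<Lambda> W' n \<mu>"
  shows "minmax_adm \<Lambda> W n (\<mu> + t)"
proof -
  let ?M = "lebesgue_on \<Lambda>"
  obtain f g where fg: "\<And>i. i < n \<Longrightarrow> H10 \<Lambda> (f i) (g i)"
    and pos: "\<And>c::nat \<Rightarrow> real. \<exists>i<n. c i \<noteq> 0 \<Longrightarrow> 0 < (\<integral>x. (\<Sum>i<n. c i * f i x)\<^sup>2 \<partial>?M)"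
    and en: "\<And>c::nat \<Rightarrow> real. \<exists>i<n. c i \<noteq> 0 \<Longrightarrow>
        energy \<Lambda> W' (\<lambda>x. \<Sum>i<n. c i * f i x) (\<lambda>x. \<Sum>i<n. c i *\<^sub>R g i x)
          \<le> \<mu> * (\<integral>x. (\<Sum>i<n. c i * f i x)\<^sup>2 \<partial>?M)"
    using adm unfolding minmax_adm_def by blast
  have "energy \<Lambda> W F G \<le> energy \<Lambda> W' F G + t * (\<integral>x. (F x)\<^sup>2 \<partial>?M)" if "H10 \<Lambda> F G" for F G
  proof -
    note s = H10_sq_int(1)[OF that]
    have i: "integrable ?M (\<lambda>x. W x * (F x)\<^sup>2)" "integrable ?M (\<lambda>x. W' x * (F x)\<^sup>2)" "integrable ?M (\<lambda>x. (F x)\<^sup>2)"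
      using s W by (auto intro: bdd_potential_integrable_square simp: sq_int_def)
    have "(\<integral>x. W x * (F x)\<^sup>2 \<partial>?M) \<le> (\<integral>x. W' x * (F x)\<^sup>2 + t * (F x)\<^sup>2 \<partial>?M)"
    proof (rule integral_mono_AE)
      show "AE x in ?M. W x * (F x)\<^sup>2 \<le> W' x * (F x)\<^sup>2 + t * (F x)\<^sup>2"
        using le by eventually_elim (simp add: mult_right_mono flip: distrib_right)
    qed (use i in auto)
    also have "\<dots> = (\<integral>x. W' x * (F x)\<^sup>2 \<partial>?M) + t * (\<integral>x. (F x)\<^sup>2 \<partial>?M)"
      using i by simp
    finally show ?thesis by (simp add: energy_def)
  qed
  note shift = this[OF H10_sum[OF \<Lambda> fg]]
  show ?thesis
    unfolding minmax_adm_def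
  proof (intro exI[of _ f] exI[of _ g] conjI allI impI)
    fix c :: "nat \<Rightarrow> real" assume c: "\<exists>i<n. c i \<noteq> 0"
    let ?F = "\<lambda>x. \<Sum>i<n. c i * f i x" and ?G = "\<lambda>x. \<Sum>i<n. c i *\<^sub>R g i x"
    show "0 < (\<integral>x. (?F x)\<^sup>2 \<partial>?M)" by (rule pos[OF c])
    have "energy \<Lambda> W ?F ?G \<le> energy \<Lambda> W' ?F ?G + t * (\<integral>x. (?F x)\<^sup>2 \<partial>?M)"
      by (rule shift)
    also have "\<dots> \<le> \<mu> * (\<integral>x. (?F x)\<^sup>2 \<partial>?M) + t * (\<integral>x. (?F x)\<^sup>2 \<partial>?M)"
      using en[OF c] by simp
    finally show "energy \<Lambda> W ?F ?G \<le> (\<mu> + t) * (\<integral>x. (?F x)\<^sup>2 \<partial>?M)"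
      by (simp add: distrib_right)
  qed (use fg in auto)
qed

lemma minmax_adm_lower_bound:
  assumes \<Lambda>: "compact \<Lambda>" and W: "bdd_potential \<Lambda> W"
    and B: "AE x in lebesgue_on \<Lambda>. - B \<le> W x" and adm: "minmax_adm \<Lambda> W n \<mu>" and n: "1 \<le> n"
  shows "- B \<le> \<mu>"
proof -
  let ?M = "lebesgue_on \<Lambda>"
  obtain f g where fg: "\<And>i. i < n \<Longrightarrow> H10 \<Lambda> (f i) (g i)"
    and pos: "\<And>c::nat \<Rightarrow> real. \<exists>i<n. c i \<noteq> 0 \<Longrightarrow> 0 < (\<integral>x. (\<Sum>i<n. c i * f i x)\<^sup>2 \<partial>?M)"
    and en: "\<And>c::nat \<Rightarrow> real. \<exists>i<n. c i \<noteq> 0 \<Longrightarrow>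
        energy \<Lambda> W (\<lambda>x. \<Sum>i<n. c i * f i x) (\<lambda>x. \<Sum>i<n. c i *\<^sub>R g i x)
          \<le> \<mu> * (\<integral>x. (\<Sum>i<n. c i * f i x)\<^sup>2 \<partial>?M)"
    using adm unfolding minmax_adm_def by blast
  \<comment> \<open>Any nonzero element of the trial space serves; the sum of the whole family is
    taken, written with the coefficient vector 1.\<close>
  define F where "F x = (\<Sum>i<n. 1 * f i x)" for x
  define G where "G x = (\<Sum>i<n. (1::real) *\<^sub>R g i x)" for x
  have nz: "\<exists>i<n. (1::real) \<noteq> 0" using n by (intro exI[of _ 0]) auto
  have H: "H10 \<Lambda> F G" unfolding F_def G_def using H10_sum[OF \<Lambda>, of n f g "\<lambda>_. 1"] fg by simp
  let ?F = "\<integral>x. (F x)\<^sup>2 \<partial>?M"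
  have p: "0 < ?F" unfolding F_def using pos[of "\<lambda>_. 1", OF nz] .
  have i: "integrable ?M (\<lambda>x. W x * (F x)\<^sup>2)" "integrable ?M (\<lambda>x. (F x)\<^sup>2)"
    using H10_sq_int(1)[OF H] W by (auto intro: bdd_potential_integrable_square simp: sq_int_def)
  have "- B * ?F = (\<integral>x. - B * (F x)\<^sup>2 \<partial>?M)" by simp
  also have "\<dots> \<le> (\<integral>x. W x * (F x)\<^sup>2 \<partial>?M)"
  proof (rule integral_mono_AE)
    show "AE x in ?M. - B * (F x)\<^sup>2 \<le> W x * (F x)\<^sup>2"
      using B by eventually_elim (intro mult_right_mono, auto)
  qed (use i in auto)
  also have "\<dots> \<le> energy \<Lambda> W F G" by (simp add: energy_def)
  also have "\<dots> \<le> \<mu> * ?F" unfolding F_def G_def using en[of "\<lambda>_. 1", OF nz] .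
  finally show ?thesis using p by (simp only: mult_le_cancel_right_pos)
qed

text \<open>Comparing infima of real sets takes more than the shift of levels: the lower bound on
  \<open>W\<close> makes the set for \<open>W\<close> bounded below, and \<open>adm\<close> makes
  the set for \<open>W'\<close> nonempty.\<close>

lemma minmax_val_shift:
  assumes \<Lambda>: "compact \<Lambda>" and W: "bdd_potential \<Lambda> W" "bdd_potential \<Lambda> W'"
    and le: "AE x in lebesgue_on \<Lambda>. W x \<le> W' x + t"
    and adm: "minmax_adm \<Lambda> W' n \<mu>" and n: "1 \<le> n"
  shows "minmax_val \<Lambda> W n \<le> minmax_val \<Lambda> W' n + t"
proof -
  obtain B where "AE x in lebesgue_on \<Lambda>. \<bar>W x\<bar> \<le> B" using W(1) by (auto simp: bdd_potential_def)
  then have "AE x in lebesgue_on \<Lambda>. - B \<le> W x" by eventually_elim auto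
  then have bdd: "bdd_below {\<mu>. minmax_adm \<Lambda> W n \<mu>}"
    using minmax_adm_lower_bound[OF \<Lambda> W(1) _ _ n] by (intro bdd_belowI[of _ "- B"]) blast
  have "minmax_val \<Lambda> W n - t \<le> minmax_val \<Lambda> W' n"
    unfolding minmax_val_def[of \<Lambda> W']
  proof (rule cInf_greatest)
    fix \<mu>' assume "\<mu>' \<in> {\<mu>. minmax_adm \<Lambda> W' n \<mu>}"
    then have "minmax_adm \<Lambda> W n (\<mu>' + t)" using minmax_adm_shift[OF \<Lambda> W le] by simp
    then have "minmax_val \<Lambda> W n \<le> \<mu>' + t" unfolding minmax_val_def using bdd by (intro cInf_lower) auto
    then show "minmax_val \<Lambda> W n - t \<le> \<mu>'" by simp
  qed (use adm in auto)
  then show ?thesis by simp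
qed

text \<open>Gaussian elimination, one equation and one unknown at a time. It supplies the
  coefficients of a trial function whose mean vanishes on every cell.\<close>

lemma homogeneous_system_nontrivial:
  fixes a :: "'k \<Rightarrow> nat \<Rightarrow> real"
  assumes "finite K" "card K < n"
  shows "\<exists>c. (\<exists>i<n. c i \<noteq> 0) \<and> (\<forall>k\<in>K. (\<Sum>i<n. c i * a k i) = 0)"
  using assms
proof (induction K arbitrary: a n rule: finite_induct)
  case empty
  then show ?case by (intro exI[of _ "\<lambda>_. 1"]) auto
next
  case (insert k K)
  show ?case
  proof (cases "\<exists>j<n. a k j \<noteq> 0")
    case False
    have "card K < n" using insert by simp
    from insert.IH[OF this, of a] False show ?thesis by (auto simp: sum.neutral)
  next
    case True
    then obtain j where j: "j < n" "a k j \<noteq> 0" by auto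
    obtain m where n: "n = Suc m" using j by (cases n) auto
    \<comment> \<open>\<open>\<pi>\<close> enumerates the unknowns other than the pivot
      \<open>j\<close>.\<close>
    define \<pi> where "\<pi> i = (if i < j then i else Suc i)" for i
    have inj: "inj_on \<pi> A" for A by (auto simp: inj_on_def \<pi>_def split: if_splits)
    have im: "\<pi> ` {..<m} = {..<n} - {j}"
    proof (rule card_subset_eq)
      show "\<pi> ` {..<m} \<subseteq> {..<n} - {j}" using j by (auto simp: \<pi>_def n)
      show "card (\<pi> ` {..<m}) = card ({..<n} - {j})" using j by (simp add: card_image[OF inj] n)
    qed simp
    have split: "(\<Sum>i<n. h i) = h j + (\<Sum>i<m. h (\<pi> i))" for h :: "nat \<Rightarrow> real"
    proof -
      have "(\<Sum>i<n. h i) = h j + sum h ({..<n} - {j})" using j by (simp add: sum.remove)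
      also have "sum h ({..<n} - {j}) = (\<Sum>i<m. h (\<pi> i))"
        unfolding im[symmetric] by (subst sum.reindex[OF inj]) simp
      finally show ?thesis .
    qed
    \<comment> \<open>Row \<open>l\<close> minus the multiple of row \<open>k\<close> that cancels
      its entry at the pivot.\<close>
    define b where "b l i = a l (\<pi> i) - a l j * a k (\<pi> i) / a k j" for l i
    have "card K < m" using insert n by simp
    from insert.IH[OF this, of b] obtain c where c: "\<exists>i<m. c i \<noteq> 0" "\<forall>l\<in>K. (\<Sum>i<m. c i * b l i) = 0"
      by auto
    \<comment> \<open>The value of the unknown \<open>j\<close> that equation \<open>k\<close>
      dictates once the others are chosen.\<close>
    define s where "s = - (\<Sum>i<m. c i * a k (\<pi> i)) / a k j"
    define c' where "c' i = (if i = j then s else c (if i < j then i else i - 1))" for i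
    have c'\<pi>: "c' (\<pi> i) = c i" for i by (auto simp: c'_def \<pi>_def)
    have c'j: "c' j = s" by (simp add: c'_def)
    obtain i where i: "i < m" "c i \<noteq> 0" using c(1) by auto
    have "\<pi> i < n" using im i(1) by blast
    then have "\<exists>i<n. c' i \<noteq> 0" using i(2) c'\<pi>[of i] by auto
    moreover have "(\<Sum>i<n. c' i * a l i) = 0" if "l \<in> insert k K" for l
    proof -
      have eq: "(\<Sum>i<n. c' i * a l i) = s * a l j + (\<Sum>i<m. c i * a l (\<pi> i))"
        unfolding split c'\<pi> c'j ..
      show ?thesis
      proof (cases "l = k")
        case True
        then show ?thesis unfolding eq using j by (simp add: s_def)
      next
        case False
        then have "0 = (\<Sum>i<m. c i * b l i)" using that c(2) by simp
        also have "\<dots> = (\<Sum>i<m. c i * a l (\<pi> i)) - (\<Sum>i<m. c i * a k (\<pi> i)) * (a l j / a k j)"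
        proof -
          have "(\<Sum>i<m. c i * b l i) = (\<Sum>i<m. c i * a l (\<pi> i) - c i * a k (\<pi> i) * (a l j / a k j))"
            by (intro sum.cong) (simp_all add: b_def right_diff_distrib)
          then show ?thesis by (simp only: sum_subtractf sum_distrib_right)
        qed
        finally show ?thesis unfolding eq by (simp add: s_def)
      qed
    qed
    ultimately show ?thesis by blast
  qed
qed

text \<open>With more trial functions than cells, some nonzero combination has mean zero on every
  cell. Adding up the Poincare inequalities of the cells bounds its squared norm by
  \<open>2 ^ DIM('a) * \<delta>\<^sup>2 * (\<mu> + B)\<close> times itself, which
  \<open>small\<close> excludes.\<close>

lemma minmax_adm_card_bound:
  fixes \<Lambda> :: "'a::euclidean_space set"
  assumes \<Lambda>: "compact \<Lambda>" and W: "bdd_potential \<Lambda> W" and B: "AE x in lebesgue_on \<Lambda>. - B \<le> W x"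
    and adm: "minmax_adm \<Lambda> W n \<mu>"
    and K: "finite K" "\<And>k. k \<in> K \<Longrightarrow> Q k \<in> sets borel" "\<And>k. k \<in> K \<Longrightarrow> convex (Q k)"
      "\<And>k x y. k \<in> K \<Longrightarrow> x \<in> Q k \<Longrightarrow> y \<in> Q k \<Longrightarrow> norm (x - y) \<le> \<delta>"
      "disjoint_family_on Q K" "\<Lambda> = (\<Union>k\<in>K. Q k)"
    and small: "2 ^ DIM('a) * \<delta>\<^sup>2 * (\<mu> + B) < 1"
  shows "n \<le> card K"
proof (rule ccontr)
  let ?M = "lebesgue_on \<Lambda>"
  assume "\<not> n \<le> card K"
  then have card: "card K < n" by simp
  obtain f g where fg: "\<And>i. i < n \<Longrightarrow> H10 \<Lambda> (f i) (g i)"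
    and pos: "\<And>c::nat \<Rightarrow> real. \<exists>i<n. c i \<noteq> 0 \<Longrightarrow> 0 < (\<integral>x. (\<Sum>i<n. c i * f i x)\<^sup>2 \<partial>?M)"
    and en: "\<And>c::nat \<Rightarrow> real. \<exists>i<n. c i \<noteq> 0 \<Longrightarrow>
        energy \<Lambda> W (\<lambda>x. \<Sum>i<n. c i * f i x) (\<lambda>x. \<Sum>i<n. c i *\<^sub>R g i x)
          \<le> \<mu> * (\<integral>x. (\<Sum>i<n. c i * f i x)\<^sup>2 \<partial>?M)"
    using adm unfolding minmax_adm_def by blast
  have cut: "integrable ?M (\<lambda>x. indicator (Q k) x * u x)" if "k \<in> K" "integrable ?M u" for k and u :: "'a \<Rightarrow> real"
  proof -
    have "Q k \<in> sets lebesgue" using K(2)[OF that(1)] by simp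
    moreover have "Q k \<inter> \<Lambda> = Q k" using K(6) that(1) by blast
    ultimately have "Q k \<in> sets ?M"
      unfolding sets_restrict_space by (intro image_eqI[of _ _ "Q k"]) auto
    from integrable_mult_indicator[OF this that(2)] show ?thesis by simp
  qed
  have sub: "Q k \<subseteq> \<Lambda>" if "k \<in> K" for k using K(6) that by blast
  obtain c where c: "\<exists>i<n. c i \<noteq> 0"
    and c0: "\<And>k. k \<in> K \<Longrightarrow> (\<Sum>i<n. c i * (\<integral>x. indicator (Q k) x * f i x \<partial>?M)) = 0"
    using homogeneous_system_nontrivial[OF K(1) card, of "\<lambda>k i. \<integral>x. indicator (Q k) x * f i x \<partial>?M"] by blast
  define F where "F x = (\<Sum>i<n. c i * f i x)" for x
  define G where "G x = (\<Sum>i<n. c i *\<^sub>R g i x)" for x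
  have H: "H10 \<Lambda> F G" unfolding F_def G_def by (rule H10_sum[OF \<Lambda> fg])
  have i: "integrable ?M (\<lambda>x. W x * (F x)\<^sup>2)" "integrable ?M (\<lambda>x. (F x)\<^sup>2)" "integrable ?M (\<lambda>x. (norm (G x))\<^sup>2)"
    using H10_sq_int[OF H] W by (auto intro: bdd_potential_integrable_square simp: sq_int_def)
  have p: "0 < (\<integral>x. (F x)\<^sup>2 \<partial>?M)" unfolding F_def using pos[OF c] .
  have e: "energy \<Lambda> W F G \<le> \<mu> * (\<integral>x. (F x)\<^sup>2 \<partial>?M)" unfolding F_def G_def using en[OF c] .
  have mean: "(\<integral>x. indicator (Q k) x * F x \<partial>?M) = 0" if k: "k \<in> K" for k
  proof -
    have int1: "integrable ?M (\<lambda>x. indicator (Q k) x * f i x)" if "i < n" for i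
    proof -
      have "sq_int \<Lambda> (\<lambda>_. 1 :: real)" by (rule continuous_sq_int[OF _ \<Lambda>]) auto
      from sq_int_inner[OF H10_sq_int(1)[OF fg[OF that]] this] show ?thesis
        by (intro cut[OF k]) simp
    qed
    have "(\<integral>x. indicator (Q k) x * F x \<partial>?M) = (\<integral>x. (\<Sum>i<n. c i * (indicator (Q k) x * f i x)) \<partial>?M)"
      by (intro Bochner_Integration.integral_cong) (auto simp: F_def sum_distrib_left ac_simps)
    also have "\<dots> = (\<Sum>i<n. \<integral>x. c i * (indicator (Q k) x * f i x) \<partial>?M)"
      by (rule Bochner_Integration.integral_sum) (use int1 in auto)
    also have "\<dots> = 0" using c0[OF k] by simp
    finally show ?thesis .
  qed
  have part: "(\<integral>x. u x \<partial>?M) = (\<Sum>k\<in>K. \<integral>x. indicator (Q k) x * u x \<partial>?M)" if "integrable ?M u" for u :: "'a \<Rightarrow> real"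
  proof -
    have "(\<integral>x. u x \<partial>?M) = (\<integral>x. (\<Sum>k\<in>K. indicator (Q k) x * u x) \<partial>?M)"
    proof (intro Bochner_Integration.integral_cong refl)
      fix x assume "x \<in> space ?M"
      then have "x \<in> (\<Union>k\<in>K. Q k)" using K(6) by (simp add: space_restrict_space)
      moreover have "(\<Sum>k\<in>K. indicator (Q k) x) = indicat_real (\<Union>k\<in>K. Q k) x"
        by (rule indicator_UN_disjoint[OF K(1,5), symmetric])
      ultimately have "(\<Sum>k\<in>K. indicator (Q k) x) = (1::real)" by (simp only: indicator_simps)
      then show "u x = (\<Sum>k\<in>K. indicator (Q k) x * u x)"
        unfolding sum_distrib_right[symmetric] by simp
    qed
    also have "\<dots> = (\<Sum>k\<in>K. \<integral>x. indicator (Q k) x * u x \<partial>?M)"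
      by (rule Bochner_Integration.integral_sum) (use cut that in auto)
    finally show ?thesis .
  qed
  let ?c = "2 ^ DIM('a) * \<delta>\<^sup>2 / 2 :: real"
  have "(\<integral>x. (F x)\<^sup>2 \<partial>?M) \<le> (\<Sum>k\<in>K. ?c * (\<integral>x. indicator (Q k) x * (norm (G x))\<^sup>2 \<partial>?M))"
    unfolding part[OF i(2)]
    by (intro sum_mono Poincare_convex_H10[OF \<Lambda> H]) (fact K(2) K(3) K(4) sub mean | assumption)+
  also have "\<dots> = ?c * (\<integral>x. (norm (G x))\<^sup>2 \<partial>?M)"
    unfolding part[OF i(3)] by (simp add: sum_distrib_left)
  also have "\<dots> \<le> ?c * (2 * ((\<mu> + B) * (\<integral>x. (F x)\<^sup>2 \<partial>?M)))"
  proof (rule mult_left_mono)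
    have "- B * (\<integral>x. (F x)\<^sup>2 \<partial>?M) = (\<integral>x. - B * (F x)\<^sup>2 \<partial>?M)" by simp
    also have "\<dots> \<le> (\<integral>x. W x * (F x)\<^sup>2 \<partial>?M)"
    proof (rule integral_mono_AE)
      show "AE x in ?M. - B * (F x)\<^sup>2 \<le> W x * (F x)\<^sup>2"
        using B by eventually_elim (intro mult_right_mono, auto)
    qed (use i in auto)
    finally show "(\<integral>x. (norm (G x))\<^sup>2 \<partial>?M) \<le> 2 * ((\<mu> + B) * (\<integral>x. (F x)\<^sup>2 \<partial>?M))"
      using e by (simp add: energy_def algebra_simps)
  qed simp
  also have "\<dots> = (2 ^ DIM('a) * \<delta>\<^sup>2 * (\<mu> + B)) * (\<integral>x. (F x)\<^sup>2 \<partial>?M)" by simp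
  also have "\<dots> < 1 * (\<integral>x. (F x)\<^sup>2 \<partial>?M)"
    using small p by (intro mult_strict_right_mono) auto
  finally show False by simp
qed

section \<open>Random intervals\<close>

lemma compl_sigma_subalgebra:
  assumes "\<forall>s. V s \<in> borel_measurable M"
  shows "subalgebra M (compl_sigma M V s)"
proof -
  let ?G = "{V t -` A \<inter> space M | t A. t \<noteq> s \<and> A \<in> sets borel}"
  have "?G \<subseteq> sets M" using assms by (auto intro: measurable_sets)
  moreover from this have "?G \<subseteq> Pow (space M)" using sets.sets_into_space by blast
  ultimately show ?thesis
    unfolding subalgebra_def compl_sigma_def
    by (simp add: sets.sigma_sets_subset)
qed

lemma measurable_compl_sigma:
  assumes "t \<noteq> s"
  shows "V t \<in> borel_measurable (compl_sigma M V s)"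
  unfolding compl_sigma_def
proof (rule measurableI)
  fix A :: "real set" assume "A \<in> sets borel"
  moreover have "space (sigma (space M) {V t -` A \<inter> space M |t A. t \<noteq> s \<and> A \<in> sets borel}) = space M"
    by (rule space_measure_of) blast
  ultimately show "V t -` A \<inter> space (sigma (space M) {V t -` A \<inter> space M |t A. t \<noteq> s \<and> A \<in> sets borel})
     \<in> sets (sigma (space M) {V t -` A \<inter> space M |t A. t \<noteq> s \<and> A \<in> sets borel})"
    using assms by (subst sets_measure_of) (blast, auto)
qed simp

lemma prob_space_subalgebra_sigma_finite:
  assumes "prob_space M" "subalgebra M F"
  shows "sigma_finite_subalgebra M F"
proof -
  interpret prob_space M by fact
  have "finite_measure_subalgebra M F"
    using assms(2) by unfold_locales
  then show ?thesis by (rule finite_measure_subalgebra_is_sigma_finite)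
qed

section \<open>Conditional distribution of one site given all others\<close>

context
  fixes M :: "'w measure" and V :: "int^'d \<Rightarrow> 'w \<Rightarrow> real"
  assumes P: "prob_space M" and rv: "\<forall>s. V s \<in> borel_measurable M"
begin

interpretation prob_space M by (rule P)

lemma potential_measurable [measurable]: "V s \<in> borel_measurable M"
  using rv by blast

lemma cond_cdf_measurable [measurable]: "cond_cdf M V s y \<in> borel_measurable M"
  unfolding cond_cdf_def by simp

lemma level_set [measurable]: "{\<omega> \<in> space M. V s \<omega> < y} \<in> sets M"
  by measurable

lemma integrable_cond_cdf: "integrable M (cond_cdf M V s y)"
proof -
  interpret sigma_finite_subalgebra M "compl_sigma M V s"
    by (rule prob_space_subalgebra_sigma_finite[OF P compl_sigma_subalgebra[OF rv]])
  show ?thesis unfolding cond_cdf_def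
    by (rule real_cond_exp_int(1)) (auto intro: integrable_real_indicator simp: emeasure_eq_measure)
qed

lemma cond_cdf_mono:
  assumes "y \<le> z"
  shows "AE \<omega> in M. 0 \<le> cond_cdf M V s z \<omega> - cond_cdf M V s y \<omega> \<and> cond_cdf M V s z \<omega> - cond_cdf M V s y \<omega> \<le> 1"
proof -
  interpret sigma_finite_subalgebra M "compl_sigma M V s"
    by (rule prob_space_subalgebra_sigma_finite[OF P compl_sigma_subalgebra[OF rv]])
  let ?I = "\<lambda>y. indicat_real {\<omega> \<in> space M. V s \<omega> < y}"
  have i: "integrable M (?I y)" for y
    by (auto intro: integrable_real_indicator simp: emeasure_eq_measure)
  have "AE \<omega> in M. cond_cdf M V s y \<omega> \<le> cond_cdf M V s z \<omega>"
    unfolding cond_cdf_def using assms by (intro real_cond_exp_mono i) (auto simp: indicator_def)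
  moreover have "AE \<omega> in M. cond_cdf M V s z \<omega> \<le> 1"
    unfolding cond_cdf_def by (intro real_cond_exp_le_c i) (auto simp: indicator_def)
  moreover have "AE \<omega> in M. 0 \<le> cond_cdf M V s y \<omega>"
    unfolding cond_cdf_def by (intro real_cond_exp_ge_c i) (auto simp: indicator_def)
  ultimately show ?thesis by eventually_elim auto
qed

text \<open>For fixed endpoints this is the defining property of conditional expectation; the
  interval is half-open because \<open>cond_cdf\<close> is defined with a strict inequality.\<close>

lemma prob_interval_cond_cdf:
  assumes A: "A \<in> sets (compl_sigma M V s)" and yz: "y \<le> z"
  shows "prob (A \<inter> {\<omega> \<in> space M. y \<le> V s \<omega> \<and> V s \<omega> < z})
    = (\<integral>\<omega>. indicator A \<omega> * (cond_cdf M V s z \<omega> - cond_cdf M V s y \<omega>) \<partial>M)"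
proof -
  interpret sigma_finite_subalgebra M "compl_sigma M V s"
    by (rule prob_space_subalgebra_sigma_finite[OF P compl_sigma_subalgebra[OF rv]])
  have A' [measurable]: "A \<in> sets M"
    using A compl_sigma_subalgebra[OF rv, of s] by (auto simp: subalgebra_def)
  let ?I = "\<lambda>y. indicat_real {\<omega> \<in> space M. V s \<omega> < y}"
  have i: "integrable M (?I y)" for y
    by (auto intro: integrable_real_indicator simp: emeasure_eq_measure)
  have iA: "integrable M (\<lambda>\<omega>. indicator A \<omega> * f \<omega>)" if "integrable M f" for f :: "'w \<Rightarrow> real"
    using integrable_mult_indicator[OF A' that] by simp
  have e: "(\<integral>\<omega>. indicator A \<omega> * ?I y \<omega> \<partial>M) = (\<integral>\<omega>. indicator A \<omega> * cond_cdf M V s y \<omega> \<partial>M)" for y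
    using real_cond_exp_intA[OF i A, of y] by (simp add: set_lebesgue_integral_def cond_cdf_def)
  have "prob (A \<inter> {\<omega> \<in> space M. y \<le> V s \<omega> \<and> V s \<omega> < z})
     = (\<integral>\<omega>. indicator (A \<inter> {\<omega> \<in> space M. y \<le> V s \<omega> \<and> V s \<omega> < z}) \<omega> \<partial>M)"
  proof -
    have "A \<inter> {\<omega> \<in> space M. y \<le> V s \<omega> \<and> V s \<omega> < z} \<subseteq> space M" by auto
    then show ?thesis by (simp add: Int_absorb2)
  qed
  also have "\<dots> = (\<integral>\<omega>. indicator A \<omega> * ?I z \<omega> - indicator A \<omega> * ?I y \<omega> \<partial>M)"
    using yz by (intro Bochner_Integration.integral_cong) (auto simp: indicator_def)
  also have "\<dots> = (\<integral>\<omega>. indicator A \<omega> * ?I z \<omega> \<partial>M) - (\<integral>\<omega>. indicator A \<omega> * ?I y \<omega> \<partial>M)"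
    by (intro Bochner_Integration.integral_diff iA i)
  also have "\<dots> = (\<integral>\<omega>. indicator A \<omega> * cond_cdf M V s z \<omega> - indicator A \<omega> * cond_cdf M V s y \<omega> \<partial>M)"
    unfolding e by (intro Bochner_Integration.integral_diff[symmetric] iA integrable_cond_cdf)
  finally show ?thesis by (simp add: right_diff_distrib)
qed

text \<open>Splitting by the finitely many values of \<open>c\<close> makes the endpoint constant on
  each piece, and the pieces lie in the sigma-algebra of the other sites. Integrability is part of
  the claim because \<open>cond_cdf\<close> is given level by level, so inserting a random level
  does not automatically leave a measurable function.\<close>

lemma prob_simple_random_interval:
  assumes c: "c \<in> borel_measurable (compl_sigma M V s)" and fin: "finite (c ` space M)" and d: "0 \<le> d"
  shows "integrable M (\<lambda>\<omega>. cond_cdf M V s (c \<omega> + d) \<omega> - cond_cdf M V s (c \<omega>) \<omega>)"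
    and "prob {\<omega> \<in> space M. c \<omega> \<le> V s \<omega> \<and> V s \<omega> < c \<omega> + d}
      = (\<integral>\<omega>. cond_cdf M V s (c \<omega> + d) \<omega> - cond_cdf M V s (c \<omega>) \<omega> \<partial>M)"
proof -
  let ?Y = "c ` space M" and ?A = "\<lambda>y. c -` {y} \<inter> space M"
  let ?D = "\<lambda>y \<omega>. cond_cdf M V s (y + d) \<omega> - cond_cdf M V s y \<omega>"
  have sp: "space (compl_sigma M V s) = space M"
    using compl_sigma_subalgebra[OF rv, of s] by (simp add: subalgebra_def)
  have A: "?A y \<in> sets (compl_sigma M V s)" for y
    using measurable_sets[OF c, of "{y}"] sp by simp
  then have A' [measurable]: "?A y \<in> sets M" for y
    using compl_sigma_subalgebra[OF rv, of s] unfolding subalgebra_def by blast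
  have ptw: "?D (c \<omega>) \<omega> = (\<Sum>y\<in>?Y. indicator (?A y) \<omega> * ?D y \<omega>)" if "\<omega> \<in> space M" for \<omega>
  proof -
    have "(\<Sum>y\<in>?Y. indicator (?A y) \<omega> * ?D y \<omega>) = (\<Sum>y\<in>?Y. if y = c \<omega> then ?D (c \<omega>) \<omega> else 0)"
      using that by (intro sum.cong) (auto simp: indicator_def)
    also have "\<dots> = ?D (c \<omega>) \<omega>" using fin that by (subst sum.delta) auto
    finally show ?thesis by simp
  qed
  have i: "integrable M (\<lambda>\<omega>. indicator (?A y) \<omega> * ?D y \<omega>)" for y
    using integrable_mult_indicator[OF A' Bochner_Integration.integrable_diff[OF integrable_cond_cdf integrable_cond_cdf]] by simp
  have "integrable M (\<lambda>\<omega>. \<Sum>y\<in>?Y. indicator (?A y) \<omega> * ?D y \<omega>)"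
    by (intro Bochner_Integration.integrable_sum i)
  then show "integrable M (\<lambda>\<omega>. ?D (c \<omega>) \<omega>)"
    by (subst Bochner_Integration.integrable_cong[OF refl ptw])
  have "(\<integral>\<omega>. ?D (c \<omega>) \<omega> \<partial>M) = (\<integral>\<omega>. (\<Sum>y\<in>?Y. indicator (?A y) \<omega> * ?D y \<omega>) \<partial>M)"
    by (rule Bochner_Integration.integral_cong[OF refl ptw])
  also have "\<dots> = (\<Sum>y\<in>?Y. \<integral>\<omega>. indicator (?A y) \<omega> * ?D y \<omega> \<partial>M)"
    by (rule Bochner_Integration.integral_sum) (rule i)
  also have "\<dots> = (\<Sum>y\<in>?Y. prob (?A y \<inter> {\<omega> \<in> space M. y \<le> V s \<omega> \<and> V s \<omega> < y + d}))"
    using d by (intro sum.cong refl prob_interval_cond_cdf[symmetric] A) auto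
  also have "\<dots> = prob (\<Union>y\<in>?Y. ?A y \<inter> {\<omega> \<in> space M. y \<le> V s \<omega> \<and> V s \<omega> < y + d})"
  proof (rule finite_measure_finite_Union[symmetric, OF fin])
    have "{\<omega> \<in> space M. y \<le> V s \<omega> \<and> V s \<omega> < y + d} \<in> sets M" for y
      by measurable
    then show "(\<lambda>y. ?A y \<inter> {\<omega> \<in> space M. y \<le> V s \<omega> \<and> V s \<omega> < y + d}) ` ?Y \<subseteq> sets M"
      using A' by blast
  qed (auto simp: disjoint_family_on_def)
  also have "(\<Union>y\<in>?Y. ?A y \<inter> {\<omega> \<in> space M. y \<le> V s \<omega> \<and> V s \<omega> < y + d})
     = {\<omega> \<in> space M. c \<omega> \<le> V s \<omega> \<and> V s \<omega> < c \<omega> + d}" by auto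
  finally show "prob {\<omega> \<in> space M. c \<omega> \<le> V s \<omega> \<and> V s \<omega> < c \<omega> + d} = (\<integral>\<omega>. ?D (c \<omega>) \<omega> \<partial>M)" by simp
qed

text \<open>Dyadic rounding of the random endpoint reduces the claim to countably many deterministic intervals;
  continuity of the conditional distribution function lets the interval be closed on the right.\<close>

lemma prob_random_interval:
  assumes c: "c \<in> borel_measurable (compl_sigma M V s)" and B: "\<And>\<omega>. \<omega> \<in> space M \<Longrightarrow> \<bar>c \<omega>\<bar> \<le> B" and d: "0 \<le> d"
    and G: "\<And>\<omega> y. isCont (\<lambda>y. G y \<omega>) y" "\<And>y. AE \<omega> in M. cond_cdf M V s y \<omega> = G y \<omega>"
    and r: "\<And>y. AE \<omega> in M. cond_cdf M V s (y + d) \<omega> - cond_cdf M V s y \<omega> \<le> r"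
  shows "prob {\<omega> \<in> space M. c \<omega> \<le> V s \<omega> \<and> V s \<omega> \<le> c \<omega> + d} \<le> r"
proof -
  let ?e = "\<lambda>n::nat. 1 / 2 ^ n :: real"
  have e0: "0 < ?e n" for n by simp
  \<comment> \<open>\<open>C n\<close> rounds \<open>c\<close> down to the grid of mesh
    \<open>1 / 2 ^ n\<close>; as \<open>c\<close> is bounded, it takes finitely many values.\<close>
  define C where "C n \<omega> = of_int \<lfloor>2 ^ n * c \<omega>\<rfloor> / (2 ^ n :: real)" for n \<omega>
  have cm: "c \<in> borel_measurable M" using c compl_sigma_subalgebra[OF rv] measurable_from_subalg by blast
  have C1: "C n \<omega> \<le> c \<omega>" and C2: "c \<omega> < C n \<omega> + ?e n" for n \<omega>
  proof -
    have "of_int \<lfloor>2 ^ n * c \<omega>\<rfloor> \<le> 2 ^ n * c \<omega>" by simp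
    then show "C n \<omega> \<le> c \<omega>" by (simp add: C_def field_simps)
    have "2 ^ n * c \<omega> < of_int \<lfloor>2 ^ n * c \<omega>\<rfloor> + 1" by linarith
    then show "c \<omega> < C n \<omega> + ?e n" by (simp add: C_def field_simps)
  qed
  have lim0: "(\<lambda>n. ?e n) \<longlonglongrightarrow> 0"
    using LIMSEQ_power_zero[of "1/2 :: real"] by (simp add: power_one_over)
  have Clim: "(\<lambda>n. C n \<omega>) \<longlonglongrightarrow> c \<omega>" for \<omega>
  proof (rule tendsto_sandwich[of "\<lambda>n. c \<omega> - ?e n" _ _ "\<lambda>_. c \<omega>"])
    show "(\<lambda>n. c \<omega> - ?e n) \<longlonglongrightarrow> c \<omega>" using tendsto_diff[OF tendsto_const lim0, of "c \<omega>"] by simp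
    show "\<forall>\<^sub>F n in sequentially. c \<omega> - ?e n \<le> C n \<omega>"
      using C2[of \<omega>] by (intro always_eventually allI) (simp add: diff_le_eq less_imp_le)
  qed (use C1 in auto)
  have Cm: "C n \<in> borel_measurable (compl_sigma M V s)" for n
    unfolding C_def using c by measurable
  have Cfin: "finite ((\<lambda>\<omega>. C n \<omega> + a) ` space M)" for n a
  proof (rule finite_subset)
    show "(\<lambda>\<omega>. C n \<omega> + a) ` space M \<subseteq> (\<lambda>k. of_int k / 2 ^ n + a) ` {\<lfloor>2 ^ n * - B\<rfloor>..\<lfloor>2 ^ n * B\<rfloor>}"
    proof (rule image_subsetI)
      fix \<omega> assume "\<omega> \<in> space M"
      then have b: "- B \<le> c \<omega>" "c \<omega> \<le> B" using B[of \<omega>] by auto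
      have "\<lfloor>2 ^ n * c \<omega>\<rfloor> \<in> {\<lfloor>2 ^ n * - B\<rfloor>..\<lfloor>2 ^ n * B\<rfloor>}"
        unfolding atLeastAtMost_iff using b by (intro conjI floor_mono mult_left_mono) simp_all
      then show "C n \<omega> + a \<in> (\<lambda>k. of_int k / 2 ^ n + a) ` {\<lfloor>2 ^ n * - B\<rfloor>..\<lfloor>2 ^ n * B\<rfloor>}"
        unfolding C_def by (rule image_eqI[rotated]) simp
    qed
  qed simp
  let ?F = "\<lambda>y \<omega>. cond_cdf M V s y \<omega>"
  \<comment> \<open>Rounding down moves the interval to the left, so its right end is extended by
    \<open>?e n\<close>, which also turns the closed end into an open one. \<open>R n\<close> is the
    conditional probability of this extension and has to vanish in the limit.\<close>
  define R where "R n \<omega> = ?F (C n \<omega> + d + ?e n) \<omega> - ?F (C n \<omega> + d) \<omega>" for n \<omega>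
  have Cd: "(\<lambda>\<omega>. C n \<omega> + d) \<in> borel_measurable (compl_sigma M V s)" for n using Cm by measurable
  have Ri: "integrable M (R n)" for n
    unfolding R_def by (rule prob_simple_random_interval(1)[OF Cd Cfin]) simp
  have Di: "integrable M (\<lambda>\<omega>. ?F (C n \<omega> + d) \<omega> - ?F (C n \<omega>) \<omega>)" for n
    using prob_simple_random_interval(1)[OF Cm _ d, of n] Cfin[of n 0] by simp
  define p where "p = prob {\<omega> \<in> space M. c \<omega> \<le> V s \<omega> \<and> V s \<omega> \<le> c \<omega> + d}"
  have le: "p \<le> r + (\<integral>\<omega>. R n \<omega> \<partial>M)" for n
  proof -
    have "p \<le> prob {\<omega> \<in> space M. C n \<omega> \<le> V s \<omega> \<and> V s \<omega> < C n \<omega> + (d + ?e n)}"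
      unfolding p_def
    proof (rule finite_measure_mono)
      show "{\<omega> \<in> space M. c \<omega> \<le> V s \<omega> \<and> V s \<omega> \<le> c \<omega> + d}
        \<subseteq> {\<omega> \<in> space M. C n \<omega> \<le> V s \<omega> \<and> V s \<omega> < C n \<omega> + (d + ?e n)}"
      proof (intro subsetI CollectI conjI; elim CollectE conjE)
        fix \<omega> assume "c \<omega> \<le> V s \<omega>" "V s \<omega> \<le> c \<omega> + d"
        then show "C n \<omega> \<le> V s \<omega>" "V s \<omega> < C n \<omega> + (d + ?e n)"
          using C1[of n \<omega>] C2[of \<omega> n] by linarith+
      qed
      have "C n \<in> borel_measurable M" using Cm compl_sigma_subalgebra[OF rv] measurable_from_subalg by blast
      then show "{\<omega> \<in> space M. C n \<omega> \<le> V s \<omega> \<and> V s \<omega> < C n \<omega> + (d + ?e n)} \<in> events"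
        by measurable
    qed
    also have "\<dots> = (\<integral>\<omega>. ?F (C n \<omega> + (d + ?e n)) \<omega> - ?F (C n \<omega>) \<omega> \<partial>M)"
      using Cfin[of n 0] d e0[of n] by (intro prob_simple_random_interval(2) Cm) (simp_all add: add_nonneg_nonneg less_imp_le)
    also have "\<dots> = (\<integral>\<omega>. (?F (C n \<omega> + d) \<omega> - ?F (C n \<omega>) \<omega>) + R n \<omega> \<partial>M)"
      by (simp add: R_def add.assoc)
    also have "\<dots> = (\<integral>\<omega>. ?F (C n \<omega> + d) \<omega> - ?F (C n \<omega>) \<omega> \<partial>M) + (\<integral>\<omega>. R n \<omega> \<partial>M)"
      by (rule Bochner_Integration.integral_add[OF Di Ri])
    also have "(\<integral>\<omega>. ?F (C n \<omega> + d) \<omega> - ?F (C n \<omega>) \<omega> \<partial>M) \<le> (\<integral>\<omega>. r \<partial>M)"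
    proof (rule integral_mono_AE[OF Di])
      \<comment> \<open>The bound \<open>r\<close> holds almost surely at each fixed level; the
        finitely many values of \<open>C n\<close> share one null set.\<close>
      have "AE \<omega> in M. \<forall>y\<in>C n ` space M. ?F (y + d) \<omega> - ?F y \<omega> \<le> r"
        using r Cfin[of n 0] by (intro AE_finite_allI) auto
      then show "AE \<omega> in M. ?F (C n \<omega> + d) \<omega> - ?F (C n \<omega>) \<omega> \<le> r"
        using AE_space by eventually_elim blast
    qed simp
    also have "(\<integral>\<omega>. r \<partial>M) = r" by (simp add: prob_space)
    finally show ?thesis by simp
  qed
  have "(\<lambda>n. \<integral>\<omega>. R n \<omega> \<partial>M) \<longlonglongrightarrow> (\<integral>\<omega>. 0 \<partial>M)"
  proof (rule integral_dominated_convergence[where w = "\<lambda>_. 1"])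
    \<comment> \<open>\<open>cond_cdf\<close> agrees with its continuous version \<open>G\<close>
      only almost surely at each level. The levels that occur lie on countably many shifted grid
      points, so a single null set serves all \<open>n\<close>.\<close>
    have fg: "AE \<omega> in M. \<forall>n::nat. \<forall>k::int. ?F (of_int k / 2 ^ n + d) \<omega> = G (of_int k / 2 ^ n + d) \<omega>
      \<and> ?F (of_int k / 2 ^ n + d + ?e n) \<omega> = G (of_int k / 2 ^ n + d + ?e n) \<omega>"
      unfolding AE_all_countable using G(2) by (intro allI AE_conjI) auto
    then show "AE \<omega> in M. (\<lambda>n. R n \<omega>) \<longlonglongrightarrow> 0"
    proof eventually_elim
      case (elim \<omega>)
      have R_eq: "R n \<omega> = G (C n \<omega> + d + ?e n) \<omega> - G (C n \<omega> + d) \<omega>" for n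
        using elim unfolding R_def C_def by simp
      have l1: "(\<lambda>n. C n \<omega> + d) \<longlonglongrightarrow> c \<omega> + d" by (intro tendsto_intros Clim)
      have l2: "(\<lambda>n. C n \<omega> + d + ?e n) \<longlonglongrightarrow> c \<omega> + d" using tendsto_add[OF l1 lim0] by simp
      have "(\<lambda>n. G (C n \<omega> + d + ?e n) \<omega> - G (C n \<omega> + d) \<omega>) \<longlonglongrightarrow> G (c \<omega> + d) \<omega> - G (c \<omega> + d) \<omega>"
        by (intro tendsto_diff isCont_tendsto_compose[OF G(1) l1] isCont_tendsto_compose[OF G(1) l2])
      then show ?case by (simp add: R_eq)
    qed
    fix n
    have "AE \<omega> in M. \<forall>y\<in>(\<lambda>\<omega>. C n \<omega> + d) ` space M. 0 \<le> ?F (y + ?e n) \<omega> - ?F y \<omega> \<and> ?F (y + ?e n) \<omega> - ?F y \<omega> \<le> 1"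
      using Cfin[of n d] by (intro AE_finite_allI cond_cdf_mono) auto
    then show "AE \<omega> in M. norm (R n \<omega>) \<le> 1"
      using AE_space
    proof eventually_elim
      case (elim \<omega>)
      then have "0 \<le> R n \<omega> \<and> R n \<omega> \<le> 1" unfolding R_def by (elim ballE[of _ _ "C n \<omega> + d"]) auto
      then show ?case by simp
    qed
  qed (use Ri in auto)
  then have "(\<lambda>n. r + (\<integral>\<omega>. R n \<omega> \<partial>M)) \<longlonglongrightarrow> r + 0" by (intro tendsto_intros) simp
  from LIMSEQ_le_const[OF this] le show ?thesis unfolding p_def by auto
qed

end

section \<open>Stollmann estimate\<close>

text \<open>As the endpoint tends to \<open>y\<close>, the indicators converge except possibly at
  the single point \<open>t = y\<close>, so dominated convergence applies. Under E3 this provides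
  the continuous version of the conditional distribution function.\<close>

lemma isCont_integral_lessThan:
  fixes p :: "real \<Rightarrow> real"
  assumes p: "integrable lborel p"
  shows "isCont (\<lambda>y. \<integral>t. indicator {..<y} t * p t \<partial>lborel) y"
  unfolding continuous_at_sequentially comp_def
proof (intro allI impI)
  fix u :: "nat \<Rightarrow> real" assume u: "u \<longlonglongrightarrow> y"
  show "(\<lambda>n. \<integral>t. indicator {..<u n} t * p t \<partial>lborel) \<longlonglongrightarrow> (\<integral>t. indicator {..<y} t * p t \<partial>lborel)"
  proof (rule integral_dominated_convergence[where w = "\<lambda>t. norm (p t)"])
    have "AE t in lborel. t \<noteq> y" by (rule AE_lborel_singleton)
    then show "AE t in lborel. (\<lambda>n. indicator {..<u n} t * p t) \<longlonglongrightarrow> indicator {..<y} t * p t"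
    proof eventually_elim
      case (elim t)
      have "\<forall>\<^sub>F n in sequentially. indicat_real {..<u n} t = indicator {..<y} t"
      proof (cases "t < y")
        case True
        from order_tendstoD(1)[OF u this] show ?thesis by eventually_elim (use True in simp)
      next
        case False
        with elim have "y < t" by simp
        from order_tendstoD(2)[OF u this] show ?thesis by eventually_elim (use False in simp)
      qed
      then show ?case by (intro tendsto_mult_right tendsto_eventually)
    qed
    show "AE t in lborel. norm (indicator {..<u n} t * p t) \<le> norm (p t)" for n
      by (auto simp: indicator_def)
  qed (use p in auto)
qed

text \<open>Stollmann's argument. Lower the sites of \<open>S\<close> one after the other by slightly more than \<open>2 \<epsilon>\<close>: then \<open>h\<close> drops
  from above \<open>-\<epsilon>\<close> to below \<open>-\<epsilon>\<close>, and the first site where this happens has its potential within \<open>2 \<epsilon>\<close>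
  of a threshold determined by the other sites.\<close>

lemma Stollmann_estimate:
  fixes M :: "'w measure" and V :: "int^'d \<Rightarrow> 'w \<Rightarrow> real" and h :: "(int^'d \<Rightarrow> real) \<Rightarrow> real"
  assumes P: "prob_space M" and rv: "\<forall>s. V s \<in> borel_measurable M"
    and B: "\<forall>s\<in>S. AE \<omega> in M. \<bar>V s \<omega>\<bar> \<le> B" and S: "finite S"
    and h: "h \<in> borel_measurable borel"
    and mono: "\<And>v w. (\<And>s. v s \<le> w s) \<Longrightarrow> (\<And>s. s \<notin> S \<Longrightarrow> v s = w s) \<Longrightarrow> h v \<le> h w"
    and diag: "\<And>v t. 0 \<le> t \<Longrightarrow> h (\<lambda>s. v s - t * indicator S s) \<le> h v - t"
    and \<epsilon>: "0 < \<epsilon>"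
    and conc: "\<And>s c b. s \<in> S \<Longrightarrow> c \<in> borel_measurable (compl_sigma M V s) \<Longrightarrow> (\<And>\<omega>. \<omega> \<in> space M \<Longrightarrow> \<bar>c \<omega>\<bar> \<le> b) \<Longrightarrow>
       measure M {\<omega> \<in> space M. c \<omega> \<le> V s \<omega> \<and> V s \<omega> \<le> c \<omega> + 2 * \<epsilon>} \<le> r"
  shows "{\<omega> \<in> space M. \<bar>h (\<lambda>s. V s \<omega>)\<bar> \<le> \<epsilon>} \<in> sets M"
    and "measure M {\<omega> \<in> space M. \<bar>h (\<lambda>s. V s \<omega>)\<bar> \<le> \<epsilon>} \<le> real (card S) * r"
proof -
  interpret prob_space M by (rule P)
  have hm: "(\<lambda>\<omega>. h (u \<omega>)) \<in> borel_measurable N"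
    if "\<And>s. (\<lambda>\<omega>. u \<omega> s) \<in> borel_measurable N" for u and N :: "'w measure"
    by (rule measurable_compose[OF measurable_coordinatewise_then_product h]) (rule that)
  have Vm [measurable]: "V s \<in> borel_measurable M" for s using rv by blast
  have [measurable]: "(\<lambda>\<omega>. h (\<lambda>s. V s \<omega>)) \<in> borel_measurable M" by (rule hm) (rule Vm)
  show ev: "{\<omega> \<in> space M. \<bar>h (\<lambda>s. V s \<omega>)\<bar> \<le> \<epsilon>} \<in> sets M" by measurable
  obtain \<sigma> :: "nat \<Rightarrow> int^'d" where \<sigma>: "bij_betw \<sigma> {0..<card S} S"
    using ex_bij_betw_nat_finite[OF S] by blast
  define E where "E j = \<sigma> ` {0..<j}" for j
  \<comment> \<open>The excess of each lowering over \<open>2 * \<epsilon>\<close>: positive, so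
    that the final drop is strict, and decreasing to 0.\<close>
  define \<eta> where "\<eta> m = 1 / real (Suc m)" for m
  have \<eta>0: "0 < \<eta> m" for m by (simp add: \<eta>_def)
  have \<eta>_anti: "\<eta> n \<le> \<eta> m" if "m \<le> n" for m n
    using that by (simp add: \<eta>_def frac_le)
  define sh where "sh j m v = (\<lambda>s. v s - (2 * \<epsilon> + \<eta> m) * indicator (E j) s)" for j m and v :: "int^'d \<Rightarrow> real"
  \<comment> \<open>Quantifying over all excesses, instead of fixing one, makes the final interval
    have length exactly \<open>2 * \<epsilon>\<close>.\<close>
  define low where "low j v \<longleftrightarrow> (\<forall>m. h (sh j m v) < - \<epsilon>)" for j v
  \<comment> \<open>\<open>- B'\<close> is the default value of \<open>val\<close>; it lies below
    every site potential bounded by \<open>B\<close>.\<close>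
  define B' where "B' = \<bar>B\<bar> + 2 * \<epsilon> + 1"
  have E0: "E 0 = {}" and Ecard: "E (card S) = S"
    using \<sigma> by (auto simp: E_def bij_betw_def)
  have Esub: "E j \<subseteq> S" if "j \<le> card S" for j
    using that \<sigma> by (auto simp: E_def bij_betw_def)
  have ESuc: "E (Suc j) = insert (\<sigma> j) (E j)" for j
    by (auto simp: E_def less_Suc_eq)
  have \<sigma>S: "\<sigma> j \<in> S" if "j < card S" for j using \<sigma> that by (auto simp: bij_betw_def)
  have notE: "\<sigma> j \<notin> E j" if "j < card S" for j
  proof
    assume "\<sigma> j \<in> E j"
    then obtain i where "i < j" "\<sigma> j = \<sigma> i" by (auto simp: E_def)
    moreover have "inj_on \<sigma> {0..<card S}" using \<sigma> by (simp add: bij_betw_def)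
    ultimately show False using that by (auto dest!: inj_onD[of _ _ j i])
  qed
  \<comment> \<open>The threshold \<open>c j\<close> below is the supremum of those \<open>q\<close>
    which, put at site \<open>\<sigma> j\<close>, already make \<open>h\<close> low once the first
    \<open>j\<close> sites are lowered. Overwriting the coordinate removes the dependence on
    \<open>V (\<sigma> j)\<close>. Rational \<open>q\<close> keep the supremum countable, hence
    measurable, and the cut-off at \<open>B'\<close> keeps it bounded.\<close>
  define val where "val j q \<omega> = (if low j ((\<lambda>s. V s \<omega>)(\<sigma> j := q)) then q else - B')" for j q \<omega>
  let ?I = "\<rat> \<inter> {-B'..B'}"
  define c where "c j \<omega> = (SUP q\<in>?I. val j q \<omega>)" for j \<omega>
  have B'0: "0 < B'" using \<epsilon> by (simp add: B'_def)
  have Ine: "?I \<noteq> {}" using B'0 by (auto intro!: exI[of _ 0])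
  have valI: "- B' \<le> val j q \<omega>" "val j q \<omega> \<le> B'" if "q \<in> ?I" for j q \<omega>
    using that B'0 by (auto simp: val_def)
  have bdd: "bdd_above ((\<lambda>q. val j q \<omega>) ` ?I)" for j \<omega>
    using valI(2) by (intro bdd_aboveI[of _ B']) blast
  have c_ge: "val j q \<omega> \<le> c j \<omega>" if "q \<in> ?I" for j q \<omega>
    unfolding c_def using that by (rule cSUP_upper[OF _ bdd])
  have c_le: "c j \<omega> \<le> x" if "\<And>q. q \<in> ?I \<Longrightarrow> val j q \<omega> \<le> x" for j \<omega> x
    unfolding c_def by (rule cSUP_least[OF Ine that])
  have cB: "\<bar>c j \<omega>\<bar> \<le> B'" for j \<omega>
  proof -
    obtain q where q: "q \<in> ?I" using Ine by blast
    have "- B' \<le> c j \<omega>" using valI(1)[OF q] c_ge[OF q] order_trans by blast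
    moreover have "c j \<omega> \<le> B'" using valI(2) by (intro c_le)
    ultimately show ?thesis by (simp add: abs_le_iff)
  qed
  have cm: "c j \<in> borel_measurable (compl_sigma M V (\<sigma> j))" for j
  proof -
    let ?F = "compl_sigma M V (\<sigma> j)"
    have "(\<lambda>\<omega>. val j q \<omega>) \<in> borel_measurable ?F" for q
    proof -
      have "(\<lambda>\<omega>. h (sh j m ((\<lambda>s. V s \<omega>)(\<sigma> j := q)))) \<in> borel_measurable ?F" for m
      proof (rule hm)
        fix s
        show "(\<lambda>\<omega>. sh j m ((\<lambda>s. V s \<omega>)(\<sigma> j := q)) s) \<in> borel_measurable ?F"
        proof (cases "s = \<sigma> j")
          case False
          have "V s \<in> borel_measurable ?F" by (rule measurable_compl_sigma[OF False])
          then show ?thesis using False by (simp add: sh_def)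
        qed (simp add: sh_def)
      qed
      note [measurable] = this
      show ?thesis unfolding val_def low_def by measurable
    qed
    then show ?thesis unfolding c_def[abs_def]
      by (intro borel_measurable_cSUP bdd countable_Int1 countable_rat)
  qed
  have low_mono: "low j v" if "low j w" "\<And>s. v s \<le> w s" "\<And>s. s \<notin> S \<Longrightarrow> v s = w s" for j v w
    unfolding low_def
  proof
    fix m
    have "h (sh j m v) \<le> h (sh j m w)" using that(2,3) by (intro mono) (auto simp: sh_def)
    then show "h (sh j m v) < - \<epsilon>" using that(1) by (auto simp: low_def intro: le_less_trans)
  qed
  have key: "\<exists>j<card S. c j \<omega> \<le> V (\<sigma> j) \<omega> \<and> V (\<sigma> j) \<omega> \<le> c j \<omega> + 2 * \<epsilon>"
    if good: "\<And>s. s \<in> S \<Longrightarrow> \<bar>V s \<omega>\<bar> \<le> B" and hV: "\<bar>h (\<lambda>s. V s \<omega>)\<bar> \<le> \<epsilon>" for \<omega>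
  proof -
    define v where "v s = V s \<omega>" for s
    have hv: "- \<epsilon> \<le> h v" "h v \<le> \<epsilon>" using hV by (auto simp: v_def[abs_def])
    have "sh 0 m v = v" for m by (simp add: sh_def E0)
    then have "\<not> low 0 v" using hv(1) by (auto simp: low_def not_less)
    moreover have "low (card S) v"
      unfolding low_def
    proof
      fix m
      have "h (sh (card S) m v) \<le> h v - (2 * \<epsilon> + \<eta> m)"
        unfolding sh_def Ecard using \<epsilon> \<eta>0[of m] by (intro diag) simp
      then show "h (sh (card S) m v) < - \<epsilon>" using hv(2) \<eta>0[of m] by linarith
    qed
    ultimately obtain j where j: "j < card S" "\<not> low j v" "low (Suc j) v"
      using ex_least_nat_less[of "\<lambda>j. low j v" "card S"] by auto
    let ?s = "\<sigma> j"
    have vs: "\<bar>v ?s\<bar> \<le> B" using good[OF \<sigma>S[OF j(1)]] by (simp add: v_def)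
    \<comment> \<open>No \<open>q\<close> at or above the actual potential can be low at stage
      \<open>j\<close>: monotonicity would make \<open>v\<close> itself low at that stage.\<close>
    have "c j \<omega> \<le> v ?s"
    proof (rule c_le)
      fix q assume "q \<in> ?I"
      show "val j q \<omega> \<le> v ?s"
      proof (cases "low j (v(?s := q))")
        case True
        have "q < v ?s"
        proof (rule ccontr)
          assume nq: "\<not> q < v ?s"
          have "low j v" by (rule low_mono[OF True]) (use nq \<sigma>S[OF j(1)] in auto)
          then show False using j(2) by simp
        qed
        then show ?thesis using True by (simp add: val_def v_def[abs_def])
      next
        case False
        then have "val j q \<omega> = - B'" by (simp add: val_def v_def[abs_def])
        then show ?thesis using vs \<epsilon> by (simp add: B'_def abs_le_iff)
      qed
    qed
    \<comment> \<open>Conversely, every \<open>q\<close> below \<open>v ?s - 2 * \<epsilon>\<close>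
      is low at stage \<open>j\<close>: putting \<open>q\<close> at the site lowers it at least as
      far as stage \<open>Suc j\<close> does with a small enough excess.\<close>
    moreover have "v ?s - 2 * \<epsilon> \<le> c j \<omega>"
    proof (rule ccontr)
      assume "\<not> v ?s - 2 * \<epsilon> \<le> c j \<omega>"
      then have "c j \<omega> < v ?s - 2 * \<epsilon>" by simp
      then obtain q where q: "q \<in> \<rat>" "c j \<omega> < q" "q < v ?s - 2 * \<epsilon>" using Rats_dense_in_real by blast
      have qI: "q \<in> ?I" using q cB[of j \<omega>] vs \<epsilon> by (simp add: B'_def abs_le_iff)
      have "low j (v(?s := q))"
        unfolding low_def
      proof
        fix m
        obtain n where n: "\<eta> n < v ?s - 2 * \<epsilon> - q"
          using reals_Archimedean[of "v ?s - 2 * \<epsilon> - q"] q(3) by (auto simp: \<eta>_def inverse_eq_divide)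
        \<comment> \<open>\<open>max m n\<close> meets two demands: an excess small enough for the
          gap at \<open>?s\<close>, and at most \<open>\<eta> m\<close> at the sites already
          lowered.\<close>
        have n': "\<eta> (max m n) < v ?s - 2 * \<epsilon> - q" "\<eta> (max m n) \<le> \<eta> m"
          using \<eta>_anti[of n "max m n"] \<eta>_anti[of m "max m n"] n by auto
        have "h (sh j m (v(?s := q))) \<le> h (sh (Suc j) (max m n) v)"
        proof (rule mono)
          fix s
          show "sh j m (v(?s := q)) s \<le> sh (Suc j) (max m n) v s"
            using n' notE[OF j(1)] by (auto simp: sh_def ESuc indicator_def)
          assume "s \<notin> S"
          then show "sh j m (v(?s := q)) s = sh (Suc j) (max m n) v s"
            using Esub[of j] \<sigma>S[OF j(1)] j(1) by (auto simp: sh_def ESuc indicator_def)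
        qed
        then show "h (sh j m (v(?s := q))) < - \<epsilon>"
          using j(3) by (auto simp: low_def intro: le_less_trans)
      qed
      then have "val j q \<omega> = q" by (simp add: val_def v_def[abs_def])
      then show False using c_ge[OF qI, of j \<omega>] q(2) by simp
    qed
    ultimately show ?thesis using j(1) by (intro exI[of _ j]) (simp add: v_def)
  qed
  let ?C = "\<lambda>j. {\<omega> \<in> space M. c j \<omega> \<le> V (\<sigma> j) \<omega> \<and> V (\<sigma> j) \<omega> \<le> c j \<omega> + 2 * \<epsilon>}"
  have [measurable]: "c j \<in> borel_measurable M" for j
    using cm compl_sigma_subalgebra[OF rv] measurable_from_subalg by blast
  have Cm: "?C j \<in> sets M" for j by measurable
  have "AE \<omega> in M. \<forall>s\<in>S. \<bar>V s \<omega>\<bar> \<le> B" using B S by (intro AE_finite_allI) auto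
  then have "measure M {\<omega> \<in> space M. \<bar>h (\<lambda>s. V s \<omega>)\<bar> \<le> \<epsilon>} \<le> measure M (\<Union>j\<in>{..<card S}. ?C j)"
  proof (intro finite_measure_mono_AE)
    assume "AE \<omega> in M. \<forall>s\<in>S. \<bar>V s \<omega>\<bar> \<le> B"
    then show "AE \<omega> in M. \<omega> \<in> {\<omega> \<in> space M. \<bar>h (\<lambda>s. V s \<omega>)\<bar> \<le> \<epsilon>} \<longrightarrow> \<omega> \<in> (\<Union>j\<in>{..<card S}. ?C j)"
    proof eventually_elim
      case (elim \<omega>)
      then show ?case using key[of \<omega>] by auto
    qed
  qed (use Cm in auto)
  also have "\<dots> \<le> (\<Sum>j\<in>{..<card S}. measure M (?C j))"
    using Cm by (intro finite_measure_subadditive_finite) auto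
  also have "\<dots> \<le> (\<Sum>j\<in>{..<card S}. r)"
    using \<sigma>S cm cB by (intro sum_mono conc[of _ _ B']) auto
  finally show "measure M {\<omega> \<in> space M. \<bar>h (\<lambda>s. V s \<omega>)\<bar> \<le> \<epsilon>} \<le> real (card S) * r" by simp
qed

section \<open>Boxes and cells\<close>

lemma cube_eq_cbox: "cube L u = cbox (\<chi> i. u $ i - L) (\<chi> i. u $ i + L)"
  by (auto simp: cube_def mem_box_cart)

lemma box2_eq_cbox:
  "box2 L1 L2 u = cbox ((\<chi> i. fst u $ i - L1), (\<chi> i. snd u $ i - L2)) ((\<chi> i. fst u $ i + L1), (\<chi> i. snd u $ i + L2))"
  by (simp add: box2_def cube_eq_cbox cbox_Pair_eq)

lemma measure_cube:
  fixes u :: "real^'d"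
  assumes "0 \<le> L"
  shows "measure lborel (cube L u) = (2 * L) ^ CARD('d)"
proof -
  have "u \<in> cube L u" using assms by (simp add: cube_def)
  then have ne: "cbox (\<chi> i. u $ i - L) (\<chi> i. u $ i + L) \<noteq> {}" unfolding cube_eq_cbox[symmetric] by blast
  have "measure lborel (cube L u) = (\<Prod>i\<in>(UNIV::'d set). (u $ i + L) - (u $ i - L))"
    unfolding cube_eq_cbox using content_cbox_cart[OF ne] by simp
  also have "\<dots> = (\<Prod>i\<in>(UNIV::'d set). 2 * L)" by (intro prod.cong) auto
  finally show ?thesis by simp
qed

lemma measure_box2:
  "measure lborel (box2 L1 L2 u) = measure lborel (cube L1 (fst u)) * measure lborel (cube L2 (snd u))"
  unfolding box2_eq_cbox cube_eq_cbox by (rule content_Pair)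

text \<open>An interval of length \<open>w\<close> contains at most \<open>w + 1\<close> integers.
  Lattice sites and grid cells are both counted in this way.\<close>

lemma card_int_vectors_le:
  fixes a :: "'d::finite \<Rightarrow> real"
  assumes w: "0 \<le> w"
  shows "finite {k::int^'d. \<forall>i. a i \<le> of_int (k $ i) \<and> of_int (k $ i) \<le> a i + w}"
    and "real (card {k::int^'d. \<forall>i. a i \<le> of_int (k $ i) \<and> of_int (k $ i) \<le> a i + w}) \<le> (w + 1) ^ CARD('d)"
proof -
  let ?I = "\<lambda>i. {\<lceil>a i\<rceil>..\<lfloor>a i + w\<rfloor>}"
  let ?S = "{k::int^'d. \<forall>i. a i \<le> of_int (k $ i) \<and> of_int (k $ i) \<le> a i + w}"
  have sub: "?S \<subseteq> vec_lambda ` (PiE UNIV ?I)"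
  proof
    fix k assume "k \<in> ?S"
    then have "vec_nth k \<in> PiE UNIV ?I" by (simp add: PiE_UNIV_domain ceiling_le_iff le_floor_iff)
    then show "k \<in> vec_lambda ` (PiE UNIV ?I)" by (intro image_eqI[of _ _ "vec_nth k"]) (simp_all add: vec_nth_inverse)
  qed
  have fin: "finite (PiE UNIV ?I)" by (intro finite_PiE) auto
  show "finite ?S" using finite_subset[OF sub] fin by simp
  have "card ?S \<le> card (PiE UNIV ?I)"
    by (rule order_trans[OF card_mono[OF finite_imageI[OF fin] sub] card_image_le[OF fin]])
  also have "\<dots> = (\<Prod>i\<in>UNIV. card (?I i))" by (simp add: card_PiE)
  finally have "real (card ?S) \<le> real (\<Prod>i\<in>UNIV. card (?I i))" by (rule of_nat_mono)
  then have "real (card ?S) \<le> (\<Prod>i\<in>UNIV. real (card (?I i)))" by (simp only: of_nat_prod)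
  also have "\<dots> \<le> (\<Prod>i\<in>(UNIV::'d set). w + 1)"
  proof (rule prod_mono)
    fix i :: 'd
    have "real (nat (\<lfloor>a i + w\<rfloor> - \<lceil>a i\<rceil> + 1)) \<le> w + 1"
    proof (cases "0 \<le> \<lfloor>a i + w\<rfloor> - \<lceil>a i\<rceil> + 1")
      case True
      then have "real (nat (\<lfloor>a i + w\<rfloor> - \<lceil>a i\<rceil> + 1)) = of_int \<lfloor>a i + w\<rfloor> - of_int \<lceil>a i\<rceil> + 1" by simp
      also have "\<dots> \<le> w + 1" by linarith
      finally show ?thesis .
    qed (use w in simp)
    then show "0 \<le> real (card (?I i)) \<and> real (card (?I i)) \<le> w + 1" by simp
  qed
  finally show "real (card ?S) \<le> (w + 1) ^ CARD('d)" by simp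
qed

lemma lattice_points_cube:
  fixes u :: "real^'d"
  assumes "0 \<le> L"
  shows "finite {s. lattice_pt s \<in> cube L u}"
    and "real (card {s. lattice_pt s \<in> cube L u}) \<le> (2 * L + 1) ^ CARD('d)"
proof -
  have "{s. lattice_pt s \<in> cube L u} = {k. \<forall>i. u $ i - L \<le> of_int (k $ i) \<and> of_int (k $ i) \<le> u $ i - L + 2 * L}"
  proof -
    have e: "u $ i - L + 2 * L = u $ i + L" for i by simp
    show ?thesis unfolding e by (simp add: lattice_pt_def cube_def)
  qed
  then show "finite {s. lattice_pt s \<in> cube L u}" "real (card {s. lattice_pt s \<in> cube L u}) \<le> (2 * L + 1) ^ CARD('d)"
    using card_int_vectors_le[of "2 * L" "\<lambda>i. u $ i - L"] assms by simp_all
qed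

text \<open>For \<open>L \<ge> 1\<close> each coordinate allows at most
  \<open>2 * L + 1 \<le> 2 * (2 * L)\<close> integers; this is the origin of the factor
  \<open>2 ^ CARD('d)\<close> in the final constant.\<close>

lemma card_lattice_points_le_volume:
  fixes u :: "real^'d"
  assumes "1 \<le> L"
  shows "real (card {s. lattice_pt s \<in> cube L u}) \<le> 2 ^ CARD('d) * measure lborel (cube L u)"
proof -
  have "(2 * L + 1) ^ CARD('d) \<le> (2 * (2 * L)) ^ CARD('d)"
    using assms by (intro power_mono) auto
  then show ?thesis
    unfolding power_mult_distrib[of 2 "2 * L"] using lattice_points_cube(2)[of L u] assms
    by (simp only: measure_cube[of L u]) linarith
qed

text \<open>The grid is fixed in space and merely cut by the box. Half-open grid cells are exactly
  disjoint, and intersecting them with the box preserves convexity. The diameter is estimated by the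
  l1 norm in each of the two factors.\<close>

lemma box2_cell_partition:
  fixes u :: "(real^'d) \<times> (real^'d)"
  assumes L: "1 \<le> L1" "1 \<le> L2" and \<delta>: "0 < \<delta>" "\<delta> \<le> 1"
  obtains K :: "((int^'d) \<times> (int^'d)) set" and Q
  where "finite K" "\<And>k. Q k \<in> sets borel" "\<And>k. convex (Q k)"
    "\<And>k x y. x \<in> Q k \<Longrightarrow> y \<in> Q k \<Longrightarrow> norm (x - y) \<le> 2 * real CARD('d) * \<delta>"
    "disjoint_family_on Q K" "box2 L1 L2 u = (\<Union>k\<in>K. Q k)"
    "real (card K) \<le> (2 / \<delta>) ^ (2 * CARD('d)) * measure lborel (box2 L1 L2 u)"
proof -
  define cell1 where "cell1 k = {x::real^'d. \<forall>i. \<lfloor>x $ i / \<delta>\<rfloor> = k $ i}" for k :: "int^'d"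
  define Q where "Q k = box2 L1 L2 u \<inter> (cell1 (fst k) \<times> cell1 (snd k))" for k
  \<comment> \<open>Taking the floor of \<open>x $ i / \<delta>\<close> can lose up to 1, so the
    range of integers starts 1 lower and is longer by 1 than the scaled side of the cube.\<close>
  define K1 where "K1 L u = {k::int^'d. \<forall>i. (u $ i - L) / \<delta> - 1 \<le> of_int (k $ i) \<and> of_int (k $ i) \<le> ((u $ i - L) / \<delta> - 1) + (2 * L / \<delta> + 1)}"
    for L and u :: "real^'d"
  define K where "K = K1 L1 (fst u) \<times> K1 L2 (snd u)"
  have cell1_eq: "cell1 k = (\<Inter>i. (\<lambda>x. x $ i) -` {of_int (k $ i) * \<delta>..<(of_int (k $ i) + 1) * \<delta>})" for k
    using \<delta> by (auto simp: cell1_def floor_eq_iff field_simps)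
  have c_convex: "convex (cell1 k)" for k
    unfolding cell1_eq
    by (intro convex_INT convex_linear_vimage bounded_linear.linear[OF bounded_linear_vec_nth] convex_real_interval)
  have c_borel: "cell1 k \<in> sets borel" for k
  proof -
    have "(\<lambda>x::real^'d. x $ i) -` {a..<b} \<in> sets borel" for i a b
      using measurable_sets[of "\<lambda>x::real^'d. x $ i" borel borel "{a..<b}"] borel_measurable_continuous_onI[of "\<lambda>x::real^'d. x $ i"]
      by (simp add: continuous_on_component)
    then show ?thesis unfolding cell1_eq by (intro sets.countable_INT') auto
  qed
  have c_diam: "norm (x - y) \<le> real CARD('d) * \<delta>" if "x \<in> cell1 k" "y \<in> cell1 k" for x y k
  proof -
    have "norm (x - y) \<le> (\<Sum>i\<in>UNIV. \<bar>(x - y) $ i\<bar>)" by (rule norm_le_l1_cart)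
    also have "\<dots> \<le> (\<Sum>i\<in>(UNIV::'d set). \<delta>)"
    proof (rule sum_mono)
      fix i
      have "of_int (k $ i) * \<delta> \<le> x $ i" "x $ i < (of_int (k $ i) + 1) * \<delta>"
         "of_int (k $ i) * \<delta> \<le> y $ i" "y $ i < (of_int (k $ i) + 1) * \<delta>"
        using that unfolding cell1_eq by auto
      then show "\<bar>(x - y) $ i\<bar> \<le> \<delta>" by (simp add: algebra_simps abs_le_iff)
    qed
    finally show ?thesis by simp
  qed
  have K1_card: "finite (K1 L v)" "real (card (K1 L v)) \<le> (2 / \<delta>) ^ CARD('d) * measure lborel (cube L v)"
    if "1 \<le> L" for L v
  proof -
    have w: "0 \<le> 2 * L / \<delta> + 1" using that \<delta> by simp
    show "finite (K1 L v)" unfolding K1_def by (rule card_int_vectors_le(1)[OF w])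
    have "real (card (K1 L v)) \<le> ((2 * L / \<delta> + 1) + 1) ^ CARD('d)"
      unfolding K1_def by (rule card_int_vectors_le(2)[OF w])
    \<comment> \<open>Since \<open>L / \<delta> \<ge> 1\<close>, the additive 2 is absorbed by
      doubling the main term, which makes the count proportional to the volume.\<close>
    also have "\<dots> \<le> (2 / \<delta> * (2 * L)) ^ CARD('d)"
    proof (rule power_mono)
      have "1 \<le> L / \<delta>" using that \<delta> by (simp add: le_divide_eq)
      moreover have "2 * L / \<delta> = 2 * (L / \<delta>)" "2 / \<delta> * (2 * L) = 4 * (L / \<delta>)" by simp_all
      ultimately show "2 * L / \<delta> + 1 + 1 \<le> 2 / \<delta> * (2 * L)" by linarith
    qed (use w in simp)
    also have "\<dots> = (2 / \<delta>) ^ CARD('d) * measure lborel (cube L v)"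
      unfolding power_mult_distrib[of "2 / \<delta>" "2 * L"] using that by (subst measure_cube) simp_all
    finally show "real (card (K1 L v)) \<le> (2 / \<delta>) ^ CARD('d) * measure lborel (cube L v)" .
  qed
  have K1_cover: "(\<chi> i. \<lfloor>x $ i / \<delta>\<rfloor>) \<in> K1 L v" if "x \<in> cube L v" for x v L
    unfolding K1_def
  proof (intro CollectI allI)
    fix i
    have x: "v $ i - L \<le> x $ i" "x $ i \<le> v $ i + L" using that by (auto simp: cube_def)
    have "(v $ i - L) / \<delta> \<le> x $ i / \<delta>" "x $ i / \<delta> \<le> (v $ i + L) / \<delta>"
      using x \<delta> by (auto intro: divide_right_mono)
    moreover have "(v $ i + L) / \<delta> = (v $ i - L) / \<delta> + 2 * L / \<delta>"
      by (simp add: add_divide_distrib diff_divide_distrib)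
    ultimately show "(v $ i - L) / \<delta> - 1 \<le> of_int ((\<chi> i. \<lfloor>x $ i / \<delta>\<rfloor>) $ i) \<and>
       of_int ((\<chi> i. \<lfloor>x $ i / \<delta>\<rfloor>) $ i) \<le> ((v $ i - L) / \<delta> - 1) + (2 * L / \<delta> + 1)"
      by (simp only: vec_lambda_beta) linarith
  qed
  show thesis
  proof (rule that[of K Q])
    show "finite K" using K1_card(1) L by (simp add: K_def)
    show "Q k \<in> sets borel" for k
      unfolding Q_def box2_eq_cbox using c_borel by (intro sets.Int borel_Times) auto
    show "convex (Q k)" for k
      unfolding Q_def box2_eq_cbox using c_convex by (intro convex_Int convex_Times) auto
    show "norm (x - y) \<le> 2 * real CARD('d) * \<delta>" if "x \<in> Q k" "y \<in> Q k" for k x y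
    proof -
      have "norm (x - y) \<le> norm (fst x - fst y) + norm (snd x - snd y)"
        using norm_Pair_le[of "fst x - fst y" "snd x - snd y"] by (simp add: minus_prod_def)
      also have "\<dots> \<le> real CARD('d) * \<delta> + real CARD('d) * \<delta>"
        using that by (intro add_mono c_diam) (auto simp: Q_def)
      finally show ?thesis by (simp add: ac_simps)
    qed
    show "disjoint_family_on Q K"
      by (auto simp: disjoint_family_on_def Q_def cell1_def vec_eq_iff)
    show "box2 L1 L2 u = (\<Union>k\<in>K. Q k)"
    proof
      show "box2 L1 L2 u \<subseteq> (\<Union>k\<in>K. Q k)"
      proof
        fix x assume x: "x \<in> box2 L1 L2 u"
        let ?k = "((\<chi> i. \<lfloor>fst x $ i / \<delta>\<rfloor>), (\<chi> i. \<lfloor>snd x $ i / \<delta>\<rfloor>))"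
        have "?k \<in> K" using x K1_cover by (auto simp: K_def box2_def)
        moreover have "x \<in> Q ?k" using x by (auto simp: Q_def cell1_def mem_Times_iff)
        ultimately show "x \<in> (\<Union>k\<in>K. Q k)" by blast
      qed
    qed (auto simp: Q_def)
    have "real (card K) = real (card (K1 L1 (fst u))) * real (card (K1 L2 (snd u)))"
      by (simp add: K_def card_cartesian_product)
    also have "\<dots> \<le> ((2 / \<delta>) ^ CARD('d) * measure lborel (cube L1 (fst u))) * ((2 / \<delta>) ^ CARD('d) * measure lborel (cube L2 (snd u)))"
      using L \<delta> by (intro mult_mono K1_card(2) mult_nonneg_nonneg zero_le_power measure_nonneg) auto
    also have "\<dots> = (2 / \<delta>) ^ (2 * CARD('d)) * measure lborel (box2 L1 L2 u)"
      unfolding measure_box2 mult_2 power_add by simp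
    finally show "real (card K) \<le> (2 / \<delta>) ^ (2 * CARD('d)) * measure lborel (box2 L1 L2 u)" .
  qed
qed

section \<open>Separation of cubes in the maximum norm\<close>

lemma maxnorm_ge: "\<bar>x $ i\<bar> \<le> maxnorm x"
  unfolding maxnorm_def by (rule Max_ge) auto

lemma maxnorm_attained: "\<exists>i. maxnorm x = \<bar>x $ i\<bar>"
proof -
  have "maxnorm x \<in> range (\<lambda>i. \<bar>x $ i\<bar>)" unfolding maxnorm_def by (rule Max_in) auto
  then show ?thesis by auto
qed

lemma separated_cubes:
  assumes "La + Lb + R < maxnorm (a - b)" "y \<in> cube La a" "x \<in> cube Lb b"
  shows "R < maxnorm (x - y)"
proof -
  obtain i where i: "maxnorm (a - b) = \<bar>(a - b) $ i\<bar>" using maxnorm_attained by blast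
  have "\<bar>y $ i - a $ i\<bar> \<le> La" "\<bar>x $ i - b $ i\<bar> \<le> Lb"
    using assms(2,3) by (auto simp: cube_def abs_le_iff algebra_simps)
  then have "R < \<bar>(x - y) $ i\<bar>" using assms(1) i by (simp add: abs_if split: if_splits)
  also have "\<dots> \<le> maxnorm (x - y)" by (rule maxnorm_ge)
  finally show ?thesis .
qed

lemma maxnorm_minus: "maxnorm (a - b) = maxnorm (b - a)"
  by (simp add: maxnorm_def abs_minus_commute)

text \<open>Each of the two large distances is a maximum over the particles and so gives an
  alternative. Each of the four combinations of alternatives has exactly one centre in common, and
  this centre is far from both centres of the other box.\<close>

lemma suff_distant_cases:
  assumes sd: "suff_distant R L1 L2 u L1' L2' u'" and R: "0 < R" and L: "1 < L1" "1 < L2" "1 < L1'" "1 < L2'"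
  obtains
    "L1 + L1' + R < maxnorm (fst u - fst u')" "L1 + L2' + R < maxnorm (fst u - snd u')"
  | "L2 + L1' + R < maxnorm (snd u - fst u')" "L2 + L2' + R < maxnorm (snd u - snd u')"
  | "L1' + L1 + R < maxnorm (fst u' - fst u)" "L1' + L2 + R < maxnorm (fst u' - snd u)"
  | "L2' + L1 + R < maxnorm (snd u' - fst u)" "L2' + L2 + R < maxnorm (snd u' - snd u)"
proof -
  define m where "m = Max {L1 + R, L2 + R, L1' + R, L2' + R}"
  have m: "L1 + R \<le> m" "L2 + R \<le> m" "L1' + R \<le> m" "L2' + R \<le> m" unfolding m_def by (auto intro: Max_ge)
  have "8 * m < maxnorm2 (u - u')" "8 * m < maxnorm2 (swap2 u - u')"
    using sd unfolding suff_distant_def m_def by auto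
  then have d: "8 * m < maxnorm (fst u - fst u') \<or> 8 * m < maxnorm (snd u - snd u')"
    "8 * m < maxnorm (snd u - fst u') \<or> 8 * m < maxnorm (fst u - snd u')"
    by (auto simp: maxnorm2_def swap2_def less_max_iff_disj)
  \<comment> \<open>Here \<open>a + b + R \<le> 2 * m - R\<close>, and this is below
    \<open>8 * m\<close> because \<open>m\<close> and \<open>R\<close> are positive.\<close>
  have le: "a + b + R < z" if "8 * m < z" "a + R \<le> m" "b + R \<le> m" "1 < a" "1 < b" for a b z :: real
    using that R by linarith
  have "(8 * m < maxnorm (fst u - fst u') \<and> 8 * m < maxnorm (fst u - snd u'))
    \<or> (8 * m < maxnorm (snd u - fst u') \<and> 8 * m < maxnorm (snd u - snd u'))
    \<or> (8 * m < maxnorm (fst u' - fst u) \<and> 8 * m < maxnorm (fst u' - snd u))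
    \<or> (8 * m < maxnorm (snd u' - fst u) \<and> 8 * m < maxnorm (snd u' - snd u))"
    using d unfolding maxnorm_minus[of "fst u'"] maxnorm_minus[of "snd u'"] by blast
  then consider
      "8 * m < maxnorm (fst u - fst u')" "8 * m < maxnorm (fst u - snd u')"
    | "8 * m < maxnorm (snd u - fst u')" "8 * m < maxnorm (snd u - snd u')"
    | "8 * m < maxnorm (fst u' - fst u)" "8 * m < maxnorm (fst u' - snd u)"
    | "8 * m < maxnorm (snd u' - fst u)" "8 * m < maxnorm (snd u' - snd u)" by blast
  then show thesis
  proof cases
    case 1 then show ?thesis by (intro that(1) le m L)
  next
    case 2 then show ?thesis by (intro that(2) le m L)
  next
    case 3 then show ?thesis by (intro that(3) le m L)
  next
    case 4 then show ?thesis by (intro that(4) le m L)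
  qed
qed

section \<open>Site potentials\<close>

text \<open>It lets the infinite sum of site potentials be replaced by a finite one that agrees with
  it only on the box.\<close>

lemma dirichlet_eigenvalue_cong:
  assumes "\<And>x. x \<in> \<Lambda> \<Longrightarrow> W x = W' x"
  shows "dirichlet_eigenvalue \<Lambda> W E \<longleftrightarrow> dirichlet_eigenvalue \<Lambda> W' E"
proof -
  have "(\<integral>x. W x * f x * \<psi> x \<partial>lebesgue_on \<Lambda>) = (\<integral>x. W' x * f x * \<psi> x \<partial>lebesgue_on \<Lambda>)" for f \<psi>
    by (intro Bochner_Integration.integral_cong refl) (simp add: assms)
  then show ?thesis unfolding dirichlet_eigenvalue_def by simp
qed

text \<open>The mesh of the cells is chosen from \<open>b\<close>, \<open>B\<close> and the
  dimension alone, which makes \<open>C\<close> uniform over all boxes and potentials.\<close>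

lemma eigenvalue_count_box2:
  fixes b B :: real
  shows "\<exists>C>0. \<forall>L1 L2 (u :: (real^'d) \<times> (real^'d)) W n \<mu>. 1 \<le> L1 \<longrightarrow> 1 \<le> L2 \<longrightarrow>
    bdd_potential (box2 L1 L2 u) W \<longrightarrow> (AE x in lebesgue_on (box2 L1 L2 u). - B \<le> W x) \<longrightarrow>
    minmax_adm (box2 L1 L2 u) W n \<mu> \<longrightarrow> \<mu> \<le> b \<longrightarrow> real n \<le> C * measure lborel (box2 L1 L2 u)"
proof -
  define D where "D = DIM((real^'d) \<times> (real^'d))"
  define X where "X = 1 + max 0 (b + B)"
  \<comment> \<open>With this choice the cell diameter \<open>2 * real CARD('d) * \<delta>\<close>
    equals \<open>1 / (2 ^ D * X)\<close>, whose square outweighs the factor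
    \<open>2 ^ D * X\<close>. \<open>X \<ge> 1\<close> ensures
    \<open>\<delta> \<le> 1\<close>.\<close>
  define \<delta> where "\<delta> = 1 / (2 ^ D * (2 * real CARD('d)) * X)"
  have X: "1 \<le> X" "b + B < X" by (auto simp: X_def)
  have D: "1 \<le> D" unfolding D_def using DIM_positive[where 'a = "(real^'d) \<times> (real^'d)"] by linarith
  have p: "(2::real) \<le> 2 ^ D" using power_increasing[OF D, of "2::real"] by simp
  have c: "1 \<le> 2 * real CARD('d)" using zero_less_card_finite[where 'a = 'd] by linarith
  have den: "1 \<le> 2 ^ D * (2 * real CARD('d)) * X"
    using mult_mono[OF mult_mono[OF order_trans[OF _ p] c] X(1), of 1] p c X by simp
  have "0 < 1 / Z \<and> 1 / Z \<le> 1" if "1 \<le> Z" for Z :: real using that by (simp add: divide_le_eq)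
  from this[OF den] have \<delta>: "0 < \<delta>" "\<delta> \<le> 1" unfolding \<delta>_def by blast+
  have e: "2 * real CARD('d) * \<delta> = 1 / (2 ^ D * X)" using c by (simp add: \<delta>_def)
  have small: "2 ^ D * (2 * real CARD('d) * \<delta>)\<^sup>2 * X < 1"
  proof -
    have "2 ^ D * (2 * real CARD('d) * \<delta>)\<^sup>2 * X = 1 / (2 ^ D * X)"
      unfolding e using X by (simp add: power2_eq_square)
    also have "\<dots> < 1" using mult_mono[OF p X(1)] X p by simp
    finally show ?thesis .
  qed
  show ?thesis
  proof (intro exI[of _ "(2 / \<delta>) ^ (2 * CARD('d))"] conjI allI impI)
    show "0 < (2 / \<delta>) ^ (2 * CARD('d))" using \<delta> by simp
    fix L1 L2 and u :: "(real^'d) \<times> (real^'d)" and W n \<mu>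
    assume L: "1 \<le> L1" "1 \<le> L2" and W: "bdd_potential (box2 L1 L2 u) W"
      and lb: "AE x in lebesgue_on (box2 L1 L2 u). - B \<le> W x"
      and adm: "minmax_adm (box2 L1 L2 u) W n \<mu>" and \<mu>: "\<mu> \<le> b"
    have "2 ^ D * (2 * real CARD('d) * \<delta>)\<^sup>2 * (\<mu> + B) \<le> 2 ^ D * (2 * real CARD('d) * \<delta>)\<^sup>2 * X"
      using \<mu> X by (intro mult_left_mono) auto
    with small have sm: "2 ^ DIM((real^'d) \<times> (real^'d)) * (2 * real CARD('d) * \<delta>)\<^sup>2 * (\<mu> + B) < 1"
      unfolding D_def by linarith
    have cpt: "compact (box2 L1 L2 u)" unfolding box2_eq_cbox by simp
    show "real n \<le> (2 / \<delta>) ^ (2 * CARD('d)) * measure lborel (box2 L1 L2 u)"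
    proof (rule box2_cell_partition[OF L \<delta>, of u])
      fix K :: "((int^'d) \<times> (int^'d)) set" and Q
      assume K: "finite K" "\<And>k. Q k \<in> sets borel" "\<And>k. convex (Q k)"
        "\<And>k x y. x \<in> Q k \<Longrightarrow> y \<in> Q k \<Longrightarrow> norm (x - y) \<le> 2 * real CARD('d) * \<delta>"
        "disjoint_family_on Q K" "box2 L1 L2 u = (\<Union>k\<in>K. Q k)"
        and card: "real (card K) \<le> (2 / \<delta>) ^ (2 * CARD('d)) * measure lborel (box2 L1 L2 u)"
      have "n \<le> card K"
        by (rule minmax_adm_card_bound[OF cpt W lb adm K(1) K(2) K(3) K(4) K(5) K(6) sm])
      then show ?thesis using card by linarith
    qed
  qed
qed

text \<open>The assignment \<open>v\<close> is free, because Stollmann's argument moves its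
  coordinates one by one; randomness enters by inserting
  \<open>\<lambda>s. V s \<omega>\<close>.\<close>

definition site_potential :: "('a \<Rightarrow> real) \<Rightarrow> ('s \<Rightarrow> 'a \<Rightarrow> real) \<Rightarrow> 's set \<Rightarrow> ('s \<Rightarrow> real) \<Rightarrow> 'a \<Rightarrow> real" where
  "site_potential U \<Phi> T v x = U x + (\<Sum>s\<in>T. v s * \<Phi> s x)"

context
  fixes U :: "'a::euclidean_space \<Rightarrow> real" and \<Phi> :: "'s \<Rightarrow> 'a \<Rightarrow> real" and \<beta> :: "'s \<Rightarrow> real" and CU :: real
  assumes U: "U \<in> borel_measurable lebesgue" "AE x in lebesgue. \<bar>U x\<bar> \<le> CU"
    and \<Phi>: "\<And>s x. 0 \<le> \<Phi> s x" "\<And>s x. \<Phi> s x \<le> \<beta> s" "\<And>s. \<Phi> s \<in> borel_measurable borel"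
begin

lemma bdd_potential_site:
  assumes \<Lambda>: "compact \<Lambda>"
  shows "bdd_potential \<Lambda> (site_potential U \<Phi> T v)"
proof -
  have L: "\<Lambda> \<in> sets lebesgue" using \<Lambda> by (simp add: compact_imp_closed)
  have [measurable]: "\<Phi> s \<in> borel_measurable lebesgue" for s
    using \<Phi>(3) by (intro measurable_completion) simp
  have m: "site_potential U \<Phi> T v \<in> borel_measurable lebesgue"
    unfolding site_potential_def[abs_def] using U(1) by measurable
  have "AE x in lebesgue. \<bar>site_potential U \<Phi> T v x\<bar> \<le> CU + (\<Sum>s\<in>T. \<bar>v s\<bar> * \<beta> s)"
    using U(2)
  proof eventually_elim
    case (elim x)
    have "\<bar>\<Sum>s\<in>T. v s * \<Phi> s x\<bar> \<le> (\<Sum>s\<in>T. \<bar>v s * \<Phi> s x\<bar>)" by (rule sum_abs)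
    also have "\<dots> \<le> (\<Sum>s\<in>T. \<bar>v s\<bar> * \<beta> s)"
      using \<Phi>(1,2) by (intro sum_mono) (simp add: abs_mult mult_left_mono)
    finally show ?case using elim unfolding site_potential_def by linarith
  qed
  then have "AE x in lebesgue_on \<Lambda>. \<bar>site_potential U \<Phi> T v x\<bar> \<le> CU + (\<Sum>s\<in>T. \<bar>v s\<bar> * \<beta> s)"
    by (rule AE_restrict_space_iff[THEN iffD2, rotated, OF eventually_mono]) (use L in auto)
  moreover have "site_potential U \<Phi> T v \<in> borel_measurable (lebesgue_on \<Lambda>)"
    by (rule measurable_restrict_space1[OF m])
  ultimately show ?thesis unfolding bdd_potential_def by blast
qed

lemma site_potential_diff_le:
  "site_potential U \<Phi> T v x \<le> site_potential U \<Phi> T w x + (\<Sum>s\<in>T. \<bar>v s - w s\<bar> * \<beta> s)"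
proof -
  have "v s * \<Phi> s x \<le> w s * \<Phi> s x + \<bar>v s - w s\<bar> * \<beta> s" for s
  proof -
    have "(v s - w s) * \<Phi> s x \<le> \<bar>v s - w s\<bar> * \<Phi> s x" using \<Phi>(1) by (intro mult_right_mono) auto
    also have "\<dots> \<le> \<bar>v s - w s\<bar> * \<beta> s" using \<Phi>(2) by (intro mult_left_mono) auto
    finally show ?thesis by (simp add: algebra_simps)
  qed
  then have "(\<Sum>s\<in>T. v s * \<Phi> s x) \<le> (\<Sum>s\<in>T. w s * \<Phi> s x + \<bar>v s - w s\<bar> * \<beta> s)"
    by (intro sum_mono)
  then show ?thesis by (simp add: site_potential_def sum.distrib)
qed

context
  fixes \<Lambda> :: "'a set" and T :: "'s set" and n :: nat and v0 :: "'s \<Rightarrow> real" and \<mu>0 :: real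
  assumes \<Lambda>: "compact \<Lambda>" and adm: "minmax_adm \<Lambda> (site_potential U \<Phi> T v0) n \<mu>0" and n: "1 \<le> n"
begin

text \<open>Site potentials for two assignments differ by a bounded amount, so a level admissible at
  one assignment yields one at every other. The min-max value is thereby an infimum over a nonempty
  set for all \<open>v\<close>.\<close>

lemma site_minmax_adm: "minmax_adm \<Lambda> (site_potential U \<Phi> T v) n (\<mu>0 + (\<Sum>s\<in>T. \<bar>v s - v0 s\<bar> * \<beta> s))"
  by (rule minmax_adm_shift[OF \<Lambda> bdd_potential_site[OF \<Lambda>] bdd_potential_site[OF \<Lambda>] _ adm])
    (simp add: site_potential_diff_le)

lemma site_minmax_val_shift:
  assumes "\<And>x. x \<in> \<Lambda> \<Longrightarrow> site_potential U \<Phi> T v x \<le> site_potential U \<Phi> T w x + t"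
  shows "minmax_val \<Lambda> (site_potential U \<Phi> T v) n \<le> minmax_val \<Lambda> (site_potential U \<Phi> T w) n + t"
proof (rule minmax_val_shift[OF \<Lambda> bdd_potential_site[OF \<Lambda>] bdd_potential_site[OF \<Lambda>] _ site_minmax_adm n])
  show "AE x in lebesgue_on \<Lambda>. site_potential U \<Phi> T v x \<le> site_potential U \<Phi> T w x + t"
    using assms by (intro AE_I2) (simp add: space_restrict_space)
qed

text \<open>The value is Lipschitz in the coordinates in \<open>T\<close>, hence continuous in the
  product topology. The measurability of the events compared later rests on this.\<close>

lemma site_minmax_val_borel:
  shows "(\<lambda>v. minmax_val \<Lambda> (site_potential U \<Phi> T v) n) \<in> borel_measurable borel"
proof (rule borel_measurable_continuous_onI)
  let ?f = "\<lambda>v. minmax_val \<Lambda> (site_potential U \<Phi> T v) n"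
  have lip: "\<bar>?f v - ?f w\<bar> \<le> (\<Sum>s\<in>T. \<bar>v s - w s\<bar> * \<beta> s)" for v w
    using site_minmax_val_shift[OF site_potential_diff_le, of v w] site_minmax_val_shift[OF site_potential_diff_le, of w v]
    by (simp add: abs_le_iff abs_minus_commute)
  show "continuous_on UNIV ?f"
    unfolding continuous_on_def
  proof
    fix w :: "'s \<Rightarrow> real"
    have coord: "((\<lambda>v. v s) \<longlongrightarrow> w s) (at w)" for s
    proof -
      have "continuous_on UNIV (\<lambda>v :: 's \<Rightarrow> real. v s)"
        by (rule continuous_on_product_then_coordinatewise) (rule continuous_on_id)
      then show ?thesis by (simp add: continuous_on_def)
    qed
    have "((\<lambda>v. \<Sum>s\<in>T. \<bar>v s - w s\<bar> * \<beta> s) \<longlongrightarrow> (\<Sum>s\<in>T. \<bar>w s - w s\<bar> * \<beta> s)) (at w)"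
      by (intro tendsto_intros coord)
    then have "((\<lambda>v. \<Sum>s\<in>T. \<bar>v s - w s\<bar> * \<beta> s) \<longlongrightarrow> 0) (at w)" by simp
    then have "((\<lambda>v. ?f v - ?f w) \<longlongrightarrow> 0) (at w)"
      by (rule Lim_null_comparison[rotated]) (use lip in \<open>simp add: always_eventually\<close>)
    then show "(?f \<longlongrightarrow> ?f w) (at w)" by (rule LIM_zero_cancel)
  qed
qed

end

end

text \<open>Stollmann's hypotheses are verified for the difference of the two values:
  \<open>sep\<close> freezes the value on \<open>\<Lambda>'\<close> while the sites in
  \<open>S\<close> move, and \<open>cover\<close> makes the value on \<open>\<Lambda>\<close> follow
  at rate at least 1. Sites outside \<open>S\<close> may act on both domains.\<close>

lemma two_domain_eigenvalue_estimate:
  fixes M :: "'w measure" and V :: "int^'d \<Rightarrow> 'w \<Rightarrow> real" and U :: "'a::euclidean_space \<Rightarrow> real" and \<Phi> :: "int^'d \<Rightarrow> 'a \<Rightarrow> real"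
  assumes P: "prob_space M" and rv: "\<forall>s. V s \<in> borel_measurable M"
    and B: "\<forall>s. AE \<omega> in M. \<bar>V s \<omega>\<bar> \<le> B"
    and U: "U \<in> borel_measurable lebesgue" "AE x in lebesgue. \<bar>U x\<bar> \<le> CU"
    and \<Phi>: "\<And>s x. 0 \<le> \<Phi> s x" "\<And>s x. \<Phi> s x \<le> \<beta> s" "\<And>s. \<Phi> s \<in> borel_measurable borel"
    and \<Lambda>: "compact \<Lambda>" and adm: "minmax_adm \<Lambda> (site_potential U \<Phi> T v0) n \<mu>0" and n: "1 \<le> n"
    and \<Lambda>': "compact \<Lambda>'" and adm': "minmax_adm \<Lambda>' (site_potential U \<Phi> T' v0') m \<mu>0'" and m: "1 \<le> m"
    and S: "finite S" "finite T" "S \<subseteq> T" and cover: "\<And>x. x \<in> \<Lambda> \<Longrightarrow> 1 \<le> (\<Sum>s\<in>S. \<Phi> s x)"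
    and sep: "\<And>s x. s \<in> S \<Longrightarrow> x \<in> \<Lambda>' \<Longrightarrow> \<Phi> s x = 0"
    and \<epsilon>: "0 < \<epsilon>"
    and conc: "\<And>s c b. c \<in> borel_measurable (compl_sigma M V s) \<Longrightarrow> (\<And>\<omega>. \<omega> \<in> space M \<Longrightarrow> \<bar>c \<omega>\<bar> \<le> b) \<Longrightarrow>
       measure M {\<omega> \<in> space M. c \<omega> \<le> V s \<omega> \<and> V s \<omega> \<le> c \<omega> + 2 * \<epsilon>} \<le> r"
  shows "{\<omega> \<in> space M. \<bar>minmax_val \<Lambda> (site_potential U \<Phi> T (\<lambda>s. V s \<omega>)) n
       - minmax_val \<Lambda>' (site_potential U \<Phi> T' (\<lambda>s. V s \<omega>)) m\<bar> \<le> \<epsilon>} \<in> sets M" (is "?E \<in> _")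
    and "measure M {\<omega> \<in> space M. \<bar>minmax_val \<Lambda> (site_potential U \<Phi> T (\<lambda>s. V s \<omega>)) n
       - minmax_val \<Lambda>' (site_potential U \<Phi> T' (\<lambda>s. V s \<omega>)) m\<bar> \<le> \<epsilon>} \<le> real (card S) * r"
proof -
  define f where "f v = minmax_val \<Lambda> (site_potential U \<Phi> T v) n" for v
  define g where "g v = minmax_val \<Lambda>' (site_potential U \<Phi> T' v) m" for v
  have fb: "f \<in> borel_measurable borel"
    unfolding f_def[abs_def] by (rule site_minmax_val_borel[OF U \<Phi> \<Lambda> adm n])
  have gb: "g \<in> borel_measurable borel"
    unfolding g_def[abs_def] by (rule site_minmax_val_borel[OF U \<Phi> \<Lambda>' adm' m])
  have fsh: "f v \<le> f w + t" if "\<And>x. x \<in> \<Lambda> \<Longrightarrow> site_potential U \<Phi> T v x \<le> site_potential U \<Phi> T w x + t" for v w t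
    unfolding f_def by (rule site_minmax_val_shift[OF U \<Phi> \<Lambda> adm n that])
  have gsh: "g v \<le> g w" if off: "\<And>s. s \<notin> S \<Longrightarrow> v s = w s" for v w
  proof -
    have "site_potential U \<Phi> T' v x \<le> site_potential U \<Phi> T' w x + 0" if x: "x \<in> \<Lambda>'" for x
    proof -
      have "v s * \<Phi> s x = w s * \<Phi> s x" for s
        using off[of s] sep[of s x] x by (cases "s \<in> S") auto
      then have "(\<Sum>s\<in>T'. v s * \<Phi> s x) = (\<Sum>s\<in>T'. w s * \<Phi> s x)" by (intro sum.cong refl)
      then show ?thesis by (simp add: site_potential_def)
    qed
    from site_minmax_val_shift[OF U \<Phi> \<Lambda>' adm' m this] show ?thesis by (simp add: g_def)
  qed
  have geq: "g v = g w" if "\<And>s. s \<notin> S \<Longrightarrow> v s = w s" for v w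
    using gsh[of v w] gsh[of w v] that by (intro antisym) auto
  have mono: "f v - g v \<le> f w - g w" if "\<And>s. v s \<le> w s" "\<And>s. s \<notin> S \<Longrightarrow> v s = w s" for v w
  proof -
    have "site_potential U \<Phi> T v x \<le> site_potential U \<Phi> T w x + 0" for x
      using that(1) \<Phi>(1) by (simp add: site_potential_def sum_mono mult_right_mono)
    then show ?thesis using fsh[of v w 0] geq[of v w] that(2) by simp
  qed
  have diag: "f (\<lambda>s. v s - t * indicator S s) - g (\<lambda>s. v s - t * indicator S s) \<le> f v - g v - t"
    if t: "0 \<le> t" for v t
  proof -
    have "site_potential U \<Phi> T (\<lambda>s. v s - t * indicator S s) x \<le> site_potential U \<Phi> T v x + - t" if x: "x \<in> \<Lambda>" for x
    proof -
      have "(\<Sum>s\<in>T. (v s - t * indicator S s) * \<Phi> s x) = (\<Sum>s\<in>T. v s * \<Phi> s x) - t * (\<Sum>s\<in>T. indicator S s * \<Phi> s x)"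
        by (simp add: left_diff_distrib sum_subtractf sum_distrib_left mult.assoc)
      moreover have "(\<Sum>s\<in>T. indicator S s * \<Phi> s x) = (\<Sum>s\<in>S. \<Phi> s x)"
      proof -
        have "(\<Sum>s\<in>S. \<Phi> s x) = (\<Sum>s\<in>S. indicator S s * \<Phi> s x)" by simp
        also have "\<dots> = (\<Sum>s\<in>T. indicator S s * \<Phi> s x)"
          by (rule sum.mono_neutral_left) (use S in auto)
        finally show ?thesis ..
      qed
      moreover have "t * 1 \<le> t * (\<Sum>s\<in>S. \<Phi> s x)" using cover[OF x] t by (rule mult_left_mono)
      ultimately show ?thesis by (simp add: site_potential_def)
    qed
    from fsh[OF this] geq[of "\<lambda>s. v s - t * indicator S s" v] show ?thesis by (simp add: indicator_def)
  qed
  have h: "(\<lambda>v. f v - g v) \<in> borel_measurable borel" using fb gb by measurable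
  have BS: "\<forall>s\<in>S. AE \<omega> in M. \<bar>V s \<omega>\<bar> \<le> B" using B by blast
  have conc': "measure M {\<omega> \<in> space M. c \<omega> \<le> V s \<omega> \<and> V s \<omega> \<le> c \<omega> + 2 * \<epsilon>} \<le> r"
    if "s \<in> S" "c \<in> borel_measurable (compl_sigma M V s)" "\<And>\<omega>. \<omega> \<in> space M \<Longrightarrow> \<bar>c \<omega>\<bar> \<le> b" for s c b
    using that(2,3) by (rule conc)
  have "{\<omega> \<in> space M. \<bar>f (\<lambda>s. V s \<omega>) - g (\<lambda>s. V s \<omega>)\<bar> \<le> \<epsilon>} \<in> sets M"
    by (rule Stollmann_estimate(1)[OF P rv BS S(1) h _ _ \<epsilon>, where r = r]) (fact mono diag conc')+
  then show "?E \<in> sets M" unfolding f_def g_def .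
  have "measure M {\<omega> \<in> space M. \<bar>f (\<lambda>s. V s \<omega>) - g (\<lambda>s. V s \<omega>)\<bar> \<le> \<epsilon>} \<le> real (card S) * r"
    by (rule Stollmann_estimate(2)[OF P rv BS S(1) h _ _ \<epsilon>]) (fact mono diag conc')+
  then show "measure M ?E \<le> real (card S) * r" unfolding f_def g_def .
qed

section \<open>Pairs of boxes\<close>

definition pair_potential :: "(int^'d \<Rightarrow> real^'d \<Rightarrow> real) \<Rightarrow> int^'d \<Rightarrow> (real^'d) \<times> (real^'d) \<Rightarrow> real" where
  "pair_potential \<phi> s x = \<phi> s (fst x - lattice_pt s) + \<phi> s (snd x - lattice_pt s)"

text \<open>By the range condition no other site acts on either particle in the box. The union gives
  both particles one common index set.\<close>

definition box_sites :: "real \<Rightarrow> real \<Rightarrow> real \<Rightarrow> (real^'d) \<times> (real^'d) \<Rightarrow> (int^'d) set" where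
  "box_sites R L1 L2 u = {s. lattice_pt s \<in> cube (L1 + R) (fst u)} \<union> {s. lattice_pt s \<in> cube (L2 + R) (snd u)}"

lemma finite_box_sites:
  assumes "0 \<le> L1 + R" "0 \<le> L2 + R"
  shows "finite (box_sites R L1 L2 u)"
  unfolding box_sites_def by (intro finite_UnI lattice_points_cube(1) assms)

lemma cube_mono:
  assumes "L \<le> L'"
  shows "cube L u \<subseteq> cube L' u"
proof
  fix x assume x: "x \<in> cube L u"
  show "x \<in> cube L' u"
    unfolding cube_def
  proof (intro CollectI allI)
    fix i
    have "u $ i - L \<le> x $ i \<and> x $ i \<le> u $ i + L" using x by (simp add: cube_def)
    then show "u $ i - L' \<le> x $ i \<and> x $ i \<le> u $ i + L'" using assms by linarith
  qed
qed

lemma short_range_vanish: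
  assumes range: "\<forall>s y. R < maxnorm y \<longrightarrow> \<phi> s y = 0" and x: "x \<in> cube L v" and s: "lattice_pt s \<notin> cube (L + R) v"
  shows "\<phi> s (x - lattice_pt s) = 0"
proof -
  obtain i where "\<not> (v $ i - (L + R) \<le> lattice_pt s $ i \<and> lattice_pt s $ i \<le> v $ i + (L + R))"
    using s by (auto simp: cube_def)
  moreover have "v $ i - L \<le> x $ i" "x $ i \<le> v $ i + L" using x by (auto simp: cube_def)
  ultimately have "R < \<bar>(x - lattice_pt s) $ i\<bar>" by (simp add: abs_if) linarith
  also have "\<dots> \<le> maxnorm (x - lattice_pt s)" by (rule maxnorm_ge)
  finally show ?thesis using range by blast
qed

lemma two_pot_box2:
  assumes range: "\<forall>s y. R < maxnorm y \<longrightarrow> \<phi> s y = 0" and R: "0 < R" "0 \<le> L1" "0 \<le> L2" and x: "x \<in> box2 L1 L2 u"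
  shows "U x + two_pot V \<phi> x \<omega> = site_potential U (pair_potential \<phi>) (box_sites R L1 L2 u) (\<lambda>s. V s \<omega>) x"
proof -
  let ?T = "box_sites R L1 L2 u"
  have fin: "finite ?T" using R by (intro finite_box_sites) auto
  have 1: "single_pot V \<phi> y \<omega> = (\<Sum>s\<in>?T. V s \<omega> * \<phi> s (y - lattice_pt s))"
    if "\<And>s. s \<notin> ?T \<Longrightarrow> \<phi> s (y - lattice_pt s) = 0" for y
  proof -
    have "single_pot V \<phi> y \<omega> = (\<Sum>\<^sub>\<infinity>s\<in>?T. V s \<omega> * \<phi> s (y - lattice_pt s))"
      unfolding single_pot_def by (rule infsum_cong_neutral) (use that in auto)
    then show ?thesis using fin by simp
  qed
  have x': "fst x \<in> cube L1 (fst u)" "snd x \<in> cube L2 (snd u)" using x by (auto simp: box2_def)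
  have f: "single_pot V \<phi> (fst x) \<omega> = (\<Sum>s\<in>?T. V s \<omega> * \<phi> s (fst x - lattice_pt s))"
    using short_range_vanish[OF range x'(1)] by (intro 1) (auto simp: box_sites_def)
  have s: "single_pot V \<phi> (snd x) \<omega> = (\<Sum>s\<in>?T. V s \<omega> * \<phi> s (snd x - lattice_pt s))"
    using short_range_vanish[OF range x'(2)] by (intro 1) (auto simp: box_sites_def)
  show ?thesis
    unfolding two_pot_def f s site_potential_def pair_potential_def
    by (simp add: distrib_left sum.distrib)
qed

text \<open>\<open>infsum\<close> is 0 for families that are not summable, so summability has to
  come first. The finite range provides it: only sites within \<open>R\<close> of \<open>y\<close>
  contribute.\<close>

lemma sum_le_infsum_short_range:
  fixes \<phi> :: "int^'d \<Rightarrow> real^'d \<Rightarrow> real"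
  assumes range: "\<forall>s y. R < maxnorm y \<longrightarrow> \<phi> s y = 0" and R: "0 < R" and pos: "\<forall>s x. 0 \<le> \<phi> s x" and T: "finite T"
  shows "(\<Sum>s\<in>T. \<phi> s (y - lattice_pt s)) \<le> (\<Sum>\<^sub>\<infinity>s. \<phi> s (y - lattice_pt s))"
proof -
  let ?F = "{s. lattice_pt s \<in> cube (0 + R) y}"
  have F: "finite ?F" using R by (intro lattice_points_cube(1)) simp
  have "y \<in> cube 0 y" by (simp add: cube_def)
  then have zero: "\<phi> s (y - lattice_pt s) = 0" if "s \<notin> ?F" for s
    using short_range_vanish[OF range, of y 0 y s] that by simp
  have "(\<lambda>s. \<phi> s (y - lattice_pt s)) summable_on UNIV \<longleftrightarrow> (\<lambda>s. \<phi> s (y - lattice_pt s)) summable_on ?F"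
    by (rule summable_on_cong_neutral) (use zero in auto)
  then have "(\<lambda>s. \<phi> s (y - lattice_pt s)) summable_on UNIV" using F by simp
  then show ?thesis by (rule finite_sum_le_infsum) (use T pos in auto)
qed

text \<open>Finiteness turns the infimum into a minimum, so the pair is within
  \<open>\<epsilon>\<close> itself and not merely within every larger distance. If one set is empty,
  the distance is infinite and the hypothesis fails.\<close>

lemma spdist_finite_attained:
  assumes "spdist A B \<le> ereal \<epsilon>" "finite A" "finite B"
  obtains a b where "a \<in> A" "b \<in> B" "\<bar>a - b\<bar> \<le> \<epsilon>"
proof -
  have ne: "A \<times> B \<noteq> {}"
  proof
    assume "A \<times> B = {}"
    then have "spdist A B = \<infinity>" by (simp only: spdist_def image_empty Inf_empty top_ereal_def)
    then show False using assms(1) by simp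
  qed
  let ?F = "(\<lambda>p. ereal \<bar>fst p - snd p\<bar>) ` (A \<times> B)"
  have "finite ?F" "?F \<noteq> {}" using assms(2,3) ne by auto
  then have "Inf ?F \<in> ?F" using Min_in[of ?F] Min_Inf[of ?F] by simp
  then obtain p where "p \<in> A \<times> B" "spdist A B = ereal \<bar>fst p - snd p\<bar>" unfolding spdist_def by auto
  then show thesis using assms(1) that[of "fst p" "snd p"] by auto
qed

section \<open>Assembly over all pairs of min-max values\<close>

theorem theorem2:
  fixes M :: "'w measure"
    and V :: "int^'d \<Rightarrow> 'w \<Rightarrow> real"
    and \<phi> :: "int^'d \<Rightarrow> real^'d \<Rightarrow> real"
    and U :: "(real^'d) \<times> (real^'d) \<Rightarrow> real"
    and R :: real
  assumes P: "prob_space M"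
    and rv: "\<forall>s. V s \<in> borel_measurable M"
    and D: "U \<in> borel_measurable lebesgue" "\<exists>C. AE x in lebesgue. \<bar>U x\<bar> \<le> C"
    and E0: "\<exists>C. \<forall>s. AE \<omega> in M. \<bar>V s \<omega>\<bar> \<le> C"
    and E1: "\<forall>s x. 0 \<le> \<phi> s x" "\<forall>s. bounded (range (\<phi> s))"
            "\<exists>C. \<forall>x. (\<Sum>\<^sub>\<infinity>s. \<phi> s (x - lattice_pt s)) \<le> C"
            "\<forall>s. \<phi> s \<in> borel_measurable borel"
    and E2: "\<forall>L u x. L \<ge> 1 \<longrightarrow> x \<in> cube L u \<longrightarrow>
               (\<Sum>s\<in>{s. lattice_pt s \<in> cube L u}. \<phi> s (x - lattice_pt s)) \<ge> 1"
    and E3: "\<exists>p K. \<forall>s. (\<forall>y \<omega>. 0 \<le> p s y \<omega>) \<and> (\<forall>y. AE \<omega> in M. p s y \<omega> \<le> K) \<and>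
               (\<forall>\<omega>. integrable lborel (\<lambda>t. p s t \<omega>)) \<and>
               (\<forall>y. AE \<omega> in M. cond_cdf M V s y \<omega> = (\<integral>t. indicator {..<y} t * p s t \<omega> \<partial>lborel))"
    and E4: "0 < R" "\<forall>s y. maxnorm y > R \<longrightarrow> \<phi> s y = 0"
  shows "\<forall>a b. a \<le> b \<longrightarrow> (\<exists>C>0. \<forall>L1 L2 u L1' L2' u' \<epsilon>.
           L1 > 1 \<and> L2 > 1 \<and> L1' > 1 \<and> L2' > 1 \<and> suff_distant R L1 L2 u L1' L2' u' \<and>
           0 < \<epsilon> \<and> \<epsilon> < 1 \<longrightarrow>
           enn2ereal (outer_prob M {\<omega> \<in> space M.
              spdist (spec (box2 L1 L2 u) (\<lambda>x. U x + two_pot V \<phi> x \<omega>) \<inter> {a..b})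
                     (spec (box2 L1' L2' u') (\<lambda>x. U x + two_pot V \<phi> x \<omega>) \<inter> {a..b}) \<le> ereal \<epsilon>})
           \<le> ereal (C * measure lborel (box2 L1 L2 u) * measure lborel (box2 L1' L2' u')
                    * Max {measure lborel (cube L1 (fst u)), measure lborel (cube L1' (fst u')),
                           measure lborel (cube L2 (snd u)), measure lborel (cube L2' (snd u'))})
             * nu M V (2 * \<epsilon>))"
proof (intro allI impI)
  fix a b :: real
  assume "a \<le> b"
  interpret prob_space M by (rule P)
  obtain CU where CU: "AE x in lebesgue. \<bar>U x\<bar> \<le> CU" using D(2) by blast
  obtain CV where CV: "\<forall>s. AE \<omega> in M. \<bar>V s \<omega>\<bar> \<le> CV" using E0 by blast
  obtain C\<phi> where C\<phi>: "\<And>x. (\<Sum>\<^sub>\<infinity>s. \<phi> s (x - lattice_pt s)) \<le> C\<phi>" using E1(3) by blast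
  let ?\<Phi> = "pair_potential \<phi>"
  have "\<exists>B. \<forall>x. \<phi> s x \<le> B" for s
  proof -
    obtain B where "\<And>x. norm (\<phi> s x) \<le> B" using E1(2) unfolding bounded_iff by blast
    then show ?thesis by (intro exI[of _ B]) (simp add: abs_le_iff)
  qed
  then obtain \<beta>0 where \<beta>0: "\<And>s x. \<phi> s x \<le> \<beta>0 s" by metis
  have \<Phi>0: "0 \<le> ?\<Phi> s x" for s x using E1(1) by (simp add: pair_potential_def)
  have \<Phi>b: "?\<Phi> s x \<le> 2 * \<beta>0 s" for s x
    using add_mono[OF \<beta>0[of s "fst x - lattice_pt s"] \<beta>0[of s "snd x - lattice_pt s"]] by (simp add: pair_potential_def)
  have \<Phi>m: "?\<Phi> s \<in> borel_measurable borel" for s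
  proof -
    have [measurable]: "\<phi> s \<in> borel_measurable borel" using E1(4) by blast
    show ?thesis unfolding pair_potential_def[abs_def] borel_prod[symmetric] by measurable
  qed
  \<comment> \<open>A lower bound \<open>- B\<close> for the full potential, uniform in the box: the
    background contributes at most \<open>CU\<close>, and each of the two particles at most
    \<open>\<bar>CV\<bar> * C\<phi>\<close>.\<close>
  define B where "B = CU + \<bar>CV\<bar> * (2 * C\<phi>)"
  obtain C1 where C1: "0 < C1" and count: "\<And>L1 L2 (u :: (real^'d) \<times> (real^'d)) W n \<mu>. 1 \<le> L1 \<Longrightarrow> 1 \<le> L2 \<Longrightarrow>
    bdd_potential (box2 L1 L2 u) W \<Longrightarrow> AE x in lebesgue_on (box2 L1 L2 u). - B \<le> W x \<Longrightarrow>
    minmax_adm (box2 L1 L2 u) W n \<mu> \<Longrightarrow> \<mu> \<le> b \<Longrightarrow> real n \<le> C1 * measure lborel (box2 L1 L2 u)"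
    using eigenvalue_count_box2[of B b, where 'd = 'd] by blast
  have cpt: "compact (box2 L1 L2 u)" for L1 L2 and u :: "(real^'d) \<times> (real^'d)"
    unfolding box2_eq_cbox by simp
  let ?W = "\<lambda>L1 L2 u v. site_potential U ?\<Phi> (box_sites R L1 L2 u) v"
  let ?val = "\<lambda>L1 L2 u n v. minmax_val (box2 L1 L2 u) (?W L1 L2 u v) n"
  have bddW: "bdd_potential (box2 L1 L2 u) (?W L1 L2 u v)" for L1 L2 u v
    by (rule bdd_potential_site[OF D(1) CU \<Phi>0 \<Phi>b \<Phi>m cpt])
  have lower: "AE x in lebesgue_on (box2 L1 L2 u). - B \<le> ?W L1 L2 u (\<lambda>s. V s \<omega>) x"
    if L: "1 < L1" "1 < L2" and good: "\<forall>s. \<bar>V s \<omega>\<bar> \<le> CV" for L1 L2 u \<omega>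
  proof -
    have fin: "finite (box_sites R L1 L2 u)" using L E4(1) by (intro finite_box_sites) auto
    have "AE x in lebesgue. - B \<le> ?W L1 L2 u (\<lambda>s. V s \<omega>) x"
      using CU
    proof eventually_elim
      case (elim x)
      let ?T = "box_sites R L1 L2 u"
      have "(\<Sum>s\<in>?T. ?\<Phi> s x) \<le> 2 * C\<phi>"
        using order_trans[OF sum_le_infsum_short_range[OF E4(2,1) E1(1) fin, of "fst x"] C\<phi>]
          order_trans[OF sum_le_infsum_short_range[OF E4(2,1) E1(1) fin, of "snd x"] C\<phi>]
        by (simp add: pair_potential_def sum.distrib)
      then have "\<bar>CV\<bar> * (\<Sum>s\<in>?T. ?\<Phi> s x) \<le> \<bar>CV\<bar> * (2 * C\<phi>)" by (intro mult_left_mono) auto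
      moreover have "(\<Sum>s\<in>?T. - (\<bar>CV\<bar> * ?\<Phi> s x)) \<le> (\<Sum>s\<in>?T. V s \<omega> * ?\<Phi> s x)"
      proof (rule sum_mono)
        fix s
        have "- \<bar>CV\<bar> \<le> V s \<omega>" using good[rule_format, of s] by linarith
        then have "- \<bar>CV\<bar> * ?\<Phi> s x \<le> V s \<omega> * ?\<Phi> s x" using \<Phi>0 by (rule mult_right_mono)
        then show "- (\<bar>CV\<bar> * ?\<Phi> s x) \<le> V s \<omega> * ?\<Phi> s x" by simp
      qed
      ultimately show ?case
        using elim unfolding site_potential_def B_def by (simp add: sum_negf sum_distrib_left)
    qed
    then show ?thesis
      using cpt[of L1 L2 u] by (subst AE_restrict_space_iff) (auto simp: compact_imp_closed elim: eventually_mono)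
  qed
  have eigen: "\<exists>n. 1 \<le> n \<and> real n \<le> C1 * measure lborel (box2 L1 L2 u)
      \<and> minmax_adm (box2 L1 L2 u) (?W L1 L2 u (\<lambda>s. V s \<omega>)) n E \<and> E = ?val L1 L2 u n (\<lambda>s. V s \<omega>)"
    if L: "1 < L1" "1 < L2" and good: "\<forall>s. \<bar>V s \<omega>\<bar> \<le> CV"
      and E: "E \<in> spec (box2 L1 L2 u) (\<lambda>x. U x + two_pot V \<phi> x \<omega>)" "E \<le> b" for L1 L2 u \<omega> E
  proof -
    have "dirichlet_eigenvalue (box2 L1 L2 u) (?W L1 L2 u (\<lambda>s. V s \<omega>)) E"
      using E(1) two_pot_box2[OF E4(2,1), of L1 L2 _ u U V \<omega>] L
      by (subst dirichlet_eigenvalue_cong[where W' = "\<lambda>x. U x + two_pot V \<phi> x \<omega>"]) (auto simp: spec_def)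
    note ev = this
    have N: "n \<le> nat \<lfloor>C1 * measure lborel (box2 L1 L2 u)\<rfloor>"
      if "minmax_adm (box2 L1 L2 u) (?W L1 L2 u (\<lambda>s. V s \<omega>)) n \<mu>" "\<mu> \<le> E" for n \<mu>
    proof -
      have "real n \<le> C1 * measure lborel (box2 L1 L2 u)"
        using count[OF _ _ bddW lower[OF L good] that(1)] L that(2) E(2) by simp
      then show ?thesis by (simp add: le_nat_floor)
    qed
    obtain n where n: "1 \<le> n" "n \<le> nat \<lfloor>C1 * measure lborel (box2 L1 L2 u)\<rfloor>"
      "minmax_adm (box2 L1 L2 u) (?W L1 L2 u (\<lambda>s. V s \<omega>)) n E" "E = ?val L1 L2 u n (\<lambda>s. V s \<omega>)"
      by (rule eigenvalue_eq_minmax_val[OF cpt bddW ev N])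
    have "real n \<le> real (nat \<lfloor>C1 * measure lborel (box2 L1 L2 u)\<rfloor>)" using n(2) by simp
    also have "\<dots> \<le> C1 * measure lborel (box2 L1 L2 u)" using C1 by (simp add: of_nat_floor)
    finally show ?thesis using n by blast
  qed
  define C where "C = C1 * C1 * 2 ^ CARD('d)"
  show "\<exists>C>0. \<forall>L1 L2 u L1' L2' u' \<epsilon>.
           L1 > 1 \<and> L2 > 1 \<and> L1' > 1 \<and> L2' > 1 \<and> suff_distant R L1 L2 u L1' L2' u' \<and>
           0 < \<epsilon> \<and> \<epsilon> < 1 \<longrightarrow>
           enn2ereal (outer_prob M {\<omega> \<in> space M.
              spdist (spec (box2 L1 L2 u) (\<lambda>x. U x + two_pot V \<phi> x \<omega>) \<inter> {a..b})
                     (spec (box2 L1' L2' u') (\<lambda>x. U x + two_pot V \<phi> x \<omega>) \<inter> {a..b}) \<le> ereal \<epsilon>})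
           \<le> ereal (C * measure lborel (box2 L1 L2 u) * measure lborel (box2 L1' L2' u')
                    * Max {measure lborel (cube L1 (fst u)), measure lborel (cube L1' (fst u')),
                           measure lborel (cube L2 (snd u)), measure lborel (cube L2' (snd u'))})
             * nu M V (2 * \<epsilon>)"
  proof (intro exI[of _ C] conjI allI impI)
    show "0 < C" using C1 by (simp add: C_def)
    fix L1 L2 L1' L2' \<epsilon> :: real and u u' :: "(real^'d) \<times> (real^'d)"
    assume as: "L1 > 1 \<and> L2 > 1 \<and> L1' > 1 \<and> L2' > 1 \<and> suff_distant R L1 L2 u L1' L2' u' \<and> 0 < \<epsilon> \<and> \<epsilon> < (1::real)"
    then have L: "L1 > 1" "L2 > 1" "L1' > 1" "L2' > 1" and sd: "suff_distant R L1 L2 u L1' L2' u'" and \<epsilon>: "0 < \<epsilon>"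
      by auto
    define X where "X = {\<omega> \<in> space M.
              spdist (spec (box2 L1 L2 u) (\<lambda>x. U x + two_pot V \<phi> x \<omega>) \<inter> {a..b})
                     (spec (box2 L1' L2' u') (\<lambda>x. U x + two_pot V \<phi> x \<omega>) \<inter> {a..b}) \<le> ereal \<epsilon>}"
    define mx where "mx = Max {measure lborel (cube L1 (fst u)), measure lborel (cube L1' (fst u')),
                           measure lborel (cube L2 (snd u)), measure lborel (cube L2' (snd u'))}"
    define m1 where "m1 = measure lborel (box2 L1 L2 u)"
    define m2 where "m2 = measure lborel (box2 L1' L2' u')"
    have mx: "measure lborel (cube L1 (fst u)) \<le> mx" "measure lborel (cube L1' (fst u')) \<le> mx"
      "measure lborel (cube L2 (snd u)) \<le> mx" "measure lborel (cube L2' (snd u')) \<le> mx"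
      unfolding mx_def by (auto intro: Max_ge)
    have cubepos: "0 < measure lborel (cube l v)" if "1 < l" for l and v :: "real^'d"
      using that by (simp add: measure_cube)
    have mxpos: "0 < mx" using mx(1) cubepos[OF L(1), of "fst u"] by linarith
    have m1pos: "0 < m1" "0 < m2"
      unfolding m1_def m2_def measure_box2 using cubepos L by auto
    have Cpos: "0 < C * m1 * m2 * mx" using \<open>0 < C\<close> m1pos mxpos by simp
    have diff_le: "AE \<omega> in M. ereal (cond_cdf M V s (y + 2 * \<epsilon>) \<omega> - cond_cdf M V s y \<omega>) \<le> nu M V (2 * \<epsilon>)" for s y
    proof -
      have le: "esssup M (\<lambda>\<omega>. ereal (cond_cdf M V s (y + 2 * \<epsilon>) \<omega> - cond_cdf M V s y \<omega>)) \<le> nu M V (2 * \<epsilon>)"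
        unfolding nu_def by (rule order_trans[OF SUP_upper[of y] SUP_upper[of s]]) auto
      show ?thesis
        using esssup_AE[of "\<lambda>\<omega>. ereal (cond_cdf M V s (y + 2 * \<epsilon>) \<omega> - cond_cdf M V s y \<omega>)" M]
        by eventually_elim (rule order_trans[OF _ le])
    qed
    \<comment> \<open>\<open>nu\<close> takes extended real values. Infinity is harmless because its
      factor is positive by \<open>Cpos\<close>, minus infinity contradicts \<open>diff_le\<close>,
      and a real value \<open>r\<close> remains.\<close>
    have "enn2ereal (outer_prob M X) \<le> ereal (C * m1 * m2 * mx) * nu M V (2 * \<epsilon>)"
    proof (cases "nu M V (2 * \<epsilon>)")
      case PInf
      have "ereal z * \<infinity> = \<infinity>" if "0 < z" for z using that by simp
      from this[OF Cpos] show ?thesis unfolding PInf by (simp only: ereal_less_eq(1))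
    next
      case MInf
      from diff_le[of 0 0] have "AE \<omega> in M. False" by eventually_elim (simp add: MInf)
      then show ?thesis by simp
    next
      case (real r)
      have diff_r: "AE \<omega> in M. cond_cdf M V s (y + 2 * \<epsilon>) \<omega> - cond_cdf M V s y \<omega> \<le> r" for s y
        using diff_le[of s y] by eventually_elim (simp add: real)
      have "AE \<omega> in M. 0 \<le> r"
      proof -
        have "AE \<omega> in M. 0 \<le> cond_cdf M V 0 (0 + 2 * \<epsilon>) \<omega> - cond_cdf M V 0 0 \<omega>
            \<and> cond_cdf M V 0 (0 + 2 * \<epsilon>) \<omega> - cond_cdf M V 0 0 \<omega> \<le> 1"
          using \<epsilon> by (intro cond_cdf_mono[OF P rv]) simp
        with diff_r[of 0 0] show ?thesis by eventually_elim linarith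
      qed
      then have r0: "0 \<le> r" by simp
      have conc: "prob {\<omega> \<in> space M. c \<omega> \<le> V s \<omega> \<and> V s \<omega> \<le> c \<omega> + 2 * \<epsilon>} \<le> r"
        if c: "c \<in> borel_measurable (compl_sigma M V s)" and cb: "\<And>\<omega>. \<omega> \<in> space M \<Longrightarrow> \<bar>c \<omega>\<bar> \<le> k" for s c k
      proof -
        obtain p where p: "\<forall>\<omega>. integrable lborel (\<lambda>t. p s t \<omega>)"
          "\<forall>y. AE \<omega> in M. cond_cdf M V s y \<omega> = (\<integral>t. indicator {..<y} t * p s t \<omega> \<partial>lborel)"
          using E3 by blast
        show ?thesis
        proof (rule prob_random_interval[OF P rv c cb _ _ _ diff_r])
          show "isCont (\<lambda>y. \<integral>t. indicator {..<y} t * p s t \<omega> \<partial>lborel) y" for \<omega> y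
            using p(1) by (intro isCont_integral_lessThan) blast
          show "AE \<omega> in M. cond_cdf M V s y \<omega> = (\<integral>t. indicator {..<y} t * p s t \<omega> \<partial>lborel)" for y
            using p(2) by blast
        qed (use \<epsilon> in auto)
      qed
      define ev where "ev n m = {\<omega> \<in> space M. \<bar>?val L1 L2 u n (\<lambda>s. V s \<omega>) - ?val L1' L2' u' m (\<lambda>s. V s \<omega>)\<bar> \<le> \<epsilon>}" for n m
      \<comment> \<open>The index set does not depend on \<open>\<omega>\<close>: it asks for
        admissibility under some assignment \<open>v\<close>, which carries over to every
        assignment. The union bound can thus run over a fixed finite set.\<close>
      let ?I = "\<lambda>L1 L2 u. {n. 1 \<le> n \<and> real n \<le> C1 * measure lborel (box2 L1 L2 u) \<and> (\<exists>v \<mu>. minmax_adm (box2 L1 L2 u) (?W L1 L2 u v) n \<mu>)}"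
      have card_I: "finite (?I l1 l2 w)" "real (card (?I l1 l2 w)) \<le> C1 * measure lborel (box2 l1 l2 w)" for l1 l2 w
      proof -
        let ?k = "nat \<lfloor>C1 * measure lborel (box2 l1 l2 w)\<rfloor>"
        have sub: "?I l1 l2 w \<subseteq> {1..?k}" by (auto simp: le_nat_floor)
        then show "finite (?I l1 l2 w)" by (rule finite_subset) simp
        have "card (?I l1 l2 w) \<le> ?k" using card_mono[OF _ sub] by simp
        then have "real (card (?I l1 l2 w)) \<le> real ?k" by simp
        also have "\<dots> \<le> C1 * measure lborel (box2 l1 l2 w)" using C1 by (simp add: of_nat_floor)
        finally show "real (card (?I l1 l2 w)) \<le> C1 * measure lborel (box2 l1 l2 w)" .
      qed
      \<comment> \<open>Stated for an arbitrary ordered pair of boxes, with \<open>cube l z\<close>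
        the projection that is far from the other box, so that all four cases of separation are
        instances.\<close>
      have est: "{\<omega> \<in> space M. \<bar>?val l1 l2 w n (\<lambda>s. V s \<omega>) - ?val l1' l2' w' m (\<lambda>s. V s \<omega>)\<bar> \<le> \<epsilon>} \<in> events
          \<and> prob {\<omega> \<in> space M. \<bar>?val l1 l2 w n (\<lambda>s. V s \<omega>) - ?val l1' l2' w' m (\<lambda>s. V s \<omega>)\<bar> \<le> \<epsilon>} \<le> 2 ^ CARD('d) * mx * r"
        if n: "n \<in> ?I l1 l2 w" and m: "m \<in> ?I l1' l2' w'" and l: "1 < l1" "1 < l2" "1 < l" and lmx: "measure lborel (cube l z) \<le> mx"
          and sites: "{s. lattice_pt s \<in> cube l z} \<subseteq> box_sites R l1 l2 w"
          and proj: "(\<forall>x\<in>box2 l1 l2 w. fst x \<in> cube l z) \<or> (\<forall>x\<in>box2 l1 l2 w. snd x \<in> cube l z)"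
          and far: "l + l1' + R < maxnorm (z - fst w')" "l + l2' + R < maxnorm (z - snd w')"
        for n m l1 l2 l1' l2' w w' l z
      proof -
        let ?S = "{s. lattice_pt s \<in> cube l z}"
        from n obtain v0 \<mu>0 where ad: "minmax_adm (box2 l1 l2 w) (?W l1 l2 w v0) n \<mu>0" "1 \<le> n"
          unfolding mem_Collect_eq by (elim conjE exE)
        from m obtain v0' \<mu>0' where ad': "minmax_adm (box2 l1' l2' w') (?W l1' l2' w' v0') m \<mu>0'" "1 \<le> m"
          unfolding mem_Collect_eq by (elim conjE exE)
        have fS: "finite ?S" using l by (intro lattice_points_cube(1)) simp
        have fT: "finite (box_sites R l1 l2 w)" using l E4(1) by (intro finite_box_sites) auto
        have cover: "1 \<le> (\<Sum>s\<in>?S. ?\<Phi> s x)" if x: "x \<in> box2 l1 l2 w" for x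
        proof -
          have E2': "1 \<le> (\<Sum>s\<in>?S. \<phi> s (y - lattice_pt s))" if "y \<in> cube l z" for y
            using E2[rule_format, of l y z] that l by simp
          have "(\<Sum>s\<in>?S. ?\<Phi> s x) = (\<Sum>s\<in>?S. \<phi> s (fst x - lattice_pt s)) + (\<Sum>s\<in>?S. \<phi> s (snd x - lattice_pt s))"
            by (simp add: pair_potential_def sum.distrib)
          moreover have "0 \<le> (\<Sum>s\<in>?S. \<phi> s (fst x - lattice_pt s))" "0 \<le> (\<Sum>s\<in>?S. \<phi> s (snd x - lattice_pt s))"
            using E1(1) by (auto intro!: sum_nonneg)
          \<comment> \<open>E2 applies to the particle whose projection is the distinguished cube;
            the other particle adds a nonnegative amount.\<close>
          moreover have "1 \<le> (\<Sum>s\<in>?S. \<phi> s (fst x - lattice_pt s)) \<or> 1 \<le> (\<Sum>s\<in>?S. \<phi> s (snd x - lattice_pt s))"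
          proof (rule disj_forward[OF proj])
            assume "\<forall>x\<in>box2 l1 l2 w. fst x \<in> cube l z"
            then show "1 \<le> (\<Sum>s\<in>?S. \<phi> s (fst x - lattice_pt s))" using x by (intro E2') simp
          next
            assume "\<forall>x\<in>box2 l1 l2 w. snd x \<in> cube l z"
            then show "1 \<le> (\<Sum>s\<in>?S. \<phi> s (snd x - lattice_pt s))" using x by (intro E2') simp
          qed
          ultimately show ?thesis by linarith
        qed
        have sep: "?\<Phi> s x = 0" if s: "s \<in> ?S" and x: "x \<in> box2 l1' l2' w'" for s x
        proof -
          have s': "lattice_pt s \<in> cube l z" using s by simp
          have x': "fst x \<in> cube l1' (fst w')" "snd x \<in> cube l2' (snd w')" using x by (auto simp: box2_def)
          have "\<phi> s (fst x - lattice_pt s) = 0"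
            using E4(2) separated_cubes[OF far(1) s' x'(1)] by blast
          moreover have "\<phi> s (snd x - lattice_pt s) = 0"
            using E4(2) separated_cubes[OF far(2) s' x'(2)] by blast
          ultimately show ?thesis by (simp add: pair_potential_def)
        qed
        note tde = two_domain_eigenvalue_estimate[OF P rv CV D(1) CU \<Phi>0 \<Phi>b \<Phi>m cpt ad cpt ad' fS fT sites _ _ \<epsilon>]
        have le: "real (card ?S) * r \<le> 2 ^ CARD('d) * mx * r"
        proof (rule mult_right_mono[OF _ r0])
          have "real (card ?S) \<le> 2 ^ CARD('d) * measure lborel (cube l z)"
            using l by (intro card_lattice_points_le_volume) simp
          also have "\<dots> \<le> 2 ^ CARD('d) * mx" using lmx by (intro mult_left_mono) auto
          finally show "real (card ?S) \<le> 2 ^ CARD('d) * mx" .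
        qed
        have ev_prob: "prob {\<omega> \<in> space M. \<bar>?val l1 l2 w n (\<lambda>s. V s \<omega>) - ?val l1' l2' w' m (\<lambda>s. V s \<omega>)\<bar> \<le> \<epsilon>} \<le> real (card ?S) * r"
          by (rule tde(2)) (fact cover sep conc)+
        have ev_sets: "{\<omega> \<in> space M. \<bar>?val l1 l2 w n (\<lambda>s. V s \<omega>) - ?val l1' l2' w' m (\<lambda>s. V s \<omega>)\<bar> \<le> \<epsilon>} \<in> events"
          by (rule tde(1)[where r = r]) (fact cover sep conc)+
        show ?thesis by (rule conjI[OF ev_sets order_trans[OF ev_prob le]])
      qed
      have sites1: "{s. lattice_pt s \<in> cube l1 (fst w)} \<subseteq> box_sites R l1 l2 w"
        and sites2: "{s. lattice_pt s \<in> cube l2 (snd w)} \<subseteq> box_sites R l1 l2 w" for l1 l2 and w :: "(real^'d) \<times> (real^'d)"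
        using cube_mono[of l1 "l1 + R" "fst w"] cube_mono[of l2 "l2 + R" "snd w"] E4(1)
        by (auto simp: box_sites_def)
      have proj1: "\<forall>x\<in>box2 l1 l2 w. fst x \<in> cube l1 (fst w)" and proj2: "\<forall>x\<in>box2 l1 l2 w. snd x \<in> cube l2 (snd w)"
        for l1 l2 and w :: "(real^'d) \<times> (real^'d)"
        by (auto simp: box2_def)
      have ev_est: "ev n m \<in> events \<and> prob (ev n m) \<le> 2 ^ CARD('d) * mx * r"
        if nm: "n \<in> ?I L1 L2 u" "m \<in> ?I L1' L2' u'" for n m
      proof -
        \<comment> \<open>In the last two cases the distinguished projection belongs to the second
          box, and the boxes exchange their roles.\<close>
        have sym: "ev n m = {\<omega> \<in> space M. \<bar>?val L1' L2' u' m (\<lambda>s. V s \<omega>) - ?val L1 L2 u n (\<lambda>s. V s \<omega>)\<bar> \<le> \<epsilon>}"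
          unfolding ev_def by (subst abs_minus_commute) (rule refl)
        show ?thesis
        proof (rule suff_distant_cases[OF sd E4(1) L])
          assume "L1 + L1' + R < maxnorm (fst u - fst u')" "L1 + L2' + R < maxnorm (fst u - snd u')"
          then show ?thesis unfolding ev_def
            by (rule est[OF nm L(1,2) L(1) mx(1) sites1 disjI1[OF proj1]])
        next
          assume "L2 + L1' + R < maxnorm (snd u - fst u')" "L2 + L2' + R < maxnorm (snd u - snd u')"
          then show ?thesis unfolding ev_def
            by (rule est[OF nm L(1,2) L(2) mx(3) sites2 disjI2[OF proj2]])
        next
          assume "L1' + L1 + R < maxnorm (fst u' - fst u)" "L1' + L2 + R < maxnorm (fst u' - snd u)"
          then show ?thesis unfolding sym
            by (rule est[OF nm(2,1) L(3,4) L(3) mx(2) sites1 disjI1[OF proj1]])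
        next
          assume "L2' + L1 + R < maxnorm (snd u' - fst u)" "L2' + L2 + R < maxnorm (snd u' - snd u)"
          then show ?thesis unfolding sym
            by (rule est[OF nm(2,1) L(3,4) L(4) mx(4) sites2 disjI2[OF proj2]])
        qed
      qed
      \<comment> \<open>The lattice is countable, so outside one null set all site potentials are
        bounded at once. The reduction of eigenvalues to indexed min-max values is made only
        there.\<close>
      have "AE \<omega> in M. \<forall>s. \<bar>V s \<omega>\<bar> \<le> CV" unfolding AE_all_countable by (rule CV)
      then obtain N0 where N0: "{\<omega> \<in> space M. \<not> (\<forall>s. \<bar>V s \<omega>\<bar> \<le> CV)} \<subseteq> N0" "emeasure M N0 = 0" "N0 \<in> events"
        by (rule AE_E)
      let ?J = "?I L1 L2 u \<times> ?I L1' L2' u'"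
      let ?Z = "\<Union>p\<in>?J. ev (fst p) (snd p)"
      have finJ: "finite ?J" using card_I(1) by blast
      have evJ: "ev (fst p) (snd p) \<in> events \<and> prob (ev (fst p) (snd p)) \<le> 2 ^ CARD('d) * mx * r" if "p \<in> ?J" for p
        using that[unfolded mem_Times_iff] by (intro ev_est) blast+
      have Zm: "?Z \<in> events" using evJ finJ by (intro sets.finite_UN) auto
      have cover: "X \<subseteq> N0 \<union> ?Z"
      proof
        fix \<omega> assume \<omega>: "\<omega> \<in> X"
        show "\<omega> \<in> N0 \<union> ?Z"
        proof (cases "\<forall>s. \<bar>V s \<omega>\<bar> \<le> CV")
          case good: True
          let ?A = "\<lambda>L1 L2 u. spec (box2 L1 L2 u) (\<lambda>x. U x + two_pot V \<phi> x \<omega>) \<inter> {a..b}"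
          have inI: "\<exists>n\<in>?I l1 l2 w. E = ?val l1 l2 w n (\<lambda>s. V s \<omega>)" if "E \<in> ?A l1 l2 w" "1 < l1" "1 < l2" for E l1 l2 w
          proof -
            have "E \<in> spec (box2 l1 l2 w) (\<lambda>x. U x + two_pot V \<phi> x \<omega>)" "E \<le> b" using that(1) by simp_all
            from eigen[OF that(2,3) good this] show ?thesis by blast
          qed
          \<comment> \<open>Finiteness of the spectrum in the interval is a by-product of the
            indexing by min-max values.\<close>
          have fin: "finite (?A l1 l2 w)" if "1 < l1" "1 < l2" for l1 l2 w
          proof (rule finite_subset)
            show "?A l1 l2 w \<subseteq> (\<lambda>n. ?val l1 l2 w n (\<lambda>s. V s \<omega>)) ` ?I l1 l2 w"
              using inI[OF _ that] by blast
          qed (use card_I(1) in blast)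
          have sp: "spdist (?A L1 L2 u) (?A L1' L2' u') \<le> ereal \<epsilon>" and "\<omega> \<in> space M"
            using \<omega> unfolding X_def by blast+
          obtain E E' where EE: "E \<in> ?A L1 L2 u" "E' \<in> ?A L1' L2' u'" "\<bar>E - E'\<bar> \<le> \<epsilon>"
            by (rule spdist_finite_attained[OF sp fin[OF L(1,2)] fin[OF L(3,4)]])
          obtain n where n: "n \<in> ?I L1 L2 u" "E = ?val L1 L2 u n (\<lambda>s. V s \<omega>)" using inI[OF EE(1) L(1,2)] by blast
          obtain m where m: "m \<in> ?I L1' L2' u'" "E' = ?val L1' L2' u' m (\<lambda>s. V s \<omega>)" using inI[OF EE(2) L(3,4)] by blast
          have "\<omega> \<in> ev n m" using EE(3) n(2) m(2) \<open>\<omega> \<in> space M\<close> by (simp add: ev_def)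
          then have "\<omega> \<in> ?Z" using n(1) m(1) by (intro UN_I[of "(n, m)"]) auto
          then show ?thesis by blast
        next
          case False
          then show ?thesis using N0(1) \<omega> by (auto simp: X_def)
        qed
      qed
      have Zle: "prob ?Z \<le> C * m1 * m2 * mx * r"
      proof -
        have "prob ?Z \<le> (\<Sum>p\<in>?J. prob (ev (fst p) (snd p)))"
          using evJ finJ by (intro finite_measure_subadditive_finite) auto
        also have "\<dots> \<le> (\<Sum>p\<in>?J. 2 ^ CARD('d) * mx * r)" using evJ by (intro sum_mono) blast
        also have "\<dots> = (real (card (?I L1 L2 u)) * real (card (?I L1' L2' u'))) * (2 ^ CARD('d) * mx * r)"
          by (simp add: card_cartesian_product)
        also have "\<dots> \<le> ((C1 * m1) * (C1 * m2)) * (2 ^ CARD('d) * mx * r)"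
          unfolding m1_def m2_def using C1 r0 mxpos
          by (intro mult_right_mono mult_mono card_I(2)) auto
        also have "\<dots> = C * m1 * m2 * mx * r" by (simp add: C_def)
        finally show ?thesis .
      qed
      have "outer_prob M X \<le> emeasure M (N0 \<union> ?Z)"
        unfolding outer_prob_def using cover N0(3) Zm by (intro INF_lower) auto
      also have "\<dots> \<le> emeasure M N0 + emeasure M ?Z" using N0(3) Zm by (rule emeasure_subadditive)
      also have "\<dots> = ennreal (prob ?Z)" using N0(2) by (simp add: emeasure_eq_measure)
      also have "\<dots> \<le> ennreal (C * m1 * m2 * mx * r)" using Zle by (rule ennreal_leI)
      finally have "enn2ereal (outer_prob M X) \<le> enn2ereal (ennreal (C * m1 * m2 * mx * r))"
        by (simp add: less_eq_ennreal.rep_eq)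
      also have "\<dots> = ereal (C * m1 * m2 * mx * r)" using Cpos r0 by (intro enn2ereal_ennreal) (simp add: mult_nonneg_nonneg)
      finally show ?thesis by (simp add: real)
    qed
    then show "enn2ereal (outer_prob M {\<omega> \<in> space M.
              spdist (spec (box2 L1 L2 u) (\<lambda>x. U x + two_pot V \<phi> x \<omega>) \<inter> {a..b})
                     (spec (box2 L1' L2' u') (\<lambda>x. U x + two_pot V \<phi> x \<omega>) \<inter> {a..b}) \<le> ereal \<epsilon>})
           \<le> ereal (C * measure lborel (box2 L1 L2 u) * measure lborel (box2 L1' L2' u')
                    * Max {measure lborel (cube L1 (fst u)), measure lborel (cube L1' (fst u')),
                           measure lborel (cube L2 (snd u)), measure lborel (cube L2' (snd u'))})
             * nu M V (2 * \<epsilon>)"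
      unfolding X_def m1_def m2_def mx_def .
  qed
qed

end
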